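(* Let $T\in\mathcal{BC}(X)$ and let $f\in N(\sigma_S(T))$. If $g\in SH_L(\sigma_S(T))$, then $$(\overline{\mathcal D}(fg))(T)=f(T)(\overline{\mathcal D}g)(T)+(\overline{\mathcal D}f)(T)g(T)-(\mathcal Df)(T)\,\underline T\,(\mathcal Dg)(T).$$ If $g\in SH_R(\sigma_S(T))$, then $$((gf)\overline{\mathcal D})(T)=g(T)(\overline{\mathcal D}f)(T)+(g\overline{\mathcal D})(T)f(T)-(g\mathcal D)(T)\,\underline T\,(\mathcal Df)(T).$$ Here $\underline T=T_1e_1+T_2e_2+T_3e_3$.
   Context: $\mathbb H$: quaternions with units $e_1,e_2,e_3$. $\mathbb S$: imaginary units ($J^2=-1$). $\mathbb C_J=\mathbb R+J\mathbb R$. $\mathcal D=\partial_{q_0}+\sum_{i=1}^3e_i\partial_{q_i}$, $\overline{\mathcal D}=\partial_{q_0}-\sum_{i=1}^3e_i\partial_{q_i}$ (acting from the left as $\mathcal Df$, from the right as $f\mathcal D$). A set $U\subseteq\mathbb H$ is axially symmetric if $u+Iv\in U$ implies $u+Jv\in U$ for all $J\in\mathbb S$. A slice Cauchy domain is an axially symmetric open $U$ such that for every $J\in\mathbb S$ the boundary of $U\cap\mathbb C_J$ is a finite union of nonintersecting piecewise $C^1$ Jordan curves. On an axially symmetric open $U$, $f$ is left (right) slice hyperholomorphic if $f(u+Jv)=\alpha(u,v)+J\beta(u,v)$ (resp. $\alpha(u,v)+\beta(u,v)J$) with $\mathbb H$-valued differentiable $\alpha$ even in $v$, $\beta$ odd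 in $v$, and $\partial_u\alpha=\partial_v\beta$, $\partial_v\alpha=-\partial_u\beta$; it is intrinsic if $\alpha,\beta$ are real valued. $X=X_{\mathbb R}\otimes\mathbb H$ is a two-sided quaternionic Banach module, $X_{\mathbb R}$ a real Banach space; $\mathcal B(X)$ is the space of bounded right linear operators; $(aT)(x)=aT(x)$, $(Ta)(x)=T(ax)$ for $a\in\mathbb H$. $\mathcal{BC}(X)$: operators $T=T_0+T_1e_1+T_2e_2+T_3e_3$ with pairwise commuting $T_i\in\mathcal B(X_{\mathbb R})$; $\overline T=T_0-T_1e_1-T_2e_2-T_3e_3$. $\rho_S(T)=\{s\in\mathbb H:(T^2-2\mathrm{Re}(s)T+|s|^2\mathcal I)^{-1}\in\mathcal B(X)\}$, $\sigma_S(T)=\mathbb H\setminus\rho_S(T)$; for $T\in\mathcal{BC}(X)$, $\rho_S(T)$ is also the set of $s$ with $\mathcal Q_{c,s}(T):=s^2-s(T+\overline T)+T\overline T$ invertible in $\mathcal B(X)$. $SH_L(\sigma_S(T))$, $SH_R(\sigma_S(T))$, $N(\sigma_S(T))$: left, right, intrinsic slice hyperholomorphic functions whose (axially symmetric open) domain contains $\sigma_S(T)$. For $s\in\rho_S(T)$: $S^{-1}_L(s,T)=(s\mathcal I-\overline T)\mathcal Q_{c,s}(T)^{-1}$, $S^{-1}_R(s,T)=\mathcal Q_{c,s}(T)^{-1}(s\mathcal I-\overline T)$, $F_L(s,T)=-4(s\mathcal I-\overline T)\mathcal Q_{c,s}(T)^{-2}$, $F_R(s,T)=-4\mathcal Q_{c,s}(T)^{-2}(s\mathcal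 I-\overline T)$, $\mathcal P^L_2(s,T)=-F_L(s,T)s+T_0F_L(s,T)$, $\mathcal P^R_2(s,T)=-sF_R(s,T)+T_0F_R(s,T)$. Functional calculi: let $J\in\mathbb S$, $ds_J=ds(-J)$, and $U$ a bounded slice Cauchy domain with $\sigma_S(T)\subset U$, $\overline U\subset\mathrm{dom}(f)$ (the integrals do not depend on $U,J$). For $f$ left slice hyperholomorphic: $f(T)=\frac1{2\pi}\int_{\partial(U\cap\mathbb C_J)}S_L^{-1}(s,T)ds_Jf(s)$, $(\mathcal Df)(T)=-\frac1\pi\int_{\partial(U\cap\mathbb C_J)}\mathcal Q_{c,s}(T)^{-1}ds_Jf(s)$, $(\overline{\mathcal D}f)(T)=\frac1{2\pi}\int_{\partial(U\cap\mathbb C_J)}\mathcal P^L_2(s,T)ds_Jf(s)$. For $f$ right slice hyperholomorphic: $f(T)=\frac1{2\pi}\int f(s)ds_JS_R^{-1}(s,T)$, $(f\mathcal D)(T)=-\frac1\pi\int f(s)ds_J\mathcal Q_{c,s}(T)^{-1}$, $(f\overline{\mathcal D})(T)=\frac1{2\pi}\int f(s)ds_J\mathcal P^R_2(s,T)$, over the same contour. For intrinsic $f$ left and right versions coincide. *)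

theory Defs
  imports "HOL-Complex_Analysis.Complex_Analysis"
begin

section \<open>Quaternions\<close>

text \<open>\<open>Quat a b c d\<close> stands for \<open>a + b e\<^sub>1 + c e\<^sub>2 + d e\<^sub>3\<close> with \<open>e\<^sub>1 e\<^sub>2 = e\<^sub>3\<close>.\<close>

datatype quat = Quat (qre: real) (qim1: real) (qim2: real) (qim3: real)

lemma quat_eq_iff: "x = y \<longleftrightarrow> qre x = qre y \<and> qim1 x = qim1 y \<and> qim2 x = qim2 y \<and> qim3 x = qim3 y"
  by (cases x; cases y) simp

instantiation quat :: real_algebra_1
begin

definition "0 = Quat 0 0 0 0"
definition "1 = Quat 1 0 0 0"
definition "x + y = Quat (qre x + qre y) (qim1 x + qim1 y) (qim2 x + qim2 y) (qim3 x + qim3 y)"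
definition "- x = Quat (- qre x) (- qim1 x) (- qim2 x) (- qim3 x)"
definition "x - y = Quat (qre x - qre y) (qim1 x - qim1 y) (qim2 x - qim2 y) (qim3 x - qim3 y)"
definition "x * y = Quat
  (qre x * qre y - qim1 x * qim1 y - qim2 x * qim2 y - qim3 x * qim3 y)
  (qre x * qim1 y + qim1 x * qre y + qim2 x * qim3 y - qim3 x * qim2 y)
  (qre x * qim2 y - qim1 x * qim3 y + qim2 x * qre y + qim3 x * qim1 y)
  (qre x * qim3 y + qim1 x * qim2 y - qim2 x * qim1 y + qim3 x * qre y)"
definition "r *\<^sub>R x = Quat (r * qre x) (r * qim1 x) (r * qim2 x) (r * qim3 x)"

lemmas quat_arith_defs = zero_quat_def one_quat_def plus_quat_def uminus_quat_def minus_quat_def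
  times_quat_def scaleR_quat_def

instance
  by standard (simp_all add: quat_arith_defs algebra_simps)

end

instantiation quat :: real_normed_div_algebra
begin

definition "norm x = sqrt ((qre x)\<^sup>2 + (qim1 x)\<^sup>2 + (qim2 x)\<^sup>2 + (qim3 x)\<^sup>2)"
definition "inverse x = (1 / (norm x)\<^sup>2) *\<^sub>R Quat (qre x) (- qim1 x) (- qim2 x) (- qim3 x)"
definition "(x::quat) div y = x * inverse y"
definition sgn_quat_def: "sgn x = x /\<^sub>R norm (x::quat)"
definition dist_quat_def: "dist x y = norm (x - y :: quat)"
definition uniformity_quat_def [code del]:
  "(uniformity :: (quat \<times> quat) filter) = (INF e\<in>{0 <..}. principal {(x, y). dist x y < e})"
definition open_quat_def [code del]:
  "open (U :: quat set) \<longleftrightarrow> (\<forall>x\<in>U. eventually (\<lambda>(x', y). x' = x \<longrightarrow> y \<in> U) uniformity)"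

lemma quat_norm_sq: "(norm x)\<^sup>2 = (qre x)\<^sup>2 + (qim1 x)\<^sup>2 + (qim2 x)\<^sup>2 + (qim3 x)\<^sup>2" for x :: quat
  by (simp add: norm_quat_def)

lemma quat_norm_eq_0: "norm x = 0 \<longleftrightarrow> x = 0" for x :: quat
proof -
  have "norm x = 0 \<longleftrightarrow> (qre x)\<^sup>2 + (qim1 x)\<^sup>2 + (qim2 x)\<^sup>2 + (qim3 x)\<^sup>2 = 0"
    by (simp add: norm_quat_def)
  also have "\<dots> \<longleftrightarrow> x = 0"
    by (auto simp: quat_eq_iff zero_quat_def add_nonneg_eq_0_iff)
  finally show ?thesis .
qed

lemma quat_norm_Pair: "norm x = norm (qre x, qim1 x, qim2 x, qim3 x)" for x :: quat
  by (simp add: norm_quat_def norm_Pair add.assoc)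

instance
proof
  fix a b :: real and x y z :: quat and U :: "quat set"
  show "norm x = 0 \<longleftrightarrow> x = 0" by (rule quat_norm_eq_0)
  show "norm (x + y) \<le> norm x + norm y"
    using norm_triangle_ineq[of "(qre x, qim1 x, qim2 x, qim3 x)" "(qre y, qim1 y, qim2 y, qim3 y)"]
    by (simp add: quat_norm_Pair plus_quat_def)
  show "norm (a *\<^sub>R x) = \<bar>a\<bar> * norm x"
    using norm_scaleR[of a "(qre x, qim1 x, qim2 x, qim3 x)"]
    by (simp add: quat_norm_Pair scaleR_quat_def)
  show "norm (x * y) = norm x * norm y"
    unfolding norm_quat_def real_sqrt_mult[symmetric]
    by (rule arg_cong[of _ _ sqrt]) (simp add: times_quat_def power2_eq_square algebra_simps)
  show "inverse x * x = 1" if "x \<noteq> 0"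
  proof -
    have "(norm x)\<^sup>2 \<noteq> 0" using that quat_norm_eq_0 by simp
    then show ?thesis
      unfolding quat_norm_sq inverse_quat_def
      by (simp add: quat_eq_iff times_quat_def scaleR_quat_def one_quat_def
          add_divide_distrib [symmetric] power2_eq_square algebra_simps)
  qed
  show "x * inverse x = 1" if "x \<noteq> 0"
  proof -
    have "(norm x)\<^sup>2 \<noteq> 0" using that quat_norm_eq_0 by simp
    then show ?thesis
      unfolding quat_norm_sq inverse_quat_def
      by (simp add: quat_eq_iff times_quat_def scaleR_quat_def one_quat_def
          add_divide_distrib [symmetric] power2_eq_square algebra_simps)
  qed
  show "inverse 0 = (0::quat)"
    by (simp add: inverse_quat_def zero_quat_def scaleR_quat_def)
qed (rule divide_quat_def sgn_quat_def dist_quat_def uniformity_quat_def open_quat_def)+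

end

definition quat_e1 :: quat where "quat_e1 = Quat 0 1 0 0"
definition quat_e2 :: quat where "quat_e2 = Quat 0 0 1 0"
definition quat_e3 :: quat where "quat_e3 = Quat 0 0 0 1"

lemma quat_units:
  "quat_e1 * quat_e1 = -1" "quat_e2 * quat_e2 = -1" "quat_e3 * quat_e3 = -1"
  "quat_e1 * quat_e2 = quat_e3" "quat_e2 * quat_e3 = quat_e1" "quat_e3 * quat_e1 = quat_e2"
  by (simp_all add: quat_e1_def quat_e2_def quat_e3_def quat_arith_defs)

definition imag_units :: "quat set" where
  "imag_units = {J. J * J = -1}"


section \<open>Slice hyperholomorphic functions\<close>

text \<open>The plane \<open>\<complex>\<^sub>J\<close> is identified with \<^typ>\<open>complex\<close> through \<open>u + \<i>v \<mapsto> u + Jv\<close>.\<close>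

definition slice_emb :: "quat \<Rightarrow> complex \<Rightarrow> quat" where
  "slice_emb J z = of_real (Re z) + J * of_real (Im z)"

definition slice :: "quat \<Rightarrow> quat set \<Rightarrow> complex set" where
  "slice J U = {z. slice_emb J z \<in> U}"

definition axially_symmetric :: "quat set \<Rightarrow> bool" where
  "axially_symmetric U \<longleftrightarrow>
    (\<forall>I\<in>imag_units. \<forall>J\<in>imag_units. \<forall>u v :: real.
      of_real u + I * of_real v \<in> U \<longrightarrow> of_real u + J * of_real v \<in> U)"

text \<open>The pairs \<open>(u, v)\<close> with \<open>u + Jv \<in> D\<close>; for axially symmetric \<open>D\<close> the choice of \<open>J\<close> is
  immaterial.\<close>

definition slice_params :: "quat set \<Rightarrow> (real \<times> real) set" where
  "slice_params D = {(u, v). \<exists>J\<in>imag_units. of_real u + J * of_real v \<in> D}"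

text \<open>The conditions on the pair \<open>(\<alpha>, \<beta>)\<close>: parity in \<open>v\<close>, differentiability and the Cauchy--Riemann
  system \<open>\<partial>\<^sub>u \<alpha> = \<partial>\<^sub>v \<beta>\<close>, \<open>\<partial>\<^sub>v \<alpha> = - \<partial>\<^sub>u \<beta>\<close>; the partial derivatives are the values of the Frechet
  derivative at \<open>(1, 0)\<close> and \<open>(0, 1)\<close>.\<close>

definition stem_pair :: "quat set \<Rightarrow> (real \<times> real \<Rightarrow> quat) \<Rightarrow> (real \<times> real \<Rightarrow> quat) \<Rightarrow> bool" where
  "stem_pair D \<alpha> \<beta> \<longleftrightarrow>
    (\<forall>(u, v) \<in> slice_params D.
      \<alpha> (u, - v) = \<alpha> (u, v) \<and> \<beta> (u, - v) = - \<beta> (u, v) \<and>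
      \<alpha> differentiable (at (u, v)) \<and> \<beta> differentiable (at (u, v)) \<and>
      frechet_derivative \<alpha> (at (u, v)) (1, 0) = frechet_derivative \<beta> (at (u, v)) (0, 1) \<and>
      frechet_derivative \<alpha> (at (u, v)) (0, 1) = - frechet_derivative \<beta> (at (u, v)) (1, 0))"

definition left_slice_hyp :: "quat set \<Rightarrow> (quat \<Rightarrow> quat) \<Rightarrow> bool" where
  "left_slice_hyp D f \<longleftrightarrow> (\<exists>\<alpha> \<beta>. stem_pair D \<alpha> \<beta> \<and>
    (\<forall>(u, v) \<in> slice_params D. \<forall>J\<in>imag_units.
      f (of_real u + J * of_real v) = \<alpha> (u, v) + J * \<beta> (u, v)))"

definition right_slice_hyp :: "quat set \<Rightarrow> (quat \<Rightarrow> quat) \<Rightarrow> bool" where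
  "right_slice_hyp D f \<longleftrightarrow> (\<exists>\<alpha> \<beta>. stem_pair D \<alpha> \<beta> \<and>
    (\<forall>(u, v) \<in> slice_params D. \<forall>J\<in>imag_units.
      f (of_real u + J * of_real v) = \<alpha> (u, v) + \<beta> (u, v) * J))"

definition intrinsic_slice_hyp :: "quat set \<Rightarrow> (quat \<Rightarrow> quat) \<Rightarrow> bool" where
  "intrinsic_slice_hyp D f \<longleftrightarrow> (\<exists>\<alpha> \<beta>. stem_pair D \<alpha> \<beta> \<and>
    (\<forall>(u, v) \<in> slice_params D. \<alpha> (u, v) \<in> \<real> \<and> \<beta> (u, v) \<in> \<real> \<and>
      (\<forall>J\<in>imag_units. f (of_real u + J * of_real v) = \<alpha> (u, v) + J * \<beta> (u, v))))"

text \<open>The classes \<open>SH\<^sub>L(K)\<close>, \<open>SH\<^sub>R(K)\<close> and \<open>N(K)\<close>. A function is given together with its domain,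
  as a pair \<open>(D, f)\<close>; the values of \<open>f\<close> outside \<open>D\<close> are irrelevant.\<close>

definition SH_L :: "quat set \<Rightarrow> (quat set \<times> (quat \<Rightarrow> quat)) set" where
  "SH_L K = {(D, f). open D \<and> axially_symmetric D \<and> K \<subseteq> D \<and> left_slice_hyp D f}"

definition SH_R :: "quat set \<Rightarrow> (quat set \<times> (quat \<Rightarrow> quat)) set" where
  "SH_R K = {(D, f). open D \<and> axially_symmetric D \<and> K \<subseteq> D \<and> right_slice_hyp D f}"

definition SH_intrinsic :: "quat set \<Rightarrow> (quat set \<times> (quat \<Rightarrow> quat)) set" where
  "SH_intrinsic K = {(D, f). open D \<and> axially_symmetric D \<and> K \<subseteq> D \<and> intrinsic_slice_hyp D f}"


section \<open>Slice Cauchy domains and contours\<close>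

definition jordan_system :: "(real \<Rightarrow> complex) set \<Rightarrow> complex set \<Rightarrow> bool" where
  "jordan_system \<Gamma> B \<longleftrightarrow> finite \<Gamma> \<and>
    (\<forall>\<gamma>\<in>\<Gamma>. valid_path \<gamma> \<and> simple_path \<gamma> \<and> pathfinish \<gamma> = pathstart \<gamma>) \<and>
    pairwise (\<lambda>\<gamma> \<delta>. path_image \<gamma> \<inter> path_image \<delta> = {}) \<Gamma> \<and>
    (\<Union>\<gamma>\<in>\<Gamma>. path_image \<gamma>) = B"

text \<open>The boundary of \<open>U \<inter> \<complex>\<^sub>J\<close> is taken relative to the plane \<open>\<complex>\<^sub>J\<close>.\<close>

definition slice_cauchy_domain :: "quat set \<Rightarrow> bool" where
  "slice_cauchy_domain U \<longleftrightarrow> open U \<and> axially_symmetric U \<and>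
    (\<forall>J\<in>imag_units. \<exists>\<Gamma>. jordan_system \<Gamma> (frontier (slice J U)))"

text \<open>A parametrisation of \<open>\<partial>\<Omega>\<close> with the positive orientation (\<open>\<Omega>\<close> lies to the left of the curves):
  the curves wind once around the points of \<open>\<Omega>\<close> and do not wind around exterior points.\<close>

definition oriented_boundary :: "complex set \<Rightarrow> (real \<Rightarrow> complex) set \<Rightarrow> bool" where
  "oriented_boundary \<Omega> \<Gamma> \<longleftrightarrow> jordan_system \<Gamma> (frontier \<Omega>) \<and>
    (\<forall>z\<in>\<Omega>. (\<Sum>\<gamma>\<in>\<Gamma>. winding_number \<gamma> z) = 1) \<and>
    (\<forall>z. z \<notin> closure \<Omega> \<longrightarrow> (\<Sum>\<gamma>\<in>\<Gamma>. winding_number \<gamma> z) = 0)"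

text \<open>\<open>(J, \<Gamma>) \<in> contours K D\<close> means that \<open>\<Gamma>\<close> parametrises \<open>\<partial>(U \<inter> \<complex>\<^sub>J)\<close> for some bounded slice Cauchy
  domain \<open>U\<close> with \<open>K \<subseteq> U\<close> and \<open>closure U \<subseteq> D\<close>.\<close>

definition contours :: "quat set \<Rightarrow> quat set \<Rightarrow> (quat \<times> (real \<Rightarrow> complex) set) set" where
  "contours K D = {(J, \<Gamma>). J \<in> imag_units \<and>
    (\<exists>U. bounded U \<and> slice_cauchy_domain U \<and> K \<subseteq> U \<and> closure U \<subseteq> D \<and>
      oriented_boundary (slice J U) \<Gamma>)}"


section \<open>The quaternionic Banach module and its operators\<close>

text \<open>For a real Banach space \<open>'x\<close>, the tuple \<open>(x\<^sub>0, x\<^sub>1, x\<^sub>2, x\<^sub>3) :: 'x qmod\<close> stands for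
  \<open>x\<^sub>0 + x\<^sub>1 e\<^sub>1 + x\<^sub>2 e\<^sub>2 + x\<^sub>3 e\<^sub>3\<close> in \<open>'x \<otimes> \<H>\<close>.\<close>

type_synonym 'x qmod = "'x \<times> 'x \<times> 'x \<times> 'x"
type_synonym 'x qop = "'x qmod \<Rightarrow>\<^sub>L 'x qmod"

fun left_scale :: "quat \<Rightarrow> 'x::real_normed_vector qmod \<Rightarrow> 'x qmod" where
  "left_scale (Quat a b c d) (x0, x1, x2, x3) =
    (a *\<^sub>R x0 - b *\<^sub>R x1 - c *\<^sub>R x2 - d *\<^sub>R x3,
     a *\<^sub>R x1 + b *\<^sub>R x0 + c *\<^sub>R x3 - d *\<^sub>R x2,
     a *\<^sub>R x2 - b *\<^sub>R x3 + c *\<^sub>R x0 + d *\<^sub>R x1,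
     a *\<^sub>R x3 + b *\<^sub>R x2 - c *\<^sub>R x1 + d *\<^sub>R x0)"

fun right_scale :: "'x::real_normed_vector qmod \<Rightarrow> quat \<Rightarrow> 'x qmod" where
  "right_scale (x0, x1, x2, x3) (Quat a b c d) =
    (a *\<^sub>R x0 - b *\<^sub>R x1 - c *\<^sub>R x2 - d *\<^sub>R x3,
     b *\<^sub>R x0 + a *\<^sub>R x1 + d *\<^sub>R x2 - c *\<^sub>R x3,
     c *\<^sub>R x0 - d *\<^sub>R x1 + a *\<^sub>R x2 + b *\<^sub>R x3,
     d *\<^sub>R x0 + c *\<^sub>R x1 - b *\<^sub>R x2 + a *\<^sub>R x3)"

lemma left_right_scale_assoc:
  "left_scale (p * q) x = left_scale p (left_scale q x)"
  "right_scale x (p * q) = right_scale (right_scale x p) q"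
  "left_scale p (right_scale x q) = right_scale (left_scale p x) q"
  by (cases p; cases q; cases x; simp add: times_quat_def algebra_simps)+

lemma bounded_linear_left_scale:
  "bounded_linear (left_scale q :: 'x::real_normed_vector qmod \<Rightarrow> 'x qmod)"
proof -
  have "left_scale q = (\<lambda>x :: 'x qmod.
     (qre q *\<^sub>R fst x - qim1 q *\<^sub>R fst (snd x) - qim2 q *\<^sub>R fst (snd (snd x)) - qim3 q *\<^sub>R snd (snd (snd x)),
      qre q *\<^sub>R fst (snd x) + qim1 q *\<^sub>R fst x + qim2 q *\<^sub>R snd (snd (snd x)) - qim3 q *\<^sub>R fst (snd (snd x)),
      qre q *\<^sub>R fst (snd (snd x)) - qim1 q *\<^sub>R snd (snd (snd x)) + qim2 q *\<^sub>R fst x + qim3 q *\<^sub>R fst (snd x),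
      qre q *\<^sub>R snd (snd (snd x)) + qim1 q *\<^sub>R fst (snd (snd x)) - qim2 q *\<^sub>R fst (snd x) + qim3 q *\<^sub>R fst x))"
    by (cases q) auto
  moreover have "bounded_linear \<dots>"
    by (intro bounded_linear_intros)
  ultimately show ?thesis
    by simp
qed

text \<open>The bounded operators of left multiplication by a quaternion; with the conventions
  \<open>(aT)(x) = a T(x)\<close> and \<open>(Ta)(x) = T(ax)\<close>, the operators \<open>aT\<close> and \<open>Ta\<close> are
  \<open>lmul a o\<^sub>L T\<close> and \<open>T o\<^sub>L lmul a\<close>.\<close>

lift_definition lmul :: "quat \<Rightarrow> 'x::real_normed_vector qop" is left_scale
  by (rule bounded_linear_left_scale)

lift_definition real_op :: "('x::real_normed_vector \<Rightarrow>\<^sub>L 'x) \<Rightarrow> 'x qop" is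
  "\<lambda>A (x0, x1, x2, x3). (A x0, A x1, A x2, A x3)"
  unfolding case_prod_beta
  by (intro bounded_linear_Pair;
      erule bounded_linear_compose, intro bounded_linear_intros)

text \<open>\<open>\<B>(X)\<close>: bounded right linear operators. (Additivity and boundedness are part of the type
  \<^typ>\<open>'x qop\<close>.)\<close>

definition right_linear_ops :: "'x::real_normed_vector qop set" where
  "right_linear_ops = {T. \<forall>x q. blinfun_apply T (right_scale x q) = right_scale (blinfun_apply T x) q}"

definition qop :: "('x::real_normed_vector \<Rightarrow>\<^sub>L 'x) \<Rightarrow> ('x \<Rightarrow>\<^sub>L 'x) \<Rightarrow> ('x \<Rightarrow>\<^sub>L 'x) \<Rightarrow> ('x \<Rightarrow>\<^sub>L 'x) \<Rightarrow> 'x qop"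
  where "qop T0 T1 T2 T3 = real_op T0 + (real_op T1 o\<^sub>L lmul quat_e1) +
    (real_op T2 o\<^sub>L lmul quat_e2) + (real_op T3 o\<^sub>L lmul quat_e3)"

definition commuting_ops :: "'x::real_normed_vector qop set" where
  "commuting_ops = {qop T0 T1 T2 T3 | T0 T1 T2 T3.
    T0 o\<^sub>L T1 = T1 o\<^sub>L T0 \<and> T0 o\<^sub>L T2 = T2 o\<^sub>L T0 \<and> T0 o\<^sub>L T3 = T3 o\<^sub>L T0 \<and>
    T1 o\<^sub>L T2 = T2 o\<^sub>L T1 \<and> T1 o\<^sub>L T3 = T3 o\<^sub>L T1 \<and> T2 o\<^sub>L T3 = T3 o\<^sub>L T2}"

text \<open>The components \<open>T\<^sub>0, \<dots>, T\<^sub>3\<close> are read off from the restriction of \<open>T\<close> to \<open>'x\<close>.\<close>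

lift_definition real_incl :: "'x::real_normed_vector \<Rightarrow>\<^sub>L 'x qmod" is "\<lambda>x. (x, 0, 0, 0)"
  by (intro bounded_linear_intros)

definition comp0 :: "'x::real_normed_vector qop \<Rightarrow> ('x \<Rightarrow>\<^sub>L 'x)" where
  "comp0 T = fst_blinfun o\<^sub>L T o\<^sub>L real_incl"
definition comp1 :: "'x::real_normed_vector qop \<Rightarrow> ('x \<Rightarrow>\<^sub>L 'x)" where
  "comp1 T = fst_blinfun o\<^sub>L snd_blinfun o\<^sub>L T o\<^sub>L real_incl"
definition comp2 :: "'x::real_normed_vector qop \<Rightarrow> ('x \<Rightarrow>\<^sub>L 'x)" where
  "comp2 T = fst_blinfun o\<^sub>L snd_blinfun o\<^sub>L snd_blinfun o\<^sub>L T o\<^sub>L real_incl"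
definition comp3 :: "'x::real_normed_vector qop \<Rightarrow> ('x \<Rightarrow>\<^sub>L 'x)" where
  "comp3 T = snd_blinfun o\<^sub>L snd_blinfun o\<^sub>L snd_blinfun o\<^sub>L T o\<^sub>L real_incl"

lemma comp_qop [simp]:
  "comp0 (qop T0 T1 T2 T3) = T0" "comp1 (qop T0 T1 T2 T3) = T1"
  "comp2 (qop T0 T1 T2 T3) = T2" "comp3 (qop T0 T1 T2 T3) = T3"
  by (auto intro!: blinfun_eqI simp: comp0_def comp1_def comp2_def comp3_def qop_def real_op.rep_eq
      lmul.rep_eq real_incl.rep_eq quat_e1_def quat_e2_def quat_e3_def blinfun.add_left
      blinfun.zero_right)

lemma qop_right_linear: "qop T0 T1 T2 T3 \<in> right_linear_ops"
  unfolding right_linear_ops_def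
proof safe
  fix x0 x1 x2 x3 q
  show "blinfun_apply (qop T0 T1 T2 T3) (right_scale (x0, x1, x2, x3) q) =
    right_scale (blinfun_apply (qop T0 T1 T2 T3) (x0, x1, x2, x3)) q"
    by (cases q) (simp add: qop_def real_op.rep_eq lmul.rep_eq quat_e1_def quat_e2_def quat_e3_def
        blinfun.add_left blinfun.add_right blinfun.diff_right blinfun.scaleR_right
        blinfun.minus_right algebra_simps)
qed

definition conj_op :: "'x::real_normed_vector qop \<Rightarrow> 'x qop" where
  "conj_op T = qop (comp0 T) (- comp1 T) (- comp2 T) (- comp3 T)"

definition vec_op :: "'x::real_normed_vector qop \<Rightarrow> 'x qop" where
  "vec_op T = qop 0 (comp1 T) (comp2 T) (comp3 T)"

definition is_op_inverse :: "'x::real_normed_vector qop \<Rightarrow> 'x qop \<Rightarrow> bool" where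
  "is_op_inverse A B \<longleftrightarrow> B \<in> right_linear_ops \<and> A o\<^sub>L B = id_blinfun \<and> B o\<^sub>L A = id_blinfun"

definition op_inv :: "'x::real_normed_vector qop \<Rightarrow> 'x qop" where
  "op_inv A = (THE B. is_op_inverse A B)"

definition S_resolvent_set :: "'x::real_normed_vector qop \<Rightarrow> quat set" where
  "S_resolvent_set T =
    {s. \<exists>B. is_op_inverse ((T o\<^sub>L T) - (2 * qre s) *\<^sub>R T + (norm s)\<^sup>2 *\<^sub>R id_blinfun) B}"

definition S_spectrum :: "'x::real_normed_vector qop \<Rightarrow> quat set" where
  "S_spectrum T = - S_resolvent_set T"


section \<open>Resolvent kernels\<close>

definition Q_c :: "quat \<Rightarrow> 'x::real_normed_vector qop \<Rightarrow> 'x qop" where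
  "Q_c s T = lmul (s * s) - (lmul s o\<^sub>L (T + conj_op T)) + (T o\<^sub>L conj_op T)"

definition S_res_L :: "quat \<Rightarrow> 'x::real_normed_vector qop \<Rightarrow> 'x qop" where
  "S_res_L s T = (lmul s - conj_op T) o\<^sub>L op_inv (Q_c s T)"

definition S_res_R :: "quat \<Rightarrow> 'x::real_normed_vector qop \<Rightarrow> 'x qop" where
  "S_res_R s T = op_inv (Q_c s T) o\<^sub>L (lmul s - conj_op T)"

definition F_res_L :: "quat \<Rightarrow> 'x::real_normed_vector qop \<Rightarrow> 'x qop" where
  "F_res_L s T = (-4) *\<^sub>R ((lmul s - conj_op T) o\<^sub>L (op_inv (Q_c s T) o\<^sub>L op_inv (Q_c s T)))"

definition F_res_R :: "quat \<Rightarrow> 'x::real_normed_vector qop \<Rightarrow> 'x qop" where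
  "F_res_R s T = (-4) *\<^sub>R ((op_inv (Q_c s T) o\<^sub>L op_inv (Q_c s T)) o\<^sub>L (lmul s - conj_op T))"

definition P2_L :: "quat \<Rightarrow> 'x::real_normed_vector qop \<Rightarrow> 'x qop" where
  "P2_L s T = - (F_res_L s T o\<^sub>L lmul s) + (real_op (comp0 T) o\<^sub>L F_res_L s T)"

definition P2_R :: "quat \<Rightarrow> 'x::real_normed_vector qop \<Rightarrow> 'x qop" where
  "P2_R s T = - (lmul s o\<^sub>L F_res_R s T) + (real_op (comp0 T) o\<^sub>L F_res_R s T)"


section \<open>Functional calculi\<close>

text \<open>\<open>\<integral> K(s) ds\<^sub>J f(s)\<close> and \<open>\<integral> f(s) ds\<^sub>J K(s)\<close> over the contour \<open>(J, \<Gamma>)\<close>, with \<open>ds\<^sub>J = ds (- J)\<close>.\<close>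

definition slice_integral_L ::
    "quat \<times> (real \<Rightarrow> complex) set \<Rightarrow> (quat \<Rightarrow> 'x::banach qop) \<Rightarrow> (quat \<Rightarrow> quat) \<Rightarrow> 'x qop" where
  "slice_integral_L = (\<lambda>(J, \<Gamma>) K f. \<Sum>\<gamma>\<in>\<Gamma>. integral {0..1} (\<lambda>t.
     K (slice_emb J (\<gamma> t)) o\<^sub>L
     lmul (slice_emb J (vector_derivative \<gamma> (at t within {0..1})) * (- J)) o\<^sub>L
     lmul (f (slice_emb J (\<gamma> t)))))"

definition slice_integral_R ::
    "quat \<times> (real \<Rightarrow> complex) set \<Rightarrow> (quat \<Rightarrow> quat) \<Rightarrow> (quat \<Rightarrow> 'x::banach qop) \<Rightarrow> 'x qop" where
  "slice_integral_R = (\<lambda>(J, \<Gamma>) f K. \<Sum>\<gamma>\<in>\<Gamma>. integral {0..1} (\<lambda>t.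
     lmul (f (slice_emb J (\<gamma> t))) o\<^sub>L
     lmul (slice_emb J (vector_derivative \<gamma> (at t within {0..1})) * (- J)) o\<^sub>L
     K (slice_emb J (\<gamma> t))))"

text \<open>The operators \<open>f(T)\<close>, \<open>(D f)(T)\<close>, \<open>(Dbar f)(T)\<close> for left and \<open>f(T)\<close>, \<open>(f D)(T)\<close>, \<open>(f Dbar)(T)\<close>
  for right slice hyperholomorphic \<open>f\<close>, where \<open>D = \<partial>\<^sub>0 + e\<^sub>1\<partial>\<^sub>1 + e\<^sub>2\<partial>\<^sub>2 + e\<^sub>3\<partial>\<^sub>3\<close> and
  \<open>Dbar = \<partial>\<^sub>0 - e\<^sub>1\<partial>\<^sub>1 - e\<^sub>2\<partial>\<^sub>2 - e\<^sub>3\<partial>\<^sub>3\<close>. They are given by integrals over a contour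
  \<open>c \<in> contours (S_spectrum T) (dom f)\<close> and do not depend on the choice of \<open>c\<close>; statements about
  them quantify over all contours, separately for every term.\<close>

definition calc_L ::
    "quat \<times> (real \<Rightarrow> complex) set \<Rightarrow> (quat \<Rightarrow> quat) \<Rightarrow> 'x::banach qop \<Rightarrow> 'x qop" where
  "calc_L c f T = (1 / (2 * pi)) *\<^sub>R slice_integral_L c (\<lambda>s. S_res_L s T) f"
definition D_calc_L ::
    "quat \<times> (real \<Rightarrow> complex) set \<Rightarrow> (quat \<Rightarrow> quat) \<Rightarrow> 'x::banach qop \<Rightarrow> 'x qop" where
  "D_calc_L c f T = (- 1 / pi) *\<^sub>R slice_integral_L c (\<lambda>s. op_inv (Q_c s T)) f"
definition Dbar_calc_L ::
    "quat \<times> (real \<Rightarrow> complex) set \<Rightarrow> (quat \<Rightarrow> quat) \<Rightarrow> 'x::banach qop \<Rightarrow> 'x qop" where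
  "Dbar_calc_L c f T = (1 / (2 * pi)) *\<^sub>R slice_integral_L c (\<lambda>s. P2_L s T) f"

definition calc_R ::
    "quat \<times> (real \<Rightarrow> complex) set \<Rightarrow> (quat \<Rightarrow> quat) \<Rightarrow> 'x::banach qop \<Rightarrow> 'x qop" where
  "calc_R c f T = (1 / (2 * pi)) *\<^sub>R slice_integral_R c f (\<lambda>s. S_res_R s T)"
definition D_calc_R ::
    "quat \<times> (real \<Rightarrow> complex) set \<Rightarrow> (quat \<Rightarrow> quat) \<Rightarrow> 'x::banach qop \<Rightarrow> 'x qop" where
  "D_calc_R c f T = (- 1 / pi) *\<^sub>R slice_integral_R c f (\<lambda>s. op_inv (Q_c s T))"
definition Dbar_calc_R ::
    "quat \<times> (real \<Rightarrow> complex) set \<Rightarrow> (quat \<Rightarrow> quat) \<Rightarrow> 'x::banach qop \<Rightarrow> 'x qop" where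
  "Dbar_calc_R c f T = (1 / (2 * pi)) *\<^sub>R slice_integral_R c f (\<lambda>s. P2_R s T)"

end

theory Submission
  imports Defs
begin

text \<open>On a slice, \<open>\<Q>\<^sub>c,\<^sub>s(T) = s\<^sup>2 - 2 s T\<^sub>0 + T\<^sub>0\<^sup>2 + \<dots> + T\<^sub>3\<^sup>2\<close> commutes with \<open>J\<close>, so the weights
  \<open>M(f) = (2\<pi>\<i>)\<^sup>-\<^sup>1 \<integral> \<Q>\<^sub>c,\<^sub>s(T)\<^sup>-\<^sup>1 f(s) ds\<close> behave like the divided differences of \<open>f\<close> at the two roots of a
  quadratic polynomial. All operators of the theorem are expressed through them:
  \<open>f(T) = M(sf) - T* M(f)\<close>, \<open>(Df)(T) = -2 M(f)\<close> and, after an integration by parts,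
  \<open>(Dbar f)(T) = 2 M((sf)') - 2 T* M(f')\<close>, where \<open>T*\<close> is the conjugate of \<open>T\<close>. The resolvent identity
  gives \<open>M(fg) = M(sf) M(g) + M(f) M(sg) - 2 T\<^sub>0 M(f) M(g)\<close>, and the theorem for intrinsic \<open>f, g\<close> is
  then an algebraic identity. A slice hyperholomorphic \<open>g\<close> is a combination of four intrinsic
  functions with coefficients \<open>1, e\<^sub>1, e\<^sub>2, e\<^sub>3\<close>, on the right or on the left.\<close>

section \<open>Separation of points by bounded functionals\<close>

text \<open>A slice fixes a unit J, and T need not commute with J although the resolvent does.
  Operators are therefore made a complex vector space whose scalars act from the right, by
  \<open>A o\<^sub>L lmul J\<close>: every left factor, T* in particular, then passes through the
  integrals. Moving T to the other side of M(f) needs more, namely that M(f) is the same for J and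
  -J; this is where the symmetry f(cnj z) = cnj f(z) of intrinsic functions enters. Independence of
  J also makes the contours comparable, which may differ from term to term in the theorem.

  Operator integrals exist as gauge integrals because of local primitives, and identities between
  them are tested with complex linear functionals, which turn them into scalar integrals over
  cycles. This is the purpose of the separation theorem and of Cauchy's theorem for cycles.\<close>

definition sublinear_functional :: "('a::real_vector \<Rightarrow> real) \<Rightarrow> bool" where
  "sublinear_functional p \<longleftrightarrow> (\<forall>x y. p (x + y) \<le> p x + p y) \<and> (\<forall>r x. 0 \<le> r \<longrightarrow> p (r *\<^sub>R x) = r * p x)"

lemma sublinear_functionalD:
  assumes "sublinear_functional p"
  shows "p (x + y) \<le> p x + p y" "0 \<le> r \<Longrightarrow> p (r *\<^sub>R x) = r * p x" "p 0 = 0" "- p (- x) \<le> p x"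
proof -
  have add: "p (x + y) \<le> p x + p y" for x y
    using assms by (auto simp: sublinear_functional_def)
  have scale: "0 \<le> r \<Longrightarrow> p (r *\<^sub>R x) = r * p x" for r x
    using assms by (auto simp: sublinear_functional_def)
  show zero: "p 0 = 0" using scale[of 0 0] by simp
  show "- p (- x) \<le> p x" using add[of x "- x"] zero by simp
qed (use assms in \<open>auto simp: sublinear_functional_def\<close>)

text \<open>A minimal sublinear functional \<open>p\<close> is linear because it agrees with all its tilts \<open>tilt p y\<close>, and
  a linear functional below \<open>tilt norm x\<close> is at most \<open>- norm x\<close> at \<open>- x\<close>.\<close>

definition tilt :: "('a::real_vector \<Rightarrow> real) \<Rightarrow> 'a \<Rightarrow> 'a \<Rightarrow> real" where
  "tilt p y x = (INF t\<in>{0..}. p (x + t *\<^sub>R y) - t * p y)"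

text \<open>Without a lower bound the infimum in \<open>tilt\<close> would be an unspecified real
  number. Subadditivity applied to t y = (x + t y) + (- x) gives a bound that does not depend on
  t.\<close>

lemma tilt_bdd:
  assumes "sublinear_functional p"
  shows "bdd_below ((\<lambda>t. p (x + t *\<^sub>R y) - t * p y) ` {0..})"
proof (rule bdd_belowI2)
  fix t :: real assume t: "t \<in> {0..}"
  have "t * p y = p (t *\<^sub>R y)" using t sublinear_functionalD(2)[OF assms] by simp
  also have "\<dots> \<le> p (x + t *\<^sub>R y) + p (- x)"
    using sublinear_functionalD(1)[OF assms, of "x + t *\<^sub>R y" "- x"] by simp
  finally show "- p (- x) \<le> p (x + t *\<^sub>R y) - t * p y" by simp
qed

lemma tilt_le:
  assumes "sublinear_functional p" "0 \<le> t"
  shows "tilt p y x \<le> p (x + t *\<^sub>R y) - t * p y"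
  unfolding tilt_def by (rule cINF_lower[OF tilt_bdd[OF assms(1)]]) (use assms in auto)

text \<open>For subadditivity the parameters t and s of the two summands are added, and t + s is
  used for the sum. For homogeneity a positive factor r only rescales the parameter, which gives one
  inequality for every r > 0; the same inequality for 1 / r gives the other.\<close>

lemma sublinear_tilt:
  assumes "sublinear_functional p"
  shows "sublinear_functional (tilt p y)"
  unfolding sublinear_functional_def
proof (intro conjI allI impI)
  fix u v
  have "tilt p y (u + v) - (p (u + t *\<^sub>R y) - t * p y) \<le> tilt p y v" if "t \<in> {0..}" for t
    unfolding tilt_def[of p y v]
  proof (rule cINF_greatest)
    fix s :: real assume s: "s \<in> {0..}"
    have "tilt p y (u + v) \<le> p ((u + v) + (t + s) *\<^sub>R y) - (t + s) * p y"
      using that s by (intro tilt_le assms) auto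
    also have "(u + v) + (t + s) *\<^sub>R y = (u + t *\<^sub>R y) + (v + s *\<^sub>R y)"
      by (simp add: algebra_simps)
    also have "p \<dots> \<le> p (u + t *\<^sub>R y) + p (v + s *\<^sub>R y)"
      by (rule sublinear_functionalD[OF assms])
    finally show "tilt p y (u + v) - (p (u + t *\<^sub>R y) - t * p y) \<le> p (v + s *\<^sub>R y) - s * p y"
      by (simp add: algebra_simps)
  qed simp
  then have "tilt p y (u + v) - tilt p y v \<le> tilt p y u"
    unfolding tilt_def[of p y u] by (intro cINF_greatest) (auto simp: algebra_simps)
  then show "tilt p y (u + v) \<le> tilt p y u + tilt p y v" by simp
next
  have le: "tilt p y (r *\<^sub>R u) \<le> r * tilt p y u" if "0 < r" for r u
  proof -
    have "tilt p y (r *\<^sub>R u) / r \<le> tilt p y u"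
      unfolding tilt_def[of p y u]
    proof (rule cINF_greatest)
      fix t :: real assume t: "t \<in> {0..}"
      have "tilt p y (r *\<^sub>R u) \<le> p (r *\<^sub>R u + (r * t) *\<^sub>R y) - (r * t) * p y"
        using that t by (intro tilt_le assms) auto
      also have "r *\<^sub>R u + (r * t) *\<^sub>R y = r *\<^sub>R (u + t *\<^sub>R y)" by (simp add: algebra_simps)
      also have "p \<dots> = r * p (u + t *\<^sub>R y)"
        using that sublinear_functionalD(2)[OF assms] by simp
      finally show "tilt p y (r *\<^sub>R u) / r \<le> p (u + t *\<^sub>R y) - t * p y"
        using that by (simp add: field_simps)
    qed simp
    then show ?thesis using that by (simp add: field_simps)
  qed
  fix r :: real and u assume "0 \<le> r"
  then consider "r = 0" | "0 < r" by linarith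
  then show "tilt p y (r *\<^sub>R u) = r * tilt p y u"
  proof cases
    case 1
    have "p (t *\<^sub>R y) - t * p y = 0" if "t \<in> {0..}" for t
      using that sublinear_functionalD(2)[OF assms] by simp
    then have "tilt p y 0 = (INF t\<in>{0::real..}. 0)"
      unfolding tilt_def by (intro INF_cong) auto
    then show ?thesis using 1 by simp
  next
    case 2
    have "tilt p y ((1 / r) *\<^sub>R (r *\<^sub>R u)) \<le> (1 / r) * tilt p y (r *\<^sub>R u)"
      using 2 by (intro le) auto
    then show ?thesis using le[OF 2, of u] 2 by (simp add: field_simps)
  qed
qed

lemma minimal_sublinear_imp_linear:
  assumes p: "sublinear_functional p"
    and min: "\<And>q. sublinear_functional q \<Longrightarrow> (\<And>x. q x \<le> p x) \<Longrightarrow> q = p"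
  shows "linear p"
proof -
  have neg: "p (- y) = - p y" for y
  proof -
    \<comment> \<open>The parameter t = 0 shows that the tilt lies below p, so minimality makes them
      equal; t = 1 at the point - y then yields p (- y) \<le> p 0 - p y.\<close>
    have "tilt p y = p"
      using tilt_le[OF p, of 0 y] by (intro min sublinear_tilt p) simp
    then have "p (- y) \<le> p (- y + 1 *\<^sub>R y) - 1 * p y"
      using tilt_le[OF p, of 1 y "- y"] by simp
    then show ?thesis using sublinear_functionalD(3)[OF p] sublinear_functionalD(4)[OF p, of y] by simp
  qed
  show ?thesis
  proof (rule linearI)
    fix x y
    have "p ((x + y) + (- y)) \<le> p (x + y) + p (- y)" by (rule sublinear_functionalD[OF p])
    then show "p (x + y) = p x + p y"
      using sublinear_functionalD(1)[OF p, of x y] neg[of y] by simp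
  next
    fix r x
    show "p (r *\<^sub>R x) = r *\<^sub>R p x"
    proof (cases "0 \<le> r")
      case True
      then show ?thesis using sublinear_functionalD(2)[OF p] by simp
    next
      case False
      then show ?thesis
        using sublinear_functionalD(2)[OF p, of "- r" x] neg[of "r *\<^sub>R x"] by simp
    qed
  qed
qed

text \<open>Zorn's lemma for the reversed pointwise order, where a nonempty chain is bounded by its
  pointwise infimum. Each member p satisfies - q (- x) \<le> - p (- x) \<le> p x, which keeps the
  infimum finite.\<close>

lemma exists_linear_below_sublinear:
  assumes q: "sublinear_functional q"
  shows "\<exists>\<phi>. linear \<phi> \<and> (\<forall>x. \<phi> x \<le> q x)"
proof -
  define A where "A = {p. sublinear_functional p \<and> (\<forall>x. p x \<le> q x)}"
  have "\<exists>m\<in>A. \<forall>a\<in>A. (\<forall>x. a x \<le> m x) \<longrightarrow> a = m"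
  proof (rule predicate_Zorn)
    show "partial_order_on A (relation_of (\<lambda>m a. \<forall>x. a x \<le> m x) A)"
      by (rule partial_order_on_relation_ofI) (auto intro: order_trans antisym simp: fun_eq_iff)
    fix C assume C: "C \<in> Chains (relation_of (\<lambda>m a. \<forall>x. a x \<le> m x) A)"
    show "\<exists>u\<in>A. \<forall>a\<in>C. \<forall>x. u x \<le> a x"
    proof (cases "C = {}")
      case True
      then show ?thesis using q by (auto simp: A_def)
    next
      case False
      have CA: "p \<in> A" if "p \<in> C" for p
        using C that by (auto simp: Chains_def relation_of_def)
      have sub: "sublinear_functional p" and le: "p x \<le> q x" if "p \<in> C" for p x
        using CA[OF that] by (auto simp: A_def)
      have tot: "(\<forall>x. p x \<le> r x) \<or> (\<forall>x. r x \<le> p x)" if "p \<in> C" "r \<in> C" for p r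
        using C that by (auto simp: Chains_def relation_of_def)
      define u where "u x = (INF p\<in>C. p x)" for x
      have bdd: "bdd_below ((\<lambda>p. p x) ` C)" for x
      proof (rule bdd_belowI2)
        fix p assume p: "p \<in> C"
        show "- q (- x) \<le> p x"
          using sublinear_functionalD(4)[OF sub[OF p], of x] le[OF p, of "- x"] by simp
      qed
      have ule: "u x \<le> p x" if "p \<in> C" for p x
        unfolding u_def by (rule cINF_lower[OF bdd that])
      have "sublinear_functional u"
        unfolding sublinear_functional_def
      proof (intro conjI allI impI)
        fix x y
        have "u (x + y) - r y \<le> u x" if r: "r \<in> C" for r
          unfolding u_def[of x]
        proof (rule cINF_greatest[OF False])
          fix p assume p: "p \<in> C"
          \<comment> \<open>Two members of the chain are comparable; the smaller one serves for both
            summands at once.\<close>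
          obtain s where s: "s \<in> C" "\<And>z. s z \<le> p z" "\<And>z. s z \<le> r z"
            using tot[OF p r] p r by auto
          have "u (x + y) \<le> s (x + y)" by (rule ule[OF s(1)])
          also have "\<dots> \<le> s x + s y" by (rule sublinear_functionalD[OF sub[OF s(1)]])
          also have "\<dots> \<le> p x + r y" by (intro add_mono s)
          finally show "u (x + y) - r y \<le> p x" by simp
        qed
        then have "u (x + y) - u x \<le> u y"
          unfolding u_def[of y] by (intro cINF_greatest False) (auto simp: algebra_simps)
        then show "u (x + y) \<le> u x + u y" by simp
      next
        fix r :: real and x assume "0 \<le> r"
        then consider "r = 0" | "0 < r" by linarith
        then show "u (r *\<^sub>R x) = r * u x"
        proof cases
          case 1
          have "u 0 = (INF p\<in>C. 0)"
            unfolding u_def by (intro INF_cong) (auto dest: sub sublinear_functionalD(3))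
          then show ?thesis using 1 False by simp
        next
          case 2
          have le: "u (s *\<^sub>R z) \<le> s * u z" if s: "0 < s" for s z
          proof -
            have "u (s *\<^sub>R z) / s \<le> u z"
              unfolding u_def[of z]
            proof (rule cINF_greatest[OF False])
              fix p assume p: "p \<in> C"
              show "u (s *\<^sub>R z) / s \<le> p z"
                using ule[OF p, of "s *\<^sub>R z"] sublinear_functionalD(2)[OF sub[OF p], of s z] s
                by (simp add: field_simps)
            qed
            then show ?thesis using s by (simp add: field_simps)
          qed
          show ?thesis using le[OF 2, of x] le[of "1 / r" "r *\<^sub>R x"] 2 by (simp add: field_simps)
        qed
      qed
      moreover have "u x \<le> q x" for x
        using False ule le by (meson all_not_in_conv order_trans)
      ultimately show ?thesis using ule by (auto simp: A_def)
    qed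
  qed
  then obtain m where m: "m \<in> A" and min: "\<And>a. a \<in> A \<Longrightarrow> (\<And>x. a x \<le> m x) \<Longrightarrow> a = m"
    by blast
  have "linear m"
  proof (rule minimal_sublinear_imp_linear)
    show "sublinear_functional m" using m by (simp add: A_def)
    fix a assume a: "sublinear_functional a" "\<And>x. a x \<le> m x"
    then show "a = m" using m by (intro min) (auto simp: A_def intro: order_trans)
  qed
  then show ?thesis using m by (auto simp: A_def)
qed

theorem bounded_linear_functional_separates:
  fixes x :: "'a::real_normed_vector"
  assumes "x \<noteq> 0"
  obtains \<phi> :: "'a \<Rightarrow> real" where "bounded_linear \<phi>" "\<phi> x \<noteq> 0"
proof -
  have n: "sublinear_functional (norm :: 'a \<Rightarrow> real)"
    by (auto simp: sublinear_functional_def norm_triangle_ineq)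
  obtain \<phi> where lin: "linear \<phi>" and le: "\<And>z. \<phi> z \<le> tilt norm x z"
    using exists_linear_below_sublinear[OF sublinear_tilt[OF n, of x]] by blast
  have "\<phi> z \<le> norm z" for z
    using le[of z] tilt_le[OF n, of 0 x z] by simp
  then have "\<bar>\<phi> z\<bar> \<le> norm z" for z
    by (metis abs_leI lin linear_neg norm_minus_cancel)
  then have "bounded_linear \<phi>"
    using lin by (intro bounded_linear_intro[where K = 1]) (auto simp: linear_add linear_scale)
  moreover have "\<phi> (- x) \<le> - norm x"
    using le[of "- x"] tilt_le[OF n, of 1 x "- x"] by simp
  then have "\<phi> x \<noteq> 0" using assms lin by (auto simp: linear_neg)
  ultimately show ?thesis by (rule that)
qed

section \<open>Cauchy's theorem for cycles\<close>

text \<open>Differentiation under the integral needs a bound on the derivative of the path, which a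
  valid path need not have. Near a given z the path is replaced by a polynomial path with the same
  end points that gives the same integrals.\<close>

lemma Cauchy_type_integral_holomorphic:
  assumes "open S" "f holomorphic_on S" "valid_path \<gamma>" "path_image \<gamma> \<subseteq> S"
  shows "(\<lambda>z. contour_integral \<gamma> (\<lambda>w. f w / (w - z))) holomorphic_on (- path_image \<gamma>)"
proof -
  have "path \<gamma>" using assms by (simp add: valid_path_imp_path)
  have op: "open (- path_image \<gamma>)"
    using \<open>path \<gamma>\<close> by (simp add: closed_path_image open_Compl)
  have "(\<lambda>z. contour_integral \<gamma> (\<lambda>w. f w / (w - z))) field_differentiable at z"
    if z: "z \<in> - path_image \<gamma>" for z
  proof -
    obtain r where r: "r > 0" "cball z r \<subseteq> - path_image \<gamma>"
      using op z open_contains_cball by blast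
    \<comment> \<open>Removing the whole closed ball keeps the integrand holomorphic for all w in
      \<open>ball z r\<close> simultaneously, so one polynomial path serves a neighbourhood of
      z.\<close>
    define S' where "S' = S - cball z r"
    have S': "open S'" "path_image \<gamma> \<subseteq> S'" using assms r by (auto simp: S'_def)
    obtain d where d: "d > 0" "\<And>g h. valid_path g \<Longrightarrow> valid_path h \<Longrightarrow>
        (\<forall>t\<in>{0..1}. norm (g t - \<gamma> t) < d \<and> norm (h t - \<gamma> t) < d) \<Longrightarrow>
        pathstart h = pathstart g \<Longrightarrow> pathfinish h = pathfinish g \<Longrightarrow>
        path_image h \<subseteq> S' \<and> (\<forall>f. f holomorphic_on S' \<longrightarrow> contour_integral h f = contour_integral g f)"
      using contour_integral_nearby_ends[OF S'(1) \<open>path \<gamma>\<close> S'(2)] by metis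
    obtain p where p: "polynomial_function p" "pathstart p = pathstart \<gamma>" "pathfinish p = pathfinish \<gamma>"
        "\<And>t. t \<in> {0..1} \<Longrightarrow> norm (p t - \<gamma> t) < d"
      using path_approx_polynomial_function[OF \<open>path \<gamma>\<close> \<open>d > 0\<close>] by metis
    have vp: "valid_path p" by (rule valid_path_polynomial_function[OF p(1)])
    have pS: "path_image p \<subseteq> S'"
      and eq: "\<And>f. f holomorphic_on S' \<Longrightarrow> contour_integral p f = contour_integral \<gamma> f"
      using d(2)[of \<gamma> p] p vp assms d(1) by auto
    obtain p' where p': "polynomial_function p'" "\<And>x. (p has_vector_derivative p' x) (at x)"
      using has_vector_derivative_polynomial_function[OF p(1)] by blast
    have "bounded (p' ` {0..1})"
      by (intro compact_imp_bounded compact_continuous_image continuous_on_polymonial_function p') simp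
    then obtain B where B: "\<And>t. t \<in> {0..1} \<Longrightarrow> norm (p' t) \<le> B"
      unfolding bounded_iff by blast
    have hol: "(\<lambda>u. f u / (u - w)) holomorphic_on S'" if "w \<in> ball z r" for w
      using that by (intro holomorphic_intros holomorphic_on_subset[OF assms(2)]) (auto simp: S'_def)
    have "((\<lambda>w. contour_integral p (\<lambda>u. f u / (u - w))) has_field_derivative
        of_nat 1 * contour_integral p (\<lambda>u. f u / (u - z) ^ Suc 1)) (at z)"
    proof (rule Cauchy_next_derivative(2)[where S = "ball z r" and B = B])
      show "continuous_on (path_image p) f"
        using pS by (intro continuous_on_subset[OF holomorphic_on_imp_continuous_on[OF assms(2)]])
          (auto simp: S'_def)
      show "norm (vector_derivative p (at t)) \<le> B" if "t \<in> {0..1}" for t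
        using B[OF that] vector_derivative_at[OF p'(2)] by simp
      show "((\<lambda>u. f u / (u - w) ^ 1) has_contour_integral contour_integral p (\<lambda>u. f u / (u - w))) p"
        if "w \<in> ball z r - path_image p" for w
        using that contour_integrable_holomorphic_simple[OF hol[of w] S'(1) vp pS]
        by (auto simp: has_contour_integral_integral)
    qed (use vp r pS in \<open>auto simp: S'_def\<close>)
    then have "(\<lambda>w. contour_integral p (\<lambda>u. f u / (u - w))) field_differentiable at z"
      by (auto simp: field_differentiable_def)
    moreover have "contour_integral p (\<lambda>u. f u / (u - w)) = contour_integral \<gamma> (\<lambda>u. f u / (u - w))"
      if "w \<in> ball z r" for w
      by (rule eq[OF hol[OF that]])
    ultimately show ?thesis
      using field_differentiable_transform_within[OF r(1), of z UNIV
          "\<lambda>w. contour_integral p (\<lambda>u. f u / (u - w))" "\<lambda>w. contour_integral \<gamma> (\<lambda>u. f u / (u - w))"]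
      by (simp add: dist_commute)
  qed
  then show ?thesis
    by (simp add: holomorphic_on_def field_differentiable_at_within)
qed

section \<open>Cauchy's integral formula for cycles by Dixon's argument\<close>

definition diff_quot :: "(complex \<Rightarrow> complex) \<Rightarrow> complex \<Rightarrow> complex \<Rightarrow> complex" where
  "diff_quot f z w = (if w = z then deriv f z else (f w - f z) / (w - z))"

lemma diff_quot_holomorphic:
  "open S \<Longrightarrow> f holomorphic_on S \<Longrightarrow> diff_quot f z holomorphic_on S"
  unfolding diff_quot_def[abs_def] by (rule pole_lemma_open)

lemma contour_integral_diff_quot:
  assumes "open S" "f holomorphic_on S" "valid_path \<gamma>" "path_image \<gamma> \<subseteq> S" "z \<notin> path_image \<gamma>"
  shows "contour_integral \<gamma> (diff_quot f z) =
    contour_integral \<gamma> (\<lambda>w. f w / (w - z)) - 2 * pi * \<i> * winding_number \<gamma> z * f z"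
proof -
  have i: "((\<lambda>w. 1 / (w - z)) has_contour_integral 2 * pi * \<i> * winding_number \<gamma> z) \<gamma>"
    by (rule has_contour_integral_winding_number) (use assms in auto)
  have "(\<lambda>w. f w / (w - z)) contour_integrable_on \<gamma>"
    by (rule contour_integrable_holomorphic_simple[where S = "S - {z}"])
      (use assms in \<open>auto intro!: holomorphic_intros holomorphic_on_subset[OF assms(2)]\<close>)
  then have "((\<lambda>w. f w / (w - z) - f z * (1 / (w - z))) has_contour_integral
      contour_integral \<gamma> (\<lambda>w. f w / (w - z)) - f z * (2 * pi * \<i> * winding_number \<gamma> z)) \<gamma>"
    by (intro has_contour_integral_diff has_contour_integral_lmul i has_contour_integral_integral)
  then have "(diff_quot f z has_contour_integral
      contour_integral \<gamma> (\<lambda>w. f w / (w - z)) - f z * (2 * pi * \<i> * winding_number \<gamma> z)) \<gamma>"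
    by (rule has_contour_integral_eq) (use assms in \<open>auto simp: diff_quot_def diff_divide_distrib\<close>)
  then show ?thesis by (simp add: contour_integral_unique mult_ac)
qed

text \<open>Near a point of the path, the path may be replaced by a slightly translated polynomial loop
  that avoids the point: its image is negligible.\<close>

lemma contour_integral_diff_quot_holomorphic:
  assumes "open S" "f holomorphic_on S" "valid_path \<gamma>" "pathfinish \<gamma> = pathstart \<gamma>" "path_image \<gamma> \<subseteq> S"
  shows "(\<lambda>z. contour_integral \<gamma> (diff_quot f z)) holomorphic_on S"
proof -
  have "path \<gamma>" using assms by (simp add: valid_path_imp_path)
  have "(\<lambda>z. contour_integral \<gamma> (diff_quot f z)) field_differentiable at z0" if z0: "z0 \<in> S" for z0
  proof -
    obtain d where d: "d > 0" "\<And>g h. valid_path g \<Longrightarrow> valid_path h \<Longrightarrow>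
        (\<forall>t\<in>{0..1}. norm (g t - \<gamma> t) < d \<and> norm (h t - \<gamma> t) < d) \<Longrightarrow>
        pathfinish g = pathstart g \<Longrightarrow> pathfinish h = pathstart h \<Longrightarrow>
        path_image h \<subseteq> S \<and> (\<forall>f. f holomorphic_on S \<longrightarrow> contour_integral h f = contour_integral g f)"
      using contour_integral_nearby_loops[OF assms(1) \<open>path \<gamma>\<close> assms(5)] by metis
    obtain p where p: "polynomial_function p" "pathstart p = pathstart \<gamma>" "pathfinish p = pathfinish \<gamma>"
        "\<And>t. t \<in> {0..1} \<Longrightarrow> norm (p t - \<gamma> t) < d / 2"
      using path_approx_polynomial_function[OF \<open>path \<gamma>\<close>, of "d / 2"] d(1) by auto
    \<comment> \<open>A smooth curve in the plane has measure zero, whereas a ball of translations e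
      has not; so some e moves the polynomial loop off z0. Approximation and translation each cost
      less than d / 2.\<close>
    have "negligible (p ` UNIV)"
      by (rule negligible_differentiable_image_lowdim)
        (auto intro!: differentiable_on_polynomial_function p(1))
    moreover have "(\<lambda>w. z0 - w) differentiable_on (p ` UNIV)"
      by (intro differentiable_on_diff differentiable_on_const differentiable_on_ident)
    ultimately have "negligible ((\<lambda>w. z0 - w) ` p ` UNIV)"
      by - (rule negligible_differentiable_image_negligible, auto)
    then have "\<not> ball 0 (d / 2) \<subseteq> (\<lambda>w. z0 - w) ` p ` UNIV"
      using d(1) negligible_subset open_not_negligible[of "ball 0 (d / 2) :: complex set"] by auto
    then obtain e where "e \<in> ball 0 (d / 2)" and e2: "e \<notin> (\<lambda>w. z0 - w) ` p ` UNIV"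
      by blast
    then have e: "norm e < d / 2" by simp
    have e2: "z0 \<noteq> e + p t" for t
      using e2 by (metis add_diff_cancel_right' image_eqI rangeI)
    define q where "q t = e + p t" for t
    have vq: "valid_path q"
      unfolding q_def[abs_def] using p by (intro valid_path_polynomial_function) auto
    have lq: "pathfinish q = pathstart q"
      using p assms by (simp add: q_def pathfinish_def pathstart_def)
    have "norm (q t - \<gamma> t) < d" if "t \<in> {0..1}" for t
    proof -
      have "norm (q t - \<gamma> t) \<le> norm e + norm (p t - \<gamma> t)"
        unfolding q_def using norm_triangle_ineq[of e "p t - \<gamma> t"] by (simp add: algebra_simps)
      then show ?thesis using e p(4)[OF that] by simp
    qed
    then have qS: "path_image q \<subseteq> S"
      and eq: "\<And>f. f holomorphic_on S \<Longrightarrow> contour_integral q f = contour_integral \<gamma> f"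
      using d(2)[of \<gamma> q] vq lq assms d(1) by auto
    have "z0 \<notin> path_image q" using e2 by (auto simp: path_image_def q_def)
    moreover have "open (S - path_image q)"
      using assms(1) vq by (simp add: closed_path_image open_Diff valid_path_imp_path)
    ultimately obtain r where r: "r > 0" "ball z0 r \<subseteq> S - path_image q"
      using z0 by (meson DiffI openE)
    have "ball z0 r \<inter> path_image q = {}" using r(2) by auto
    \<comment> \<open>On a ball that misses the loop the winding number is a constant c. There the
      integral of the difference quotient is a Cauchy integral minus 2 pi i c f(z), which is
      holomorphic in z.\<close>
    then have "winding_number q constant_on ball z0 r"
      using vq lq by (intro winding_number_constant) (auto simp: valid_path_imp_path)
    then obtain c where c: "\<And>z. z \<in> ball z0 r \<Longrightarrow> winding_number q z = c"
      by (auto simp: constant_on_def)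
    have "(\<lambda>z. contour_integral q (\<lambda>w. f w / (w - z)) - 2 * pi * \<i> * c * f z) holomorphic_on ball z0 r"
      using r(2) Cauchy_type_integral_holomorphic[OF assms(1,2) vq qS] assms(2)
      by (intro holomorphic_intros) (auto elim: holomorphic_on_subset)
    then have "(\<lambda>z. contour_integral \<gamma> (diff_quot f z)) holomorphic_on ball z0 r"
    proof (rule holomorphic_transform)
      fix z assume z: "z \<in> ball z0 r"
      have "contour_integral \<gamma> (diff_quot f z) = contour_integral q (diff_quot f z)"
        using eq[OF diff_quot_holomorphic[OF assms(1,2)]] by simp
      also have "\<dots> = contour_integral q (\<lambda>w. f w / (w - z)) - 2 * pi * \<i> * c * f z"
        using z r(2) c[OF z] contour_integral_diff_quot[OF assms(1,2) vq qS, of z] by auto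
      finally show "contour_integral q (\<lambda>w. f w / (w - z)) - 2 * pi * \<i> * c * f z =
          contour_integral \<gamma> (diff_quot f z)" by simp
    qed
    then show ?thesis
      by (rule holomorphic_on_imp_differentiable_at) (use r in auto)
  qed
  then show ?thesis
    by (simp add: holomorphic_on_def field_differentiable_at_within)
qed

text \<open>The constant L replaces the length of the path, which may be infinite. It bounds
  integrals by the supremum over an open neighbourhood of the path instead of the path itself; hence
  the compact set K, on which f is bounded, and its interior S'.\<close>

lemma Cauchy_type_integral_tendsto_0:
  assumes "open S" "f holomorphic_on S" "valid_path \<gamma>" "path_image \<gamma> \<subseteq> S"
  shows "((\<lambda>z. contour_integral \<gamma> (\<lambda>w. f w / (w - z))) \<longlongrightarrow> 0) at_infinity"
proof -
  have comp: "compact (path_image \<gamma>)" using assms by (simp add: compact_valid_path_image)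
  then obtain e where e: "e > 0" "(\<Union>x\<in>path_image \<gamma>. cball x e) \<subseteq> S"
    using compact_subset_open_imp_cball_epsilon_subset[OF comp assms(1,4)] by blast
  define K where "K = (\<Union>x\<in>path_image \<gamma>. cball x e)"
  have "compact K" unfolding K_def by (rule compact_minkowski_sum_cball[OF comp])
  define S' where "S' = interior K"
  have S': "open S'" "S' \<subseteq> K" "K \<subseteq> S"
    using e interior_subset[of K] by (auto simp: S'_def K_def)
  have "path_image \<gamma> \<subseteq> S'"
  proof
    fix x assume "x \<in> path_image \<gamma>"
    then have "ball x e \<subseteq> K" by (auto simp: K_def)
    then show "x \<in> S'" unfolding S'_def using e by (meson centre_in_ball interior_maximal open_ball subsetD)
  qed
  then obtain L where L: "L > 0" "\<And>f B. f holomorphic_on S' \<Longrightarrow> (\<And>z. z \<in> S' \<Longrightarrow> norm (f z) \<le> B) \<Longrightarrow>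
      norm (contour_integral \<gamma> f) \<le> L * B"
    using contour_integral_bound_exists[OF S'(1) assms(3)] by blast
  have "bounded (f ` K)"
    using assms(2) S' \<open>compact K\<close>
    by (intro compact_imp_bounded compact_continuous_image)
      (auto intro: continuous_on_subset holomorphic_on_imp_continuous_on)
  then obtain D where D: "\<And>w. w \<in> K \<Longrightarrow> norm (f w) \<le> D" unfolding bounded_iff by blast
  obtain C where C: "\<And>w. w \<in> K \<Longrightarrow> norm w \<le> C"
    using compact_imp_bounded[OF \<open>compact K\<close>] unfolding bounded_iff by blast
  have bound: "norm (contour_integral \<gamma> (\<lambda>w. f w / (w - z))) \<le> L * (D / (norm z - C))" if z: "norm z > C" for z
  proof (rule L(2))
    show "(\<lambda>w. f w / (w - z)) holomorphic_on S'"
    proof (intro holomorphic_intros holomorphic_on_subset[OF assms(2)])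
      fix w assume "w \<in> S'"
      then show "w - z \<noteq> 0" using z C[of w] S'(2) by auto
    qed (use S' in auto)
    fix w assume w: "w \<in> S'"
    then have w: "w \<in> K" using S' by auto
    have "norm z - C \<le> norm (w - z)"
      using norm_triangle_ineq2[of z w] C[OF w] by (simp add: norm_minus_commute)
    then show "norm (f w / (w - z)) \<le> D / (norm z - C)"
      using z D[OF w] by (simp add: norm_divide frac_le order_trans[OF norm_ge_zero])
  qed
  have "((\<lambda>z. L * (D / (norm z - C))) \<longlongrightarrow> 0) (at_infinity :: complex filter)"
  proof -
    have "filterlim (\<lambda>z. - C + norm z) at_top (at_infinity :: complex filter)"
      by (rule filterlim_tendsto_add_at_top[OF tendsto_const filterlim_norm_at_top])
    then have "((\<lambda>z. L * (D / (- C + norm z))) \<longlongrightarrow> L * 0) (at_infinity :: complex filter)"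
      by (intro tendsto_intros real_tendsto_divide_at_top[OF tendsto_const])
    then show ?thesis by simp
  qed
  moreover have "\<forall>\<^sub>F z in at_infinity. norm (contour_integral \<gamma> (\<lambda>w. f w / (w - z))) \<le> L * (D / (norm z - C))"
  proof -
    have "\<forall>\<^sub>F z in at_infinity. (norm z :: real) \<ge> C + 1 "
      by (auto simp: eventually_at_infinity)
    then show ?thesis by eventually_elim (use bound in force)
  qed
  ultimately show ?thesis by (rule Lim_null_comparison[rotated])
qed

text \<open>The integrals h1 of the difference quotients are holomorphic on S, the Cauchy integrals
  h2 on the open set V of points off the curves with weighted winding number zero, and both agree on
  the overlap. S and V cover the plane, so the glued function is entire; it vanishes at infinity and
  is zero by Liouville's theorem. The weights c admit differences of two cycles.\<close>

theorem Cauchy_integral_formula_cycle: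
  fixes c :: "(real \<Rightarrow> complex) \<Rightarrow> complex"
  assumes S: "open S" and holf: "f holomorphic_on S" and fin: "finite \<Gamma>"
    and \<Gamma>: "\<And>\<gamma>. \<gamma> \<in> \<Gamma> \<Longrightarrow> valid_path \<gamma> \<and> pathfinish \<gamma> = pathstart \<gamma> \<and> path_image \<gamma> \<subseteq> S"
    and zero: "\<And>w. w \<notin> S \<Longrightarrow> (\<Sum>\<gamma>\<in>\<Gamma>. c \<gamma> * winding_number \<gamma> w) = 0"
    and z: "z \<in> S" "\<And>\<gamma>. \<gamma> \<in> \<Gamma> \<Longrightarrow> z \<notin> path_image \<gamma>"
  shows "(\<Sum>\<gamma>\<in>\<Gamma>. c \<gamma> * contour_integral \<gamma> (\<lambda>w. f w / (w - z))) =
    2 * pi * \<i> * (\<Sum>\<gamma>\<in>\<Gamma>. c \<gamma> * winding_number \<gamma> z) * f z"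
proof -
  define P where "P = (\<Union>\<gamma>\<in>\<Gamma>. path_image \<gamma>)"
  define V where "V = {w. w \<notin> P \<and> (\<Sum>\<gamma>\<in>\<Gamma>. c \<gamma> * winding_number \<gamma> w) = 0}"
  have path: "path \<gamma>" if "\<gamma> \<in> \<Gamma>" for \<gamma> using \<Gamma>[OF that] by (simp add: valid_path_imp_path)
  have "compact P" unfolding P_def using fin \<Gamma> by (intro compact_UN) (auto simp: compact_valid_path_image)
  then have opP: "open (- P)" by (simp add: compact_imp_closed open_Compl)
  have "open V"
    unfolding open_contains_ball
  proof
    fix w assume w: "w \<in> V"
    then obtain r where r: "r > 0" "ball w r \<subseteq> - P"
      using opP by (auto simp: V_def open_contains_ball)
    have "u \<in> V" if u: "u \<in> ball w r" for u
    proof -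
      have "winding_number \<gamma> u = winding_number \<gamma> w" if "\<gamma> \<in> \<Gamma>" for \<gamma>
      proof -
        have "ball w r \<inter> path_image \<gamma> = {}" using r that by (auto simp: P_def)
        then have "winding_number \<gamma> constant_on ball w r"
          using path[OF that] \<Gamma>[OF that] by (intro winding_number_constant) auto
        then obtain k where "\<And>v. v \<in> ball w r \<Longrightarrow> winding_number \<gamma> v = k"
          by (auto simp: constant_on_def)
        then show ?thesis using u r(1) by simp
      qed
      then show ?thesis using w u r by (auto simp: V_def)
    qed
    then show "\<exists>r>0. ball w r \<subseteq> V" using r by auto
  qed
  define h1 where "h1 u = (\<Sum>\<gamma>\<in>\<Gamma>. c \<gamma> * contour_integral \<gamma> (diff_quot f u))" for u
  define h2 where "h2 u = (\<Sum>\<gamma>\<in>\<Gamma>. c \<gamma> * contour_integral \<gamma> (\<lambda>w. f w / (w - u)))" for u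
  have rel: "h1 u = h2 u - 2 * pi * \<i> * (\<Sum>\<gamma>\<in>\<Gamma>. c \<gamma> * winding_number \<gamma> u) * f u" if "u \<notin> P" for u
  proof -
    have "h1 u = (\<Sum>\<gamma>\<in>\<Gamma>. c \<gamma> * (contour_integral \<gamma> (\<lambda>w. f w / (w - u)) - 2 * pi * \<i> * winding_number \<gamma> u * f u))"
      unfolding h1_def using \<Gamma> that
      by (intro sum.cong refl) (auto simp: contour_integral_diff_quot[OF S holf] P_def)
    then show ?thesis
      by (simp add: h2_def ring_distribs sum_subtractf sum_distrib_left sum_distrib_right mult_ac)
  qed
  define h where "h u = (if u \<in> S then h1 u else h2 u)" for u
  have hV: "h u = h2 u" if "u \<in> V" for u using rel[of u] that by (auto simp: h_def V_def)
  have "h holomorphic_on S"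
  proof (rule holomorphic_transform[of h1])
    show "h1 holomorphic_on S"
      unfolding h1_def[abs_def] using \<Gamma>
      by (intro holomorphic_intros contour_integral_diff_quot_holomorphic S holf) auto
  qed (auto simp: h_def)
  moreover have "h holomorphic_on V"
  proof (rule holomorphic_transform[of h2])
    show "h2 holomorphic_on V"
      unfolding h2_def[abs_def] using \<Gamma>
      by (intro holomorphic_intros holomorphic_on_subset[OF Cauchy_type_integral_holomorphic[OF S holf]])
        (auto simp: V_def P_def)
  qed (simp add: hV)
  moreover have "S \<union> V = UNIV" using zero \<Gamma> by (auto simp: V_def P_def)
  ultimately have "h holomorphic_on UNIV"
    using holomorphic_on_Un[of h S V] S \<open>open V\<close> by auto
  moreover have "(h \<longlongrightarrow> 0) at_infinity"
  proof -
    have "(h2 \<longlongrightarrow> (\<Sum>\<gamma>\<in>\<Gamma>. c \<gamma> * 0)) at_infinity"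
      unfolding h2_def[abs_def] using \<Gamma>
      by (intro tendsto_intros Cauchy_type_integral_tendsto_0[OF S holf]) auto
    then have "(h2 \<longlongrightarrow> 0) at_infinity" by simp
    moreover have "\<forall>\<^sub>F u in at_infinity. h2 u = h u"
    proof -
      obtain B where B: "P \<subseteq> ball 0 B"
        using compact_imp_bounded[OF \<open>compact P\<close>] bounded_subset_ballD by blast
      have "u \<in> V" if u: "B \<le> norm u" for u
      proof -
        have "winding_number \<gamma> u = 0" if "\<gamma> \<in> \<Gamma>" for \<gamma>
          using path[OF that] \<Gamma>[OF that] B u that
          by (intro winding_number_zero_outside[of \<gamma> "ball 0 B"]) (auto simp: P_def)
        then show ?thesis using B u by (auto simp: V_def)
      qed
      then show ?thesis unfolding eventually_at_infinity by (metis hV)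
    qed
    ultimately show ?thesis by (rule Lim_transform_eventually)
  qed
  ultimately have "h z = 0" by (rule Liouville_weak_0)
  then show ?thesis using rel[of z] z by (auto simp: h_def h2_def P_def)
qed

text \<open>The integral formula is applied to (w - z) f(w), which vanishes at z. A point z of S off
  all curves exists because their union is compact and nonempty, and no nonempty open subset of the
  plane is compact.\<close>

corollary Cauchy_theorem_cycle:
  fixes c :: "(real \<Rightarrow> complex) \<Rightarrow> complex"
  assumes S: "open S" and holf: "f holomorphic_on S" and fin: "finite \<Gamma>"
    and \<Gamma>: "\<And>\<gamma>. \<gamma> \<in> \<Gamma> \<Longrightarrow> valid_path \<gamma> \<and> pathfinish \<gamma> = pathstart \<gamma> \<and> path_image \<gamma> \<subseteq> S"
    and zero: "\<And>w. w \<notin> S \<Longrightarrow> (\<Sum>\<gamma>\<in>\<Gamma>. c \<gamma> * winding_number \<gamma> w) = 0"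
  shows "(\<Sum>\<gamma>\<in>\<Gamma>. c \<gamma> * contour_integral \<gamma> f) = 0"
proof (cases "\<Gamma> = {}")
  case False
  define P where "P = (\<Union>\<gamma>\<in>\<Gamma>. path_image \<gamma>)"
  have "compact P" unfolding P_def using fin \<Gamma> by (intro compact_UN) (auto simp: compact_valid_path_image)
  moreover have "P \<noteq> {}" using False by (auto simp: P_def)
  ultimately have "P \<noteq> S" using S compact_open by blast
  moreover have "P \<subseteq> S" using \<Gamma> by (auto simp: P_def)
  ultimately obtain z where z: "z \<in> S" "z \<notin> P" by blast
  have "(\<Sum>\<gamma>\<in>\<Gamma>. c \<gamma> * contour_integral \<gamma> (\<lambda>w. ((w - z) * f w) / (w - z))) =
      2 * pi * \<i> * (\<Sum>\<gamma>\<in>\<Gamma>. c \<gamma> * winding_number \<gamma> z) * ((z - z) * f z)"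
    by (rule Cauchy_integral_formula_cycle[OF S _ fin \<Gamma> zero])
      (use z in \<open>auto simp: P_def intro!: holomorphic_intros holf\<close>)
  moreover have "contour_integral \<gamma> (\<lambda>w. ((w - z) * f w) / (w - z)) = contour_integral \<gamma> f" if "\<gamma> \<in> \<Gamma>" for \<gamma>
    using that z by (intro contour_integral_eq) (auto simp: P_def)
  ultimately show ?thesis by simp
qed simp

section \<open>Contour integrals in Banach spaces with a complex structure\<close>

text \<open>A complex Banach space, presented as a real one with the operator of multiplication by
  the imaginary unit. In this form the same space of operators can carry a different complex
  structure for each quaternionic unit.\<close>

locale complex_structure =
  fixes Jm :: "'b::banach \<Rightarrow> 'b"
  assumes bounded_linear_Jm: "bounded_linear Jm" and Jm_Jm: "Jm (Jm x) = - x"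
begin

definition cm :: "complex \<Rightarrow> 'b \<Rightarrow> 'b" where
  "cm c x = Re c *\<^sub>R x + Im c *\<^sub>R Jm x"

lemma cm_mult: "cm (a * b) x = cm a (cm b x)"
  using bounded_linear.linear[OF bounded_linear_Jm]
  by (simp add: cm_def linear_add linear_scale Jm_Jm algebra_simps)

lemma bounded_bilinear_cm: "bounded_bilinear cm"
proof
  obtain K where K: "K > 0" "\<And>x. norm (Jm x) \<le> norm x * K"
    using bounded_linear.pos_bounded[OF bounded_linear_Jm] by blast
  show "\<exists>K. \<forall>a b. norm (cm a b) \<le> norm a * norm b * K"
  proof (intro exI allI)
    fix a b
    have "norm (cm a b) \<le> \<bar>Re a\<bar> * norm b + \<bar>Im a\<bar> * norm (Jm b)"
      unfolding cm_def by (rule norm_triangle_le) simp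
    also have "\<dots> \<le> norm a * norm b + norm a * (norm b * K)"
      by (intro add_mono mult_mono abs_Re_le_cmod abs_Im_le_cmod K) auto
    finally show "norm (cm a b) \<le> norm a * norm b * (1 + K)" by (simp add: algebra_simps)
  qed
qed (use bounded_linear.linear[OF bounded_linear_Jm] in \<open>simp_all add: cm_def linear_add linear_scale algebra_simps\<close>)

sublocale cm: bounded_bilinear cm
  by (rule bounded_bilinear_cm)

definition cfunctional :: "('b \<Rightarrow> complex) \<Rightarrow> bool" where
  "cfunctional \<psi> \<longleftrightarrow> bounded_linear \<psi> \<and> (\<forall>c x. \<psi> (cm c x) = c * \<psi> x)"

lemma cfunctionalD:
  assumes "cfunctional \<psi>"
  shows "bounded_linear \<psi>" "\<psi> (cm c x) = c * \<psi> x" "linear \<psi>"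
  using assms by (auto simp: cfunctional_def bounded_linear.linear)

text \<open>A separating real functional \<phi> is made complex linear as \<phi> (u) - i \<phi> (Jm
  u), whose real part is \<phi>. Identities between operator integrals are thereby reduced to scalar
  contour integrals.\<close>

lemma cfunctional_eqI:
  assumes "\<And>\<psi>. cfunctional \<psi> \<Longrightarrow> \<psi> x = \<psi> y"
  shows "x = y"
proof (rule ccontr)
  assume "x \<noteq> y"
  then obtain \<phi> :: "'b \<Rightarrow> real" where \<phi>: "bounded_linear \<phi>" "\<phi> (x - y) \<noteq> 0"
    using bounded_linear_functional_separates[of "x - y"] by auto
  define \<psi> where "\<psi> u = Complex (\<phi> u) (- \<phi> (Jm u))" for u
  have "bounded_linear (\<lambda>u. of_real (\<phi> u) - \<i> * of_real (\<phi> (Jm u)))"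
    by (intro bounded_linear_sub bounded_linear_const_mult bounded_linear_compose[OF bounded_linear_of_real]
        bounded_linear_compose[OF \<phi>(1)] bounded_linear_Jm \<phi>)
  also have "(\<lambda>u. of_real (\<phi> u) - \<i> * of_real (\<phi> (Jm u))) = \<psi>"
    by (auto simp: \<psi>_def complex_eq_iff)
  finally have bl: "bounded_linear \<psi>" .
  have "cfunctional \<psi>"
    unfolding cfunctional_def
    using bl bounded_linear.linear[OF \<phi>(1)] bounded_linear.linear[OF bounded_linear_Jm]
    by (auto simp: \<psi>_def cm_def complex_eq_iff linear_add linear_diff linear_scale linear_neg Jm_Jm)
  then have "\<psi> x = \<psi> y" by (rule assms)
  then show False
    using \<phi>(2) bounded_linear.linear[OF \<phi>(1)] by (simp add: \<psi>_def linear_diff)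
qed

text \<open>Holomorphy is asked only after applying functionals, where the scalar theory is
  available; continuity in norm is added for integrals over segments to exist.\<close>

definition weakly_holomorphic_on :: "(complex \<Rightarrow> 'b) \<Rightarrow> complex set \<Rightarrow> bool" where
  "weakly_holomorphic_on h S \<longleftrightarrow> continuous_on S h \<and> (\<forall>\<psi>. cfunctional \<psi> \<longrightarrow> (\<lambda>z. \<psi> (h z)) holomorphic_on S)"

lemma weakly_holomorphic_on_subset:
  "weakly_holomorphic_on h S \<Longrightarrow> T \<subseteq> S \<Longrightarrow> weakly_holomorphic_on h T"
  by (meson continuous_on_subset holomorphic_on_subset weakly_holomorphic_on_def)

lemma weakly_holomorphic_onI:
  assumes "open S" "\<And>z. z \<in> S \<Longrightarrow> (h has_derivative (\<lambda>k. cm k (h' z))) (at z)"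
  shows "weakly_holomorphic_on h S"
  unfolding weakly_holomorphic_on_def
proof (intro conjI allI impI)
  show "continuous_on S h"
    using assms(2) by (meson continuous_at_imp_continuous_on has_derivative_continuous)
  fix \<psi> assume \<psi>: "cfunctional \<psi>"
  have "((\<lambda>z. \<psi> (h z)) has_field_derivative \<psi> (h' z)) (at z)" if "z \<in> S" for z
    using bounded_linear.has_derivative[OF cfunctionalD(1)[OF \<psi>] assms(2)[OF that]]
    by (simp add: has_field_derivative_def cfunctionalD(2)[OF \<psi>] mult_commute_abs)
  then show "(\<lambda>z. \<psi> (h z)) holomorphic_on S"
    using assms(1) by (auto simp: holomorphic_on_open)
qed

lemma has_derivative_cm:
  assumes "(f has_field_derivative f') (at z)" "(h has_derivative (\<lambda>k. cm k h')) (at z)"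
  shows "((\<lambda>z. cm (f z) (h z)) has_derivative (\<lambda>k. cm k (cm (f z) h' + cm f' (h z)))) (at z)"
  using cm.FDERIV[OF assms(1)[unfolded has_field_derivative_def] assms(2)]
  by (rule has_derivative_eq_rhs) (simp add: fun_eq_iff cm.add_right cm_mult[symmetric] mult_ac)

text \<open>As in the scalar case the primitive is the integral over the segment from the centre.
  That its increments are again integrals over segments is checked functional by functional, with a
  scalar primitive on the ball; the derivative then follows from continuity of h.\<close>

lemma weakly_holomorphic_primitive:
  assumes h: "weakly_holomorphic_on h (ball a r)"
  shows "\<exists>F. \<forall>z\<in>ball a r. (F has_derivative (\<lambda>k. cm k (h z))) (at z)"
proof -
  have cont: "continuous_on (ball a r) h" using h by (simp add: weakly_holomorphic_on_def)
  have seg: "linepath z w t \<in> ball a r" if "z \<in> ball a r" "w \<in> ball a r" "t \<in> {0..1}" for z w t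
    using linepath_in_convex_hull[of z "ball a r" w t] that convex_ball[of a r] by (simp add: hull_same)
  have int: "(\<lambda>t. h (linepath z w t)) integrable_on {0..1}" if "z \<in> ball a r" "w \<in> ball a r" for z w
    using that seg
    by (intro integrable_continuous_interval continuous_on_compose2[OF cont] continuous_on_linepath) auto
  define F where "F w = cm (w - a) (integral {0..1} (\<lambda>t. h (linepath a w t)))" for w
  have diff: "F w - F z = cm (w - z) (integral {0..1} (\<lambda>t. h (linepath z w t)))"
    if z: "z \<in> ball a r" and w: "w \<in> ball a r" for z w
  proof (rule cfunctional_eqI)
    fix \<psi> assume \<psi>: "cfunctional \<psi>"
    have hol: "(\<lambda>z. \<psi> (h z)) holomorphic_on ball a r" using h \<psi> by (simp add: weakly_holomorphic_on_def)
    obtain G where G: "\<And>x. x \<in> ball a r \<Longrightarrow> (G has_field_derivative \<psi> (h x)) (at x within ball a r)"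
      using holomorphic_convex_primitive'[OF convex_ball open_ball hol] by blast
    have *: "\<psi> (cm (w - z) (integral {0..1} (\<lambda>t. h (linepath z w t)))) = G w - G z"
      if z: "z \<in> ball a r" and w: "w \<in> ball a r" for z w
    proof -
      have "((\<lambda>z. \<psi> (h z)) has_contour_integral G (pathfinish (linepath z w)) - G (pathstart (linepath z w)))
          (linepath z w)"
        using closed_segment_subset[OF z w convex_ball]
        by (intro contour_integral_primitive[OF G]) auto
      then have "((\<lambda>t. \<psi> (h (linepath z w t)) * (w - z)) has_integral G w - G z) {0..1}"
        by (simp add: has_contour_integral_linepath)
      moreover have "((\<lambda>t. \<psi> (h (linepath z w t)) * (w - z)) has_integral
          \<psi> (integral {0..1} (\<lambda>t. h (linepath z w t))) * (w - z)) {0..1}"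
        using has_integral_linear[OF integrable_integral[OF int[OF z w]] cfunctionalD(1)[OF \<psi>]]
        by (intro has_integral_mult_left) (simp add: o_def)
      ultimately show ?thesis
        using cfunctionalD(2)[OF \<psi>] by (metis has_integral_unique mult.commute)
    qed
    have a: "a \<in> ball a r" using z by (metis centre_in_ball mem_ball order_le_less_trans zero_le_dist)
    show "\<psi> (F w - F z) = \<psi> (cm (w - z) (integral {0..1} (\<lambda>t. h (linepath z w t))))"
      using *[OF a w] *[OF a z] *[OF z w] cfunctionalD(3)[OF \<psi>] by (simp add: F_def linear_diff)
  qed
  have "(F has_derivative (\<lambda>k. cm k (h z))) (at z)" if z: "z \<in> ball a r" for z
    unfolding has_derivative_at_alt
  proof (intro conjI allI impI)
    show "bounded_linear (\<lambda>k. cm k (h z))" by (rule cm.bounded_linear_left)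
    fix e :: real assume e: "e > 0"
    obtain K where K: "K > 0" "\<And>c x. norm (cm c x) \<le> norm c * norm x * K"
      using cm.pos_bounded by blast
    have "isCont h z" using cont z by (simp add: continuous_on_eq_continuous_at)
    then obtain d1 where d1: "d1 > 0" "\<And>w. dist w z < d1 \<Longrightarrow> dist (h w) (h z) < e / K"
      using divide_pos_pos[OF e K(1)] unfolding continuous_at_eps_delta by blast
    obtain d2 where d2: "d2 > 0" "ball z d2 \<subseteq> ball a r" using z by (meson open_ball openE)
    show "\<exists>d>0. \<forall>w. norm (w - z) < d \<longrightarrow> norm (F w - F z - cm (w - z) (h z)) \<le> e * norm (w - z)"
    proof (intro exI conjI allI impI)
      show "min d1 d2 > 0" using d1 d2 by simp
      fix w assume w: "norm (w - z) < min d1 d2"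
      then have "w \<in> ball z d2" by (simp add: dist_norm norm_minus_commute)
      then have wb: "w \<in> ball a r" using d2 by blast
      have "integral {0..1} (\<lambda>t. h (linepath z w t) - h z) = integral {0..1} (\<lambda>t. h (linepath z w t)) - h z"
        using integral_diff[OF int[OF z wb] integrable_const_ivl[of "h z"]] by simp
      then have "F w - F z - cm (w - z) (h z) = cm (w - z) (integral {0..1} (\<lambda>t. h (linepath z w t) - h z))"
        by (simp add: diff[OF z wb] cm.diff_right)
      moreover
      have "norm (integral {0..1} (\<lambda>t. h (linepath z w t) - h z)) \<le> (e / K) * (1 - 0)"
      proof (rule integral_bound)
        show "continuous_on {0..1} (\<lambda>t. h (linepath z w t) - h z)"
          using seg[OF z wb]
          by (intro continuous_intros continuous_on_compose2[OF cont] continuous_on_linepath) auto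
        fix t :: real assume t: "t \<in> {0..1}"
        have "linepath z w t - z = t *\<^sub>R (w - z)" by (simp add: linepath_def algebra_simps)
        then have "dist (linepath z w t) z \<le> norm (w - z)"
          using t by (simp add: dist_norm mult_left_le_one_le)
        then have "dist (h (linepath z w t)) (h z) < e / K" using w by (intro d1) auto
        then show "norm (h (linepath z w t) - h z) \<le> e / K" by (simp add: dist_norm)
      qed simp
      then have "norm (cm (w - z) (integral {0..1} (\<lambda>t. h (linepath z w t) - h z))) \<le> norm (w - z) * (e / K) * K"
        using K(1) by (intro order_trans[OF K(2)] mult_right_mono mult_left_mono) auto
      ultimately have "norm (F w - F z - cm (w - z) (h z)) \<le> norm (w - z) * (e / K) * K"
        by simp
      then show "norm (F w - F z - cm (w - z) (h z)) \<le> e * norm (w - z)" using K(1) by (simp add: mult.commute)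
    qed
  qed
  then show ?thesis by blast
qed

section \<open>Integration of operator functions along valid paths\<close>

definition vint :: "(real \<Rightarrow> complex) \<Rightarrow> (complex \<Rightarrow> 'b) \<Rightarrow> 'b" where
  "vint \<gamma> h = integral {0..1} (\<lambda>t. cm (vector_derivative \<gamma> (at t within {0..1})) (h (\<gamma> t)))"

text \<open>The fundamental theorem for the gauge integral tolerates finitely many exceptional
  points and asks only for continuity there, so the derivative of the path may be unbounded.\<close>

lemma has_integral_derivative_along_path:
  assumes "valid_path \<gamma>" "{u..v} \<subseteq> {0..1}" "u \<le> v" "open S" "\<gamma> ` {u..v} \<subseteq> S"
    and F: "\<And>z. z \<in> S \<Longrightarrow> (F has_derivative (\<lambda>k. cm k (h z))) (at z)"
  shows "((\<lambda>t. cm (vector_derivative \<gamma> (at t within {0..1})) (h (\<gamma> t))) has_integral F (\<gamma> v) - F (\<gamma> u)) {u..v}"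
proof -
  obtain K where K: "finite K" "\<And>t. t \<in> {0..1} - K \<Longrightarrow> \<gamma> differentiable (at t)"
      and c\<gamma>: "continuous_on {0..1} \<gamma>"
    using assms(1) by (auto simp: valid_path_def piecewise_C1_differentiable_on_def C1_differentiable_on_eq)
  have contF: "continuous_on S F"
    using F by (meson continuous_at_imp_continuous_on has_derivative_continuous)
  show ?thesis
  proof (rule fundamental_theorem_of_calculus_interior_strong[OF K(1) assms(3)])
    fix t assume t: "t \<in> {u<..<v} - K"
    then have t01: "t \<in> {0<..<1}" "t \<in> {u..v}" using assms(2,3)
      by (auto simp: subset_iff)  (meson atLeastAtMost_iff less_eq_real_def less_le_trans le_less_trans)+
    have "at t within {0..1} = at t" using t01 by (intro at_within_interior) auto
    moreover have "(\<gamma> has_vector_derivative vector_derivative \<gamma> (at t)) (at t)"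
      using K(2)[of t] t t01 by (simp add: vector_derivative_works[symmetric])
    ultimately have "(\<gamma> has_derivative (\<lambda>x. x *\<^sub>R vector_derivative \<gamma> (at t within {0..1}))) (at t)"
      by (simp add: has_vector_derivative_def)
    moreover have "(F has_derivative (\<lambda>k. cm k (h (\<gamma> t)))) (at (\<gamma> t))"
      using t01 assms(5) by (intro F) auto
    ultimately have "((F \<circ> \<gamma>) has_derivative (\<lambda>k. cm k (h (\<gamma> t))) \<circ> (\<lambda>x. x *\<^sub>R vector_derivative \<gamma> (at t within {0..1}))) (at t)"
      by (rule diff_chain_at)
    then show "((\<lambda>t. F (\<gamma> t)) has_vector_derivative cm (vector_derivative \<gamma> (at t within {0..1})) (h (\<gamma> t))) (at t)"
      by (simp add: has_vector_derivative_def o_def cm.scaleR_left)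
  next
    show "continuous_on {u..v} (\<lambda>t. F (\<gamma> t))"
      using assms(2,5) by (intro continuous_on_compose2[OF contF] continuous_on_subset[OF c\<gamma>]) auto
  qed
qed

text \<open>A valid path may have infinite length, so continuity of \<open>h\<close> would not suffice.\<close>

lemma vint_integrable:
  assumes "open S" "weakly_holomorphic_on h S" "valid_path \<gamma>" "path_image \<gamma> \<subseteq> S"
  shows "(\<lambda>t. cm (vector_derivative \<gamma> (at t within {0..1})) (h (\<gamma> t))) integrable_on {0..1}"
proof -
  \<comment> \<open>Integrability is local on the interval: a short piece of the path stays in a
    ball on which h has a primitive, and there the fundamental theorem supplies the
    integral.\<close>
  have "(\<lambda>t. cm (vector_derivative \<gamma> (at t within {0..1})) (h (\<gamma> t))) integrable_on cbox 0 1"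
  proof (rule integrable_on_little_subintervals, intro ballI)
    fix x :: real assume "x \<in> cbox 0 1"
    then have x: "x \<in> {0..1}" by simp
    then have "\<gamma> x \<in> S" using assms(4) by (auto simp: path_image_def)
    then obtain r where r: "r > 0" "ball (\<gamma> x) r \<subseteq> S" using assms(1) openE by blast
    obtain F where F: "\<And>z. z \<in> ball (\<gamma> x) r \<Longrightarrow> (F has_derivative (\<lambda>k. cm k (h z))) (at z)"
      using weakly_holomorphic_primitive[OF weakly_holomorphic_on_subset[OF assms(2) r(2)]] by blast
    have "continuous_on {0..1} \<gamma>" using assms(3) by (simp add: path_def[symmetric] valid_path_imp_path)
    then obtain d where d: "d > 0" "\<And>t. t \<in> {0..1} \<Longrightarrow> dist t x < d \<Longrightarrow> dist (\<gamma> t) (\<gamma> x) < r"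
      using x r(1) unfolding continuous_on_iff by blast
    show "\<exists>d>0. \<forall>u v. x \<in> cbox u v \<and> cbox u v \<subseteq> ball x d \<and> cbox u v \<subseteq> cbox 0 1 \<longrightarrow>
        (\<lambda>t. cm (vector_derivative \<gamma> (at t within {0..1})) (h (\<gamma> t))) integrable_on cbox u v"
    proof (intro exI[of _ d] conjI allI impI d(1), elim conjE)
      fix u v assume uv: "x \<in> cbox u v" "cbox u v \<subseteq> ball x d" "cbox u v \<subseteq> cbox 0 1"
      have "\<gamma> ` {u..v} \<subseteq> ball (\<gamma> x) r"
      proof (rule image_subsetI)
        fix t assume "t \<in> {u..v}"
        then have "t \<in> ball x d" "t \<in> {0..1}" using uv by auto
        then show "\<gamma> t \<in> ball (\<gamma> x) r" using d(2)[of t] by (simp add: dist_commute)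
      qed
      then show "(\<lambda>t. cm (vector_derivative \<gamma> (at t within {0..1})) (h (\<gamma> t))) integrable_on cbox u v"
        using has_integral_derivative_along_path[OF assms(3) _ _ open_ball[of "\<gamma> x" r] _ F, of u v] uv
        by (auto intro: has_integral_integrable)
    qed
  qed
  then show ?thesis by simp
qed

lemma cfunctional_vint:
  assumes "open S" "weakly_holomorphic_on h S" "valid_path \<gamma>" "path_image \<gamma> \<subseteq> S" "cfunctional \<psi>"
  shows "\<psi> (vint \<gamma> h) = contour_integral \<gamma> (\<lambda>z. \<psi> (h z))"
proof -
  have "((\<lambda>t. \<psi> (cm (vector_derivative \<gamma> (at t within {0..1})) (h (\<gamma> t)))) has_integral \<psi> (vint \<gamma> h)) {0..1}"
    unfolding vint_def
    using has_integral_linear[OF integrable_integral[OF vint_integrable[OF assms(1-4)]] cfunctionalD(1)[OF assms(5)]]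
    by (simp add: o_def)
  then have "((\<lambda>z. \<psi> (h z)) has_contour_integral \<psi> (vint \<gamma> h)) \<gamma>"
    unfolding has_contour_integral_def using cfunctionalD(2)[OF assms(5)] by (simp add: mult.commute)
  then show ?thesis by (simp add: contour_integral_unique)
qed

end

section \<open>Operators on the quaternionic module\<close>

interpretation blinfun_compose: bounded_bilinear "(o\<^sub>L)"
  by (rule bounded_bilinear_blinfun_compose)

lemmas op_simps = blinfun_compose.add_left blinfun_compose.add_right blinfun_compose.diff_left
  blinfun_compose.diff_right blinfun_compose.minus_left blinfun_compose.minus_right
  blinfun_compose.scaleR_left blinfun_compose.scaleR_right blinfun_compose.zero_left
  blinfun_compose.zero_right
lemmas apply_simps = blinfun.bilinear_simps

lemma blinfun_compose_assoc: "(A o\<^sub>L B) o\<^sub>L C = A o\<^sub>L (B o\<^sub>L C)"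
  by (rule blinfun_eqI) simp

lemma lmul_apply_prod:
  "blinfun_apply (lmul q) (x0, x1, x2, x3) =
    (qre q *\<^sub>R x0 - qim1 q *\<^sub>R x1 - qim2 q *\<^sub>R x2 - qim3 q *\<^sub>R x3,
     qre q *\<^sub>R x1 + qim1 q *\<^sub>R x0 + qim2 q *\<^sub>R x3 - qim3 q *\<^sub>R x2,
     qre q *\<^sub>R x2 - qim1 q *\<^sub>R x3 + qim2 q *\<^sub>R x0 + qim3 q *\<^sub>R x1,
     qre q *\<^sub>R x3 + qim1 q *\<^sub>R x2 - qim2 q *\<^sub>R x1 + qim3 q *\<^sub>R x0)"
  by (cases q) (simp add: lmul.rep_eq)

lemma real_op_apply_prod:
  "blinfun_apply (real_op A) (x0, x1, x2, x3) =
    (blinfun_apply A x0, blinfun_apply A x1, blinfun_apply A x2, blinfun_apply A x3)"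
  by (simp add: real_op.rep_eq)

lemma qmod_eqI:
  fixes A B :: "'x::real_normed_vector qop"
  assumes "\<And>x0 x1 x2 x3. blinfun_apply A (x0, x1, x2, x3) = blinfun_apply B (x0, x1, x2, x3)"
  shows "A = B"
  by (rule blinfun_eqI) (metis assms prod_cases4)

lemma lmul_mult: "lmul (p * q) = lmul p o\<^sub>L lmul q"
  by (rule blinfun_eqI) (simp add: lmul.rep_eq left_right_scale_assoc)

lemma lmul_add: "lmul (p + q) = lmul p + lmul q"
  by (rule qmod_eqI) (simp add: lmul_apply_prod plus_quat_def blinfun.add_left algebra_simps)

lemma lmul_scaleR: "lmul (r *\<^sub>R q) = r *\<^sub>R lmul q"
  by (rule qmod_eqI) (simp add: lmul_apply_prod scaleR_quat_def blinfun.scaleR_left algebra_simps)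

lemma linear_lmul: "linear lmul"
  by (rule linearI) (simp_all add: lmul_add lmul_scaleR)

lemma lmul_1 [simp]: "lmul 1 = id_blinfun"
  by (rule qmod_eqI) (simp add: lmul_apply_prod one_quat_def)

lemma lmul_of_real: "lmul (of_real r) = r *\<^sub>R id_blinfun"
  by (simp add: of_real_def lmul_scaleR)

lemma quat_decompose: "q = of_real (qre q) + qim1 q *\<^sub>R quat_e1 + qim2 q *\<^sub>R quat_e2 + qim3 q *\<^sub>R quat_e3"
  by (simp add: quat_eq_iff quat_e1_def quat_e2_def quat_e3_def of_real_def quat_arith_defs)

lemma real_op_compose: "real_op (A o\<^sub>L B) = real_op A o\<^sub>L real_op B"
  by (rule qmod_eqI) (simp add: real_op_apply_prod)

lemma real_op_lmul_commute: "real_op A o\<^sub>L lmul q = lmul q o\<^sub>L real_op A"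
  by (rule qmod_eqI) (simp add: real_op_apply_prod lmul_apply_prod apply_simps)

lemma id_blinfun_compose [simp]: "id_blinfun o\<^sub>L A = A" "A o\<^sub>L id_blinfun = A"
  by (auto intro!: blinfun_eqI)

lemma qop_apply_prod:
  "blinfun_apply (qop A0 A1 A2 A3) (x0, x1, x2, x3) =
    (A0 x0 - A1 x1 - A2 x2 - A3 x3, A0 x1 + A1 x0 + A2 x3 - A3 x2,
     A0 x2 - A1 x3 + A2 x0 + A3 x1, A0 x3 + A1 x2 - A2 x1 + A3 x0)"
  by (simp add: qop_def blinfun.add_left lmul_apply_prod real_op_apply_prod quat_e1_def quat_e2_def
      quat_e3_def blinfun.minus_right)

lemma qop_compose:
  "qop A0 A1 A2 A3 o\<^sub>L qop B0 B1 B2 B3 =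
    qop ((A0 o\<^sub>L B0) - (A1 o\<^sub>L B1) - (A2 o\<^sub>L B2) - (A3 o\<^sub>L B3))
        ((A0 o\<^sub>L B1) + (A1 o\<^sub>L B0) + (A2 o\<^sub>L B3) - (A3 o\<^sub>L B2))
        ((A0 o\<^sub>L B2) - (A1 o\<^sub>L B3) + (A2 o\<^sub>L B0) + (A3 o\<^sub>L B1))
        ((A0 o\<^sub>L B3) + (A1 o\<^sub>L B2) - (A2 o\<^sub>L B1) + (A3 o\<^sub>L B0))"
  by (rule qmod_eqI) (simp add: qop_apply_prod apply_simps algebra_simps)

lemma real_op_qop: "real_op A = qop A 0 0 0"
  by (rule qmod_eqI) (simp add: qop_apply_prod real_op_apply_prod)

lemma conj_op_qop: "conj_op (qop A0 A1 A2 A3) = qop A0 (- A1) (- A2) (- A3)"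
  by (simp add: conj_op_def)

lemma vec_op_qop: "vec_op (qop A0 A1 A2 A3) = qop 0 A1 A2 A3"
  by (simp add: vec_op_def)

lemma right_scale_zero_units:
  "right_scale (x, 0, 0, 0) quat_e1 = (0, x, 0, 0)"
  "right_scale (x, 0, 0, 0) quat_e2 = (0, 0, x, 0)"
  "right_scale (x, 0, 0, 0) quat_e3 = (0, 0, 0, x)"
  by (simp_all add: quat_e1_def quat_e2_def quat_e3_def)

lemma right_linearD:
  "B \<in> right_linear_ops \<Longrightarrow> blinfun_apply B (right_scale x q) = right_scale (blinfun_apply B x) q"
  by (simp only: right_linear_ops_def mem_Collect_eq)

lemma right_linearI:
  "(\<And>x q. blinfun_apply B (right_scale x q) = right_scale (blinfun_apply B x) q) \<Longrightarrow> B \<in> right_linear_ops"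
  unfolding right_linear_ops_def by blast

text \<open>A right linear operator is determined by its values at (x, 0, 0, 0), because vectors in
  the other three coordinates are right multiples of these by the units.\<close>

lemma right_linear_op_qop:
  assumes "B \<in> right_linear_ops"
  shows "B = qop (comp0 B) (comp1 B) (comp2 B) (comp3 B)"
proof (rule qmod_eqI)
  fix x0 x1 x2 x3 :: 'a
  note rl = right_linearD[OF assms]
  have c: "blinfun_apply B (x, 0, 0, 0) =
      (blinfun_apply (comp0 B) x, blinfun_apply (comp1 B) x, blinfun_apply (comp2 B) x, blinfun_apply (comp3 B) x)" for x
    by (simp add: comp0_def comp1_def comp2_def comp3_def real_incl.rep_eq prod_eq_iff)
  have "blinfun_apply B (x0, x1, x2, x3) = blinfun_apply B ((x0, 0, 0, 0) + right_scale (x1, 0, 0, 0) quat_e1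
      + right_scale (x2, 0, 0, 0) quat_e2 + right_scale (x3, 0, 0, 0) quat_e3)"
    by (simp add: right_scale_zero_units)
  also have "\<dots> = blinfun_apply (qop (comp0 B) (comp1 B) (comp2 B) (comp3 B)) (x0, x1, x2, x3)"
    unfolding blinfun.add_right rl c by (simp add: qop_apply_prod quat_e1_def quat_e2_def quat_e3_def)
  finally show "blinfun_apply B (x0, x1, x2, x3) =
      blinfun_apply (qop (comp0 B) (comp1 B) (comp2 B) (comp3 B)) (x0, x1, x2, x3)" .
qed

definition comps :: "'x::real_normed_vector qop \<Rightarrow> ('x \<Rightarrow>\<^sub>L 'x) set" where
  "comps A = {comp0 A, comp1 A, comp2 A, comp3 A}"

lemma comps_qop: "comps (qop A0 A1 A2 A3) = {A0, A1, A2, A3}"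
  by (simp add: comps_def)

text \<open>Once each component of A can be exchanged with each component of B, coefficients compare
  as for scalar quaternions, where conjugation reverses products.\<close>

lemma conj_op_compose:
  assumes "A \<in> right_linear_ops" "B \<in> right_linear_ops"
    and comm: "\<And>a b. a \<in> comps A \<Longrightarrow> b \<in> comps B \<Longrightarrow> a o\<^sub>L b = b o\<^sub>L a"
  shows "conj_op (A o\<^sub>L B) = conj_op B o\<^sub>L conj_op A"
proof -
  obtain A0 A1 A2 A3 B0 B1 B2 B3 where A: "A = qop A0 A1 A2 A3" and B: "B = qop B0 B1 B2 B3"
    using right_linear_op_qop[OF assms(1)] right_linear_op_qop[OF assms(2)] by blast
  have c: "A0 o\<^sub>L b = b o\<^sub>L A0 \<and> A1 o\<^sub>L b = b o\<^sub>L A1 \<and> A2 o\<^sub>L b = b o\<^sub>L A2 \<and> A3 o\<^sub>L b = b o\<^sub>L A3"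
    if "b \<in> {B0, B1, B2, B3}" for b
    using comm[of _ b] that unfolding A B comps_qop by blast
  show ?thesis
    using c[of B0] c[of B1] c[of B2] c[of B3]
    unfolding A B qop_compose conj_op_qop by (simp add: op_simps algebra_simps)
qed

text \<open>With its converse \<open>real_op_commute_qop\<close> this passes between an operator and
  its components. It gives access to the components of an inverse, for which no formula is at
  hand.\<close>

lemma real_op_commute_comps:
  assumes "A \<in> right_linear_ops" "real_op r o\<^sub>L A = A o\<^sub>L real_op r" "a \<in> comps A"
  shows "r o\<^sub>L a = a o\<^sub>L r"
proof -
  obtain A0 A1 A2 A3 where A: "A = qop A0 A1 A2 A3"
    using right_linear_op_qop[OF assms(1)] by blast
  have "qop (r o\<^sub>L A0) (r o\<^sub>L A1) (r o\<^sub>L A2) (r o\<^sub>L A3) = qop (A0 o\<^sub>L r) (A1 o\<^sub>L r) (A2 o\<^sub>L r) (A3 o\<^sub>L r)"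
    using assms(2) unfolding A real_op_qop qop_compose by (simp add: op_simps)
  from arg_cong[OF this, of comp0] arg_cong[OF this, of comp1] arg_cong[OF this, of comp2] arg_cong[OF this, of comp3]
  have "r o\<^sub>L A0 = A0 o\<^sub>L r" "r o\<^sub>L A1 = A1 o\<^sub>L r" "r o\<^sub>L A2 = A2 o\<^sub>L r" "r o\<^sub>L A3 = A3 o\<^sub>L r"
    by simp_all
  then show ?thesis using assms(3) unfolding A comps_qop by auto
qed

lemma real_op_commute_qop:
  assumes "A \<in> right_linear_ops" "\<And>a. a \<in> comps A \<Longrightarrow> r o\<^sub>L a = a o\<^sub>L r"
  shows "real_op r o\<^sub>L A = A o\<^sub>L real_op r"
proof -
  obtain A0 A1 A2 A3 where A: "A = qop A0 A1 A2 A3"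
    using right_linear_op_qop[OF assms(1)] by blast
  show ?thesis using assms(2) unfolding A real_op_qop qop_compose comps_qop by (simp add: op_simps)
qed

lemma right_linear_ops_algebra:
  "id_blinfun \<in> right_linear_ops" "A \<in> right_linear_ops \<Longrightarrow> r *\<^sub>R A \<in> right_linear_ops"
  "A \<in> right_linear_ops \<Longrightarrow> B \<in> right_linear_ops \<Longrightarrow> A o\<^sub>L B \<in> right_linear_ops"
  "A \<in> right_linear_ops \<Longrightarrow> B \<in> right_linear_ops \<Longrightarrow> A + B \<in> right_linear_ops"
  "A \<in> right_linear_ops \<Longrightarrow> B \<in> right_linear_ops \<Longrightarrow> A - B \<in> right_linear_ops"
proof -
  have "right_scale (x + y) q = right_scale x q + right_scale y q"
    "right_scale (x - y) q = right_scale x q - right_scale y q"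
    "right_scale (r *\<^sub>R x) q = r *\<^sub>R right_scale x q" for x y :: "'x::real_normed_vector qmod" and q r
    by (cases x; cases y; cases q; simp add: algebra_simps)+
  note rs = this
  show "id_blinfun \<in> right_linear_ops" by (rule right_linearI) simp
  show "A \<in> right_linear_ops \<Longrightarrow> r *\<^sub>R A \<in> right_linear_ops"
    "A \<in> right_linear_ops \<Longrightarrow> B \<in> right_linear_ops \<Longrightarrow> A o\<^sub>L B \<in> right_linear_ops"
    "A \<in> right_linear_ops \<Longrightarrow> B \<in> right_linear_ops \<Longrightarrow> A + B \<in> right_linear_ops"
    "A \<in> right_linear_ops \<Longrightarrow> B \<in> right_linear_ops \<Longrightarrow> A - B \<in> right_linear_ops"
    by (auto intro!: right_linearI simp: right_linearD apply_simps rs)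
qed

lemma lmul_right_linear: "lmul q \<in> right_linear_ops"
  by (rule right_linearI) (simp add: lmul.rep_eq left_right_scale_assoc)

lemma real_op_right_linear: "real_op A \<in> right_linear_ops"
  by (simp add: real_op_qop qop_right_linear)

section \<open>Inverses of right linear operators and their stability\<close>

lemma inverse_right_linear:
  assumes "A \<in> right_linear_ops" "A o\<^sub>L B = id_blinfun" "B o\<^sub>L A = id_blinfun"
  shows "B \<in> right_linear_ops"
proof -
  have AB: "blinfun_apply A (blinfun_apply B x) = x" and BA: "blinfun_apply B (blinfun_apply A x) = x" for x
    using assms(2,3) by (metis blinfun_apply_blinfun_compose blinfun_apply_id_blinfun id_apply)+
  have "blinfun_apply B (right_scale x q) = right_scale (blinfun_apply B x) q" for x q
  proof -
    have "right_scale x q = blinfun_apply A (right_scale (blinfun_apply B x) q)"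
      using right_linearD[OF assms(1)] by (simp add: AB)
    then show ?thesis by (metis BA)
  qed
  then show ?thesis by (rule right_linearI)
qed

lemma is_op_inverseI:
  "A \<in> right_linear_ops \<Longrightarrow> A o\<^sub>L B = id_blinfun \<Longrightarrow> B o\<^sub>L A = id_blinfun \<Longrightarrow> is_op_inverse A B"
  by (simp add: is_op_inverse_def inverse_right_linear)

lemma is_op_inverse_unique: "is_op_inverse A B \<Longrightarrow> is_op_inverse A C \<Longrightarrow> B = C"
proof -
  assume B: "is_op_inverse A B" and C: "is_op_inverse A C"
  have "B = B o\<^sub>L (A o\<^sub>L C)" using C by (simp add: is_op_inverse_def)
  also have "\<dots> = C" unfolding blinfun_compose_assoc[symmetric] using B by (simp add: is_op_inverse_def)
  finally show "B = C" .
qed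

lemma op_inv_eq: "is_op_inverse A B \<Longrightarrow> op_inv A = B"
  unfolding op_inv_def by (blast intro: is_op_inverse_unique)

text \<open>C B = B A C B = B C A B = B C.\<close>

lemma op_inv_commute:
  assumes "is_op_inverse A B" "C o\<^sub>L A = A o\<^sub>L C"
  shows "C o\<^sub>L B = B o\<^sub>L C"
proof -
  have "C o\<^sub>L B = (B o\<^sub>L A) o\<^sub>L C o\<^sub>L B" using assms(1) by (simp add: is_op_inverse_def)
  also have "\<dots> = B o\<^sub>L (A o\<^sub>L C) o\<^sub>L B" by (simp only: blinfun_compose_assoc)
  also have "\<dots> = B o\<^sub>L C o\<^sub>L (A o\<^sub>L B)" unfolding assms(2)[symmetric] by (simp only: blinfun_compose_assoc)
  finally show ?thesis using assms(1) by (simp add: is_op_inverse_def)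
qed

text \<open>B Q is a left inverse and Q B a right inverse of P, so the two coincide.\<close>

lemma is_op_inverse_factor:
  assumes "P o\<^sub>L Q = A" "Q o\<^sub>L P = A" "P \<in> right_linear_ops" "is_op_inverse A B"
  shows "\<exists>B'. is_op_inverse P B'"
proof -
  have AB: "A o\<^sub>L B = id_blinfun" and BA: "B o\<^sub>L A = id_blinfun"
    using assms(4) by (auto simp: is_op_inverse_def)
  have 1: "P o\<^sub>L (Q o\<^sub>L B) = id_blinfun"
    unfolding blinfun_compose_assoc[symmetric] assms(1) by (rule AB)
  have 2: "(B o\<^sub>L Q) o\<^sub>L P = id_blinfun"
    unfolding blinfun_compose_assoc assms(2) by (rule BA)
  have "B o\<^sub>L Q = (B o\<^sub>L Q) o\<^sub>L (P o\<^sub>L (Q o\<^sub>L B))" by (simp add: 1)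
  also have "\<dots> = Q o\<^sub>L B" unfolding blinfun_compose_assoc[symmetric] 2 by simp
  finally have "(Q o\<^sub>L B) o\<^sub>L P = id_blinfun" using 2 by simp
  then show ?thesis using 1 assms(3) is_op_inverseI by blast
qed

text \<open>The geometric series. Both recursions for the powers, with C in front and with C behind,
  are used, one for each side of the inverse.\<close>

lemma Neumann_inverse:
  fixes C :: "'a::banach \<Rightarrow>\<^sub>L 'a"
  assumes "norm C < 1"
  shows "\<exists>N. (id_blinfun - C) o\<^sub>L N = id_blinfun \<and> N o\<^sub>L (id_blinfun - C) = id_blinfun"
proof -
  define pw where "pw n = ((o\<^sub>L) C ^^ n) id_blinfun" for n
  have pw_Suc: "pw (Suc n) = C o\<^sub>L pw n" for n by (simp add: pw_def)
  have pw_Suc': "pw (Suc n) = pw n o\<^sub>L C" for n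
  proof (induction n)
    case 0
    show ?case by (simp add: pw_def)
  next
    case (Suc n)
    have "pw (Suc (Suc n)) = C o\<^sub>L (pw n o\<^sub>L C)" by (simp only: pw_Suc[of "Suc n"] Suc)
    also have "\<dots> = (C o\<^sub>L pw n) o\<^sub>L C" by (rule blinfun_compose_assoc[symmetric])
    finally show ?case by (simp only: pw_Suc[of n])
  qed
  have bound: "norm (pw n) \<le> norm C ^ n" for n
  proof (induction n)
    case 0
    show ?case by (simp add: pw_def norm_blinfun_id_le)
  next
    case (Suc n)
    have "norm (pw (Suc n)) \<le> norm C * norm (pw n)" unfolding pw_Suc by (rule norm_blinfun_compose)
    also have "\<dots> \<le> norm C * norm C ^ n" by (intro mult_left_mono Suc) simp
    finally show ?case by simp
  qed
  have sm: "summable pw"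
    by (rule summable_comparison_test[OF _ summable_geometric[of "norm C"]]) (use assms bound in auto)
  define N where "N = suminf pw"
  have head: "N - suminf (\<lambda>n. pw (Suc n)) = id_blinfun"
    using suminf_split_head[OF sm] by (simp add: N_def pw_def)
  have left: "suminf (\<lambda>n. pw (Suc n)) = C o\<^sub>L N"
    unfolding pw_Suc N_def
    by (rule bounded_linear.suminf[OF blinfun_compose.bounded_linear_right sm, symmetric])
  have right: "suminf (\<lambda>n. pw (Suc n)) = N o\<^sub>L C"
    unfolding pw_Suc' N_def
    by (rule bounded_linear.suminf[OF blinfun_compose.bounded_linear_left sm, symmetric])
  have "N - (C o\<^sub>L N) = id_blinfun" "N - (N o\<^sub>L C) = id_blinfun"
    using head[unfolded left] head[unfolded right] by blast+
  then have "(id_blinfun - C) o\<^sub>L N = id_blinfun" "N o\<^sub>L (id_blinfun - C) = id_blinfun"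
    by (simp_all add: op_simps)
  then show ?thesis by blast
qed

text \<open>Since B A' = 1 - B (A - A'), a Neumann series N inverts B A', and N B is then the
  inverse of A'.\<close>

lemma is_op_inverse_perturb:
  fixes A :: "'x::banach qop"
  assumes "is_op_inverse A B" "A \<in> right_linear_ops" "A' \<in> right_linear_ops" "norm B * norm (A' - A) < 1"
  shows "\<exists>B'. is_op_inverse A' B'"
proof -
  have AB: "A o\<^sub>L B = id_blinfun" and BA: "B o\<^sub>L A = id_blinfun" using assms(1) by (auto simp: is_op_inverse_def)
  have "norm (B o\<^sub>L (A - A')) < 1"
    using assms(4) norm_blinfun_compose[of B "A - A'"] by (simp add: norm_minus_commute)
  then obtain N where N: "(id_blinfun - (B o\<^sub>L (A - A'))) o\<^sub>L N = id_blinfun"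
      "N o\<^sub>L (id_blinfun - (B o\<^sub>L (A - A'))) = id_blinfun"
    using Neumann_inverse by blast
  have "id_blinfun - (B o\<^sub>L (A - A')) = B o\<^sub>L A'" by (simp add: op_simps BA)
  then have N: "B o\<^sub>L A' o\<^sub>L N = id_blinfun" "N o\<^sub>L (B o\<^sub>L A') = id_blinfun" using N by simp_all
  have "A' o\<^sub>L (N o\<^sub>L B) = A o\<^sub>L B o\<^sub>L A' o\<^sub>L (N o\<^sub>L B)" by (simp add: AB)
  also have "\<dots> = A o\<^sub>L (B o\<^sub>L A' o\<^sub>L N) o\<^sub>L B" by (simp add: blinfun_compose_assoc)
  also have "\<dots> = id_blinfun" by (simp add: N AB)
  finally have "A' o\<^sub>L (N o\<^sub>L B) = id_blinfun" .
  moreover have "N o\<^sub>L B o\<^sub>L A' = id_blinfun" using N(2) by (simp add: blinfun_compose_assoc)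
  ultimately show ?thesis using assms(3) is_op_inverseI by blast
qed

section \<open>The S-resolvent set\<close>

text \<open>With \<open>nu T\<close> below these are half the trace and the norm of T as a
  quaternion: for commuting components T^2 - 2 (tau T) T + nu T = 0. Both are real operators and so
  commute with every \<open>lmul q\<close>.\<close>

definition tau :: "'x::real_normed_vector qop \<Rightarrow> 'x qop" where
  "tau T = real_op (comp0 T)"

definition nu :: "'x::real_normed_vector qop \<Rightarrow> 'x qop" where
  "nu T = real_op ((comp0 T o\<^sub>L comp0 T) + (comp1 T o\<^sub>L comp1 T) + (comp2 T o\<^sub>L comp2 T) + (comp3 T o\<^sub>L comp3 T))"

lemma compose_eq_apply: "A o\<^sub>L B = C o\<^sub>L D \<Longrightarrow> blinfun_apply A (blinfun_apply B x) = blinfun_apply C (blinfun_apply D x)"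
  by (metis blinfun_apply_blinfun_compose)

lemma commute_compose:
  assumes "A o\<^sub>L B = B o\<^sub>L A" "A o\<^sub>L C = C o\<^sub>L A"
  shows "A o\<^sub>L (B o\<^sub>L C) = (B o\<^sub>L C) o\<^sub>L A"
  unfolding blinfun_compose_assoc assms(2)[symmetric] unfolding blinfun_compose_assoc[symmetric] assms(1) ..

lemma commuting_opsE:
  assumes "T \<in> commuting_ops"
  obtains T0 T1 T2 T3 where "T = qop T0 T1 T2 T3"
    "\<And>a b. a \<in> {T0, T1, T2, T3} \<Longrightarrow> b \<in> {T0, T1, T2, T3} \<Longrightarrow> a o\<^sub>L b = b o\<^sub>L a"
  using assms unfolding commuting_ops_def by fastforce

lemma commuting_ops_right_linear: "T \<in> commuting_ops \<Longrightarrow> T \<in> right_linear_ops"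
  by (auto simp: commuting_ops_def qop_right_linear)

lemma commuting_ops_comps:
  assumes "T \<in> commuting_ops" "a \<in> comps T" "b \<in> comps T"
  shows "a o\<^sub>L b = b o\<^sub>L a"
proof (rule commuting_opsE[OF assms(1)])
  fix T0 T1 T2 T3 assume "T = qop T0 T1 T2 T3"
    "\<And>a b. a \<in> {T0, T1, T2, T3} \<Longrightarrow> b \<in> {T0, T1, T2, T3} \<Longrightarrow> a o\<^sub>L b = b o\<^sub>L a"
  then show ?thesis using assms(2,3) by (simp only: comps_qop)
qed

lemma add_conj_op: "T \<in> right_linear_ops \<Longrightarrow> T + conj_op T = 2 *\<^sub>R tau T"
proof -
  assume "T \<in> right_linear_ops"
  then obtain T0 T1 T2 T3 where T: "T = qop T0 T1 T2 T3" using right_linear_op_qop by blast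
  show ?thesis
    unfolding T tau_def conj_op_qop real_op_qop comp_qop
    by (rule qmod_eqI) (simp add: apply_simps qop_apply_prod scaleR_2)
qed

lemma conj_op_eq: "T \<in> right_linear_ops \<Longrightarrow> conj_op T = 2 *\<^sub>R tau T - T"
  using add_conj_op[of T] by (simp add: algebra_simps)

lemma vec_op_eq: "T \<in> right_linear_ops \<Longrightarrow> vec_op T = T - tau T"
proof -
  assume "T \<in> right_linear_ops"
  then obtain T0 T1 T2 T3 where T: "T = qop T0 T1 T2 T3" using right_linear_op_qop by blast
  show ?thesis
    unfolding T tau_def vec_op_qop real_op_qop comp_qop
    by (rule qmod_eqI) (simp add: apply_simps qop_apply_prod)
qed

lemma compose_conj_op:
  assumes "T \<in> commuting_ops"
  shows "T o\<^sub>L conj_op T = nu T"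
proof (rule commuting_opsE[OF assms])
  fix T0 T1 T2 T3 assume T: "T = qop T0 T1 T2 T3"
    and c: "\<And>a b. a \<in> {T0, T1, T2, T3} \<Longrightarrow> b \<in> {T0, T1, T2, T3} \<Longrightarrow> a o\<^sub>L b = b o\<^sub>L a"
  have "T1 o\<^sub>L T0 = T0 o\<^sub>L T1" "T2 o\<^sub>L T0 = T0 o\<^sub>L T2" "T3 o\<^sub>L T0 = T0 o\<^sub>L T3"
    "T2 o\<^sub>L T1 = T1 o\<^sub>L T2" "T3 o\<^sub>L T1 = T1 o\<^sub>L T3" "T3 o\<^sub>L T2 = T2 o\<^sub>L T3"
    by (rule c; simp)+
  then show ?thesis
    unfolding T nu_def conj_op_qop qop_compose real_op_qop comp_qop by (simp add: op_simps)
qed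

lemma real_op_commute:
  assumes "T \<in> right_linear_ops" "\<And>a. a \<in> comps T \<Longrightarrow> r o\<^sub>L a = a o\<^sub>L r"
  shows "real_op r o\<^sub>L T = T o\<^sub>L real_op r" "real_op r o\<^sub>L tau T = tau T o\<^sub>L real_op r"
    "real_op r o\<^sub>L nu T = nu T o\<^sub>L real_op r"
proof -
  show "real_op r o\<^sub>L T = T o\<^sub>L real_op r" using assms by (rule real_op_commute_qop)
  have c: "r o\<^sub>L comp0 T = comp0 T o\<^sub>L r" "r o\<^sub>L comp1 T = comp1 T o\<^sub>L r" "r o\<^sub>L comp2 T = comp2 T o\<^sub>L r"
    "r o\<^sub>L comp3 T = comp3 T o\<^sub>L r"
    by (rule assms(2); simp add: comps_def)+
  show "real_op r o\<^sub>L tau T = tau T o\<^sub>L real_op r"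
    by (simp add: tau_def real_op_compose[symmetric] c)
  have "r o\<^sub>L (a o\<^sub>L a) = a o\<^sub>L a o\<^sub>L r" if "r o\<^sub>L a = a o\<^sub>L r" for a
    using commute_compose[OF that that] .
  then show "real_op r o\<^sub>L nu T = nu T o\<^sub>L real_op r"
    by (simp add: nu_def real_op_compose[symmetric] c op_simps)
qed

lemma tau_nu_commute:
  assumes "T \<in> commuting_ops"
  shows "tau T o\<^sub>L T = T o\<^sub>L tau T" "nu T o\<^sub>L T = T o\<^sub>L nu T" "tau T o\<^sub>L nu T = nu T o\<^sub>L tau T"
proof -
  note rl = commuting_ops_right_linear[OF assms]
  have c: "comp0 T o\<^sub>L a = a o\<^sub>L comp0 T" if "a \<in> comps T" for a
    using that by (intro commuting_ops_comps[OF assms]) (auto simp: comps_def)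
  show t: "tau T o\<^sub>L T = T o\<^sub>L tau T" and "tau T o\<^sub>L nu T = nu T o\<^sub>L tau T"
    using real_op_commute[OF rl c] by (simp_all add: tau_def)
  have "conj_op T o\<^sub>L T = T o\<^sub>L conj_op T" by (simp add: conj_op_eq[OF rl] op_simps t)
  then show "nu T o\<^sub>L T = T o\<^sub>L nu T"
    unfolding compose_conj_op[OF assms, symmetric] by (intro commute_compose[symmetric]) simp_all
qed

lemma Q_c_eq:
  assumes "T \<in> commuting_ops"
  shows "Q_c s T = lmul (s * s) - 2 *\<^sub>R (lmul s o\<^sub>L tau T) + nu T"
  unfolding Q_c_def add_conj_op[OF commuting_ops_right_linear[OF assms]] compose_conj_op[OF assms]
  by (simp add: op_simps)

lemma tau_lmul_commute: "tau T o\<^sub>L lmul q = lmul q o\<^sub>L tau T"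
  and nu_lmul_commute: "nu T o\<^sub>L lmul q = lmul q o\<^sub>L nu T"
  by (simp_all add: tau_def nu_def real_op_lmul_commute)

lemma tau_nu_right_linear: "tau T \<in> right_linear_ops" "nu T \<in> right_linear_ops"
  by (simp_all add: tau_def nu_def real_op_right_linear)

lemma Q_c_right_linear: "T \<in> commuting_ops \<Longrightarrow> Q_c s T \<in> right_linear_ops"
  by (simp add: Q_c_eq right_linear_ops_algebra tau_nu_right_linear lmul_right_linear)

lemma conj_op_linear:
  "conj_op (A + B) = conj_op A + conj_op B" "conj_op (A - B) = conj_op A - conj_op B"
  "conj_op (r *\<^sub>R A) = r *\<^sub>R conj_op A"
  by (rule qmod_eqI, simp add: conj_op_def comp0_def comp1_def comp2_def comp3_def op_simps
      qop_apply_prod apply_simps algebra_simps)+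

lemma conj_op_id: "conj_op id_blinfun = id_blinfun"
proof -
  have "id_blinfun = qop id_blinfun 0 0 0"
    by (rule qmod_eqI) (simp add: qop_apply_prod)
  then show ?thesis by (metis conj_op_qop minus_zero)
qed

lemma quat_square: "s * s = of_real (2 * qre s) * s - of_real ((norm s)\<^sup>2)" for s :: quat
  unfolding quat_norm_sq
  by (simp add: quat_eq_iff of_real_def quat_arith_defs power2_eq_square)

lemma resolvent_factorization:
  assumes T: "T \<in> commuting_ops" and A: "A = (T o\<^sub>L T) - (2 * qre s) *\<^sub>R T + (norm s)\<^sup>2 *\<^sub>R id_blinfun"
    and s': "s' = of_real (2 * qre s) - s"
  shows "Q_c s T o\<^sub>L Q_c s' T = A o\<^sub>L conj_op A" "Q_c s' T o\<^sub>L Q_c s T = A o\<^sub>L conj_op A"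
proof -
  note rl = commuting_ops_right_linear[OF T]
  have "conj_op (T o\<^sub>L T) = conj_op T o\<^sub>L conj_op T"
    using commuting_ops_comps[OF T] by (intro conj_op_compose rl)
  then have cA: "conj_op A = (conj_op T o\<^sub>L conj_op T) - (2 * qre s) *\<^sub>R conj_op T + (norm s)\<^sup>2 *\<^sub>R id_blinfun"
    by (simp add: A conj_op_linear conj_op_id)
  have TT: "T o\<^sub>L T = 2 *\<^sub>R (tau T o\<^sub>L T) - nu T"
    using compose_conj_op[OF T] by (simp add: conj_op_eq[OF rl] op_simps tau_nu_commute[OF T] algebra_simps)
  have TTx: "blinfun_apply T (blinfun_apply T x) = 2 *\<^sub>R blinfun_apply (tau T) (blinfun_apply T x) - blinfun_apply (nu T) x" for x
    using arg_cong[OF TT, of "\<lambda>A. blinfun_apply A x"] by (simp add: apply_simps)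
  have com: "blinfun_apply T (blinfun_apply (tau T) x) = blinfun_apply (tau T) (blinfun_apply T x)"
    "blinfun_apply T (blinfun_apply (nu T) x) = blinfun_apply (nu T) (blinfun_apply T x)"
    "blinfun_apply (nu T) (blinfun_apply (tau T) x) = blinfun_apply (tau T) (blinfun_apply (nu T) x)"
    "blinfun_apply (lmul s) (blinfun_apply (tau T) x) = blinfun_apply (tau T) (blinfun_apply (lmul s) x)"
    "blinfun_apply (lmul s) (blinfun_apply (nu T) x) = blinfun_apply (nu T) (blinfun_apply (lmul s) x)" for x
    by (rule compose_eq_apply; simp add: tau_nu_commute[OF T] tau_lmul_commute nu_lmul_commute)+
  have ss: "lmul (s * s) = (2 * qre s) *\<^sub>R lmul s - (norm s)\<^sup>2 *\<^sub>R id_blinfun"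
    unfolding quat_square by (simp add: linear_diff[OF linear_lmul] lmul_mult lmul_of_real op_simps del: of_real_mult of_real_power)
  have LLx: "blinfun_apply (lmul s) (blinfun_apply (lmul s) x) = (2 * qre s) *\<^sub>R blinfun_apply (lmul s) x - (norm s)\<^sup>2 *\<^sub>R x" for x
    using arg_cong[OF ss, of "\<lambda>A. blinfun_apply A x"] by (simp add: lmul_mult apply_simps)
  have s's': "lmul (s' * s') = (2 * qre s) *\<^sub>R lmul s' - (norm s)\<^sup>2 *\<^sub>R id_blinfun"
  proof -
    have "s' * s' = of_real (2 * qre s) * s' - of_real ((norm s)\<^sup>2)"
      unfolding s' quat_norm_sq
      by (simp add: quat_eq_iff of_real_def quat_arith_defs power2_eq_square algebra_simps)
    then show ?thesis by (simp add: linear_diff[OF linear_lmul] lmul_mult lmul_of_real op_simps del: of_real_mult of_real_power)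
  qed
  have ls': "lmul s' = (2 * qre s) *\<^sub>R id_blinfun - lmul s"
    unfolding s' by (simp add: linear_diff[OF linear_lmul] lmul_of_real del: of_real_mult of_real_power)
  have Q: "Q_c s T = (2 * qre s) *\<^sub>R lmul s - (norm s)\<^sup>2 *\<^sub>R id_blinfun - 2 *\<^sub>R (tau T o\<^sub>L lmul s) + nu T"
    unfolding Q_c_eq[OF T] ss by (simp add: tau_lmul_commute)
  have Q': "Q_c s' T = (2 * qre s) *\<^sub>R ((2 * qre s) *\<^sub>R id_blinfun - lmul s) - (norm s)\<^sup>2 *\<^sub>R id_blinfun
      - 2 *\<^sub>R ((2 * qre s) *\<^sub>R tau T - (tau T o\<^sub>L lmul s)) + nu T"
    unfolding Q_c_eq[OF T] s's' by (simp add: ls' op_simps tau_lmul_commute)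
  show "Q_c s T o\<^sub>L Q_c s' T = A o\<^sub>L conj_op A" "Q_c s' T o\<^sub>L Q_c s T = A o\<^sub>L conj_op A"
    unfolding Q Q' cA unfolding A conj_op_eq[OF rl]
    by (rule blinfun_eqI, simp add: apply_simps TTx com LLx algebra_simps)+
qed

text \<open>The resolvent set is defined through A, the kernels through \<open>Q_c s T\<close>. If B
  inverts A, then \<open>conj_op B\<close> inverts \<open>conj_op A\<close>, so A times its
  conjugate is invertible, and the factorization exhibits \<open>Q_c s T\<close> as a commuting
  factor of this product.\<close>

lemma S_resolvent_set_imp_Q_c_invertible:
  assumes T: "T \<in> commuting_ops" and s: "s \<in> S_resolvent_set T"
  shows "\<exists>B. is_op_inverse (Q_c s T) B"
proof -
  note rl = commuting_ops_right_linear[OF T]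
  define A where "A = (T o\<^sub>L T) - (2 * qre s) *\<^sub>R T + (norm s)\<^sup>2 *\<^sub>R id_blinfun"
  obtain B where B: "is_op_inverse A B" using s by (auto simp: S_resolvent_set_def A_def)
  have Arl: "A \<in> right_linear_ops" unfolding A_def by (intro right_linear_ops_algebra rl)
  have Brl: "B \<in> right_linear_ops" using B by (simp add: is_op_inverse_def)
  have AB: "A o\<^sub>L B = id_blinfun" and BA: "B o\<^sub>L A = id_blinfun" using B by (auto simp: is_op_inverse_def)
  text \<open>Every real operator commuting with the components of \<open>T\<close> commutes with \<open>A\<close>, hence with \<open>B\<close>
    and with the components of both; applied to these components themselves, all of them commute.\<close>
  have comA: "real_op r o\<^sub>L A = A o\<^sub>L real_op r" if "\<And>a. a \<in> comps T \<Longrightarrow> r o\<^sub>L a = a o\<^sub>L r" for r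
  proof -
    have c: "real_op r o\<^sub>L T = T o\<^sub>L real_op r" using real_op_commute(1)[OF rl that] .
    have "real_op r o\<^sub>L (T o\<^sub>L T) = T o\<^sub>L T o\<^sub>L real_op r" by (rule commute_compose[OF c c])
    then show ?thesis by (simp add: A_def op_simps c)
  qed
  have comB: "real_op r o\<^sub>L B = B o\<^sub>L real_op r" if "\<And>a. a \<in> comps T \<Longrightarrow> r o\<^sub>L a = a o\<^sub>L r" for r
    using op_inv_commute[OF B comA[OF that]] .
  have 1: "a o\<^sub>L b = b o\<^sub>L a" if "a \<in> comps T" "b \<in> comps A" for a b
    using real_op_commute_comps[OF Arl comA that(2)] commuting_ops_comps[OF T that(1)] by blast
  have 2: "a o\<^sub>L b = b o\<^sub>L a" if "a \<in> comps A" "b \<in> comps B" for a b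
    using real_op_commute_comps[OF Brl comB that(2), of a] 1[OF _ that(1)] by metis
  have "conj_op B o\<^sub>L conj_op A = id_blinfun"
    using conj_op_compose[OF Arl Brl 2] by (simp add: AB conj_op_id)
  moreover have "conj_op A o\<^sub>L conj_op B = id_blinfun"
    using conj_op_compose[OF Brl Arl 2[symmetric]] by (simp add: BA conj_op_id)
  ultimately have "A o\<^sub>L (conj_op A o\<^sub>L conj_op B) o\<^sub>L B = id_blinfun"
    "conj_op B o\<^sub>L (B o\<^sub>L A) o\<^sub>L conj_op A = id_blinfun"
    using AB BA by simp_all
  then have "(A o\<^sub>L conj_op A) o\<^sub>L (conj_op B o\<^sub>L B) = id_blinfun"
    "(conj_op B o\<^sub>L B) o\<^sub>L (A o\<^sub>L conj_op A) = id_blinfun"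
    by (simp_all only: blinfun_compose_assoc)
  moreover have "A o\<^sub>L conj_op A \<in> right_linear_ops"
    by (intro right_linear_ops_algebra Arl) (simp add: conj_op_def qop_right_linear)
  ultimately have "is_op_inverse (A o\<^sub>L conj_op A) (conj_op B o\<^sub>L B)"
    by (intro is_op_inverseI)
  then show ?thesis
    using is_op_inverse_factor[OF resolvent_factorization[OF T A_def refl] Q_c_right_linear[OF T]] by blast
qed

lemma bounded_linear_qre: "bounded_linear qre"
proof (rule bounded_linear_intro[where K = 1])
  fix x :: quat
  have "(qre x)\<^sup>2 \<le> (norm x)\<^sup>2" by (simp add: quat_norm_sq)
  then show "norm (qre x) \<le> norm x * 1" using abs_le_square_iff[of "qre x" "norm x"] by simp
qed (simp_all add: quat_arith_defs)

text \<open>The quadratic expression in T varies continuously with s, and invertibility survives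
  small perturbations.\<close>

lemma open_S_resolvent_set:
  fixes T :: "'x::banach qop"
  assumes "T \<in> right_linear_ops"
  shows "open (S_resolvent_set T)"

proof (subst open_subopen, intro ballI)
  define A where "A s = (T o\<^sub>L T) - (2 * qre s) *\<^sub>R T + (norm s)\<^sup>2 *\<^sub>R id_blinfun" for s
  have rl: "A s \<in> right_linear_ops" for s unfolding A_def by (intro right_linear_ops_algebra assms)
  fix s assume "s \<in> S_resolvent_set T"
  then obtain B where B: "is_op_inverse (A s) B" by (auto simp: S_resolvent_set_def A_def)
  let ?U = "{s'. norm B * norm (A s' - A s) < 1}"
  have "continuous_on UNIV A"
    unfolding A_def[abs_def]
    by (intro continuous_intros bounded_linear.continuous_on[OF bounded_linear_qre])
  then have "open ?U" by (intro open_Collect_less continuous_intros)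
  moreover have "?U \<subseteq> S_resolvent_set T"
    using is_op_inverse_perturb[OF B rl rl] by (auto simp: S_resolvent_set_def A_def)
  ultimately show "\<exists>U. open U \<and> s \<in> U \<and> U \<subseteq> S_resolvent_set T" by (intro exI[of _ ?U]) simp
qed

section \<open>The resolvent on a slice\<close>

lemma is_op_inverse_Q_c:
  "T \<in> commuting_ops \<Longrightarrow> s \<in> S_resolvent_set T \<Longrightarrow> is_op_inverse (Q_c s T) (op_inv (Q_c s T))"
  using S_resolvent_set_imp_Q_c_invertible op_inv_eq by metis

lemma slice_emb_alt: "slice_emb J z = Re z *\<^sub>R 1 + Im z *\<^sub>R J"
  by (simp add: slice_emb_def of_real_def)

lemma slice_emb_add: "slice_emb J (a + b) = slice_emb J a + slice_emb J b"
  and slice_emb_diff: "slice_emb J (a - b) = slice_emb J a - slice_emb J b"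
  and slice_emb_ii: "slice_emb J \<i> = J"
  and slice_emb_cnj: "slice_emb J (cnj z) = slice_emb (- J) z"
  by (simp_all add: slice_emb_alt algebra_simps of_real_def)

lemma slice_emb_mult:
  assumes "J \<in> imag_units"
  shows "slice_emb J (a * b) = slice_emb J a * slice_emb J b"
proof -
  have "J * J = - 1" using assms by (simp add: imag_units_def)
  then show ?thesis by (simp add: slice_emb_alt algebra_simps)
qed

lemma bounded_linear_slice_emb: "bounded_linear (slice_emb J)"
  unfolding slice_emb_alt[abs_def]
  by (intro bounded_linear_add bounded_linear_scaleR_left[THEN bounded_linear_compose] bounded_linear_Re bounded_linear_Im)

lemma open_slice: "open U \<Longrightarrow> open (slice J U)"
  unfolding slice_def
  using open_vimage[of U "slice_emb J"] linear_continuous_on[OF bounded_linear_slice_emb]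
  by (simp add: vimage_def)

text \<open>The homological content of an oriented boundary: V is the inner region, meant to contain
  the spectrum, and \<Omega> the domain of holomorphy. Unlike boundaries of domains, such cycles can
  be conjugated and passed on to larger \<Omega> without further proof about their shape.\<close>

definition encircles :: "(real \<Rightarrow> complex) set \<Rightarrow> complex set \<Rightarrow> complex set \<Rightarrow> bool" where
  "encircles \<Gamma> V \<Omega> \<longleftrightarrow> finite \<Gamma> \<and> open V \<and> open \<Omega> \<and> V \<subseteq> \<Omega> \<and>
    (\<forall>\<gamma>\<in>\<Gamma>. valid_path \<gamma> \<and> pathfinish \<gamma> = pathstart \<gamma> \<and> path_image \<gamma> \<subseteq> \<Omega> - V) \<and>
    (\<forall>w\<in>V. (\<Sum>\<gamma>\<in>\<Gamma>. winding_number \<gamma> w) = 1) \<and>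
    (\<forall>w. w \<notin> \<Omega> \<longrightarrow> (\<Sum>\<gamma>\<in>\<Gamma>. winding_number \<gamma> w) = 0)"

lemma encirclesD:
  assumes "encircles \<Gamma> V \<Omega>"
  shows "finite \<Gamma>" "open V" "open \<Omega>" "V \<subseteq> \<Omega>"
    "\<And>\<gamma>. \<gamma> \<in> \<Gamma> \<Longrightarrow> valid_path \<gamma>" "\<And>\<gamma>. \<gamma> \<in> \<Gamma> \<Longrightarrow> pathfinish \<gamma> = pathstart \<gamma>"
    "\<And>\<gamma>. \<gamma> \<in> \<Gamma> \<Longrightarrow> path_image \<gamma> \<subseteq> \<Omega> - V"
    "\<And>w. w \<in> V \<Longrightarrow> (\<Sum>\<gamma>\<in>\<Gamma>. winding_number \<gamma> w) = 1"
    "\<And>w. w \<notin> \<Omega> \<Longrightarrow> (\<Sum>\<gamma>\<in>\<Gamma>. winding_number \<gamma> w) = 0"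
  using assms by (auto simp: encircles_def)

lemma encircles_paths:
  "encircles \<Gamma> V \<Omega> \<Longrightarrow> \<gamma> \<in> \<Gamma> \<Longrightarrow> valid_path \<gamma> \<and> pathfinish \<gamma> = pathstart \<gamma> \<and> path_image \<gamma> \<subseteq> \<Omega>"
  by (auto simp: encircles_def)

lemma encircles_mono: "encircles \<Gamma> V \<Omega> \<Longrightarrow> \<Omega> \<subseteq> \<Omega>' \<Longrightarrow> open \<Omega>' \<Longrightarrow> encircles \<Gamma> V \<Omega>'"
  unfolding encircles_def by blast

lemma encircles_Cauchy_theorem:
  assumes "encircles \<Gamma> V \<Omega>" "f holomorphic_on \<Omega>"
  shows "(\<Sum>\<gamma>\<in>\<Gamma>. contour_integral \<gamma> f) = 0"
proof -
  note enc = encirclesD[OF assms(1)]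
  have "(\<Sum>\<gamma>\<in>\<Gamma>. 1 * contour_integral \<gamma> f) = 0"
    by (rule Cauchy_theorem_cycle[OF enc(3) assms(2) enc(1)]) (use encircles_paths[OF assms(1)] enc(9) in auto)
  then show ?thesis by simp
qed

lemma encircles_Cauchy_formula:
  assumes "encircles \<Gamma> V \<Omega>" "f holomorphic_on \<Omega>" "z \<in> V"
  shows "(\<Sum>\<gamma>\<in>\<Gamma>. contour_integral \<gamma> (\<lambda>w. f w / (w - z))) = 2 * pi * \<i> * f z"
proof -
  have "z \<in> \<Omega>" "\<And>\<gamma>. \<gamma> \<in> \<Gamma> \<Longrightarrow> z \<notin> path_image \<gamma>" using encirclesD[OF assms(1)] assms(3) by blast+
  then have "(\<Sum>\<gamma>\<in>\<Gamma>. 1 * contour_integral \<gamma> (\<lambda>w. f w / (w - z))) =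
      2 * pi * \<i> * (\<Sum>\<gamma>\<in>\<Gamma>. 1 * winding_number \<gamma> z) * f z"
    by (intro Cauchy_integral_formula_cycle[OF encirclesD(3)[OF assms(1)] assms(2) encirclesD(1)[OF assms(1)]])
      (use encircles_paths[OF assms(1)] encirclesD(9)[OF assms(1)] in auto)
  then show ?thesis using encirclesD(8)[OF assms(1,3)] by simp
qed

text \<open>The difference of the two cycles winds zero times around points outside \<Omega>, where
  both numbers are 0, and around points of \<Omega> outside S, where both are 1. In the application
  S is the resolvent set on the slice.\<close>

lemma encircles_homologous:
  assumes "encircles \<Gamma>1 V1 \<Omega>" "encircles \<Gamma>2 V2 \<Omega>" "open S" "\<Omega> - S \<subseteq> V1 \<inter> V2" "f holomorphic_on \<Omega> \<inter> S"
  shows "(\<Sum>\<gamma>\<in>\<Gamma>1. contour_integral \<gamma> f) = (\<Sum>\<gamma>\<in>\<Gamma>2. contour_integral \<gamma> f)"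
proof -
  \<comment> \<open>A curve belonging to both cycles receives weight zero.\<close>
  define c :: "(real \<Rightarrow> complex) \<Rightarrow> complex" where
    "c \<gamma> = (if \<gamma> \<in> \<Gamma>1 then 1 else 0) - (if \<gamma> \<in> \<Gamma>2 then 1 else 0)" for \<gamma>
  note 1 = encirclesD[OF assms(1)] and 2 = encirclesD[OF assms(2)]
  have fin: "finite (\<Gamma>1 \<union> \<Gamma>2)" using 1(1) 2(1) by simp
  have split: "(\<Sum>\<gamma>\<in>\<Gamma>1 \<union> \<Gamma>2. c \<gamma> * G \<gamma>) = (\<Sum>\<gamma>\<in>\<Gamma>1. G \<gamma>) - (\<Sum>\<gamma>\<in>\<Gamma>2. G \<gamma>)" for G
  proof -
    have "(\<Sum>\<gamma>\<in>\<Gamma>1 \<union> \<Gamma>2. c \<gamma> * G \<gamma>) =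
        (\<Sum>\<gamma>\<in>\<Gamma>1 \<union> \<Gamma>2. if \<gamma> \<in> \<Gamma>1 then G \<gamma> else 0) - (\<Sum>\<gamma>\<in>\<Gamma>1 \<union> \<Gamma>2. if \<gamma> \<in> \<Gamma>2 then G \<gamma> else 0)"
      unfolding sum_subtractf[symmetric] by (intro sum.cong) (auto simp: c_def)
    also have "\<dots> = (\<Sum>\<gamma>\<in>(\<Gamma>1 \<union> \<Gamma>2) \<inter> \<Gamma>1. G \<gamma>) - (\<Sum>\<gamma>\<in>(\<Gamma>1 \<union> \<Gamma>2) \<inter> \<Gamma>2. G \<gamma>)"
      by (simp only: sum.inter_restrict[OF fin])
    also have "(\<Gamma>1 \<union> \<Gamma>2) \<inter> \<Gamma>1 = \<Gamma>1" by blast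
    also have "(\<Gamma>1 \<union> \<Gamma>2) \<inter> \<Gamma>2 = \<Gamma>2" by blast
    finally show ?thesis .
  qed
  have "(\<Sum>\<gamma>\<in>\<Gamma>1 \<union> \<Gamma>2. c \<gamma> * contour_integral \<gamma> f) = 0"
  proof (rule Cauchy_theorem_cycle[OF _ assms(5) fin])
    show "open (\<Omega> \<inter> S)" by (intro open_Int 1(3) assms(3))
    show "valid_path \<gamma> \<and> pathfinish \<gamma> = pathstart \<gamma> \<and> path_image \<gamma> \<subseteq> \<Omega> \<inter> S" if "\<gamma> \<in> \<Gamma>1 \<union> \<Gamma>2" for \<gamma>
      using that 1(5-7)[of \<gamma>] 2(5-7)[of \<gamma>] assms(4) by blast
    show "(\<Sum>\<gamma>\<in>\<Gamma>1 \<union> \<Gamma>2. c \<gamma> * winding_number \<gamma> w) = 0" if w: "w \<notin> \<Omega> \<inter> S" for w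
    proof (cases "w \<in> \<Omega>")
      case True
      then have "w \<in> V1" "w \<in> V2" using w assms(4) by blast+
      then show ?thesis by (simp add: split 1(8) 2(8))
    qed (simp add: split 1(9) 2(9))
  qed
  then show ?thesis by (simp add: split)
qed

context complex_structure
begin

text \<open>Fitted to the resolvent identity, which delivers increments already factored by w - z;
  continuity of the other factor is then all that differentiability requires.\<close>

lemma has_derivative_cmI:
  assumes "open S" "z \<in> S" "\<And>w. w \<in> S \<Longrightarrow> h w = h z + cm (w - z) (G w)" "isCont G z"
  shows "(h has_derivative (\<lambda>k. cm k (G z))) (at z)"
  unfolding has_derivative_at_alt
proof (intro conjI allI impI)
  show "bounded_linear (\<lambda>k. cm k (G z))" by (rule cm.bounded_linear_left)
  fix e :: real assume e: "e > 0"
  obtain K where K: "K > 0" "\<And>c x. norm (cm c x) \<le> norm c * norm x * K"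
    using cm.pos_bounded by blast
  obtain d1 where d1: "d1 > 0" "\<And>w. dist w z < d1 \<Longrightarrow> dist (G w) (G z) < e / K"
    using assms(4) divide_pos_pos[OF e K(1)] unfolding continuous_at_eps_delta by blast
  obtain d2 where d2: "d2 > 0" "ball z d2 \<subseteq> S" using assms(1,2) openE by blast
  show "\<exists>d>0. \<forall>w. norm (w - z) < d \<longrightarrow> norm (h w - h z - cm (w - z) (G z)) \<le> e * norm (w - z)"
  proof (intro exI conjI allI impI)
    show "min d1 d2 > 0" using d1 d2 by simp
    fix w assume w: "norm (w - z) < min d1 d2"
    then have "w \<in> ball z d2" by (simp add: dist_norm norm_minus_commute)
    then have "w \<in> S" using d2 by blast
    then have "h w - h z - cm (w - z) (G z) = cm (w - z) (G w - G z)"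
      using assms(3) by (simp add: cm.diff_right)
    moreover have "norm (G w - G z) \<le> e / K" using d1(2)[of w] w by (simp add: dist_norm)
    then have "norm (cm (w - z) (G w - G z)) \<le> norm (w - z) * (e / K) * K"
      using K(1) by (intro order_trans[OF K(2)] mult_right_mono mult_left_mono) auto
    ultimately show "norm (h w - h z - cm (w - z) (G z)) \<le> e * norm (w - z)"
      using K(1) by (simp add: mult.commute)
  qed
qed

end

section \<open>Right complex structure, resolvent identity and weights for one imaginary
  unit\<close>

locale slice_calculus =
  fixes T :: "'x::banach qop" and J :: quat
  assumes T: "T \<in> commuting_ops" and J: "J \<in> imag_units"
begin

text \<open>Scalars act by composition on the right and leave the left side free: composing with any
  operator on the left is complex linear, even if it does not commute with J.\<close>

sublocale complex_structure "\<lambda>A :: 'x qop. A o\<^sub>L lmul J"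
proof (rule complex_structure.intro)
  show "bounded_linear (\<lambda>A :: 'x qop. A o\<^sub>L lmul J)" by (rule blinfun_compose.bounded_linear_left)
  have "J * J = - 1" using J by (simp add: imag_units_def)
  then show "(A o\<^sub>L lmul J) o\<^sub>L lmul J = - A" for A :: "'x qop"
    unfolding blinfun_compose_assoc lmul_mult[symmetric]
    by (simp add: linear_neg[OF linear_lmul] op_simps)
qed

definition E :: "complex \<Rightarrow> 'x qop" where "E c = lmul (slice_emb J c)"
definition R :: "complex \<Rightarrow> 'x qop" where "R z = op_inv (Q_c (slice_emb J z) T)"
definition rho :: "complex set" where "rho = slice J (S_resolvent_set T)"

lemma cm_eq: "cm c A = A o\<^sub>L E c"
  by (simp add: cm_def E_def slice_emb_alt lmul_add lmul_scaleR op_simps)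

lemma E_mult: "E (a * b) = E a o\<^sub>L E b"
  by (simp add: E_def slice_emb_mult[OF J] lmul_mult)

lemma E_add: "E (a + b) = E a + E b" and E_diff: "E (a - b) = E a - E b"
  by (simp_all add: E_def slice_emb_add slice_emb_diff lmul_add linear_diff[OF linear_lmul])

lemma E_commute: "E a o\<^sub>L E b = E b o\<^sub>L E a"
  by (metis E_mult mult.commute)

lemma cm_compose_left: "A o\<^sub>L cm c B = cm c (A o\<^sub>L B)"
  by (simp add: cm_eq blinfun_compose_assoc)

lemma open_rho: "open rho"
  unfolding rho_def by (intro open_slice open_S_resolvent_set commuting_ops_right_linear T)

lemma Q_eq: "Q_c (slice_emb J z) T = (E z o\<^sub>L E z) - 2 *\<^sub>R (E z o\<^sub>L tau T) + nu T"
  by (simp add: Q_c_eq[OF T] E_def lmul_mult)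

lemma R_inverse:
  assumes "z \<in> rho"
  shows "Q_c (slice_emb J z) T o\<^sub>L R z = id_blinfun" "R z o\<^sub>L Q_c (slice_emb J z) T = id_blinfun"
  using is_op_inverse_Q_c[OF T, of "slice_emb J z"] assms
  by (auto simp: rho_def slice_def R_def is_op_inverse_def)

text \<open>The quadratic polynomial is built from \<open>E z\<close>, \<open>tau T\<close> and
  \<open>nu T\<close>, and an operator commuting with J commutes with every
  \<open>E z\<close>.\<close>

lemma R_commute:
  assumes "z \<in> rho" "C o\<^sub>L lmul J = lmul J o\<^sub>L C" "C o\<^sub>L tau T = tau T o\<^sub>L C" "C o\<^sub>L nu T = nu T o\<^sub>L C"
  shows "C o\<^sub>L R z = R z o\<^sub>L C"
  unfolding R_def
proof (rule op_inv_commute)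
  show "is_op_inverse (Q_c (slice_emb J z) T) (op_inv (Q_c (slice_emb J z) T))"
    using assms(1) by (intro is_op_inverse_Q_c T) (simp add: rho_def slice_def)
  have E: "C o\<^sub>L E z = E z o\<^sub>L C"
    by (simp add: E_def slice_emb_alt lmul_add lmul_scaleR op_simps assms(2))
  show "C o\<^sub>L Q_c (slice_emb J z) T = Q_c (slice_emb J z) T o\<^sub>L C"
    unfolding Q_eq op_simps
    by (simp only: commute_compose[OF E E] commute_compose[OF E assms(3)] assms(4))
qed

lemma E_R_commute: "z \<in> rho \<Longrightarrow> E c o\<^sub>L R z = R z o\<^sub>L E c"
  using E_commute[of c \<i>] by (intro R_commute) (simp_all add: E_def slice_emb_ii tau_lmul_commute nu_lmul_commute)

lemma tau_R_commute: "z \<in> rho \<Longrightarrow> tau T o\<^sub>L R z = R z o\<^sub>L tau T"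
  by (intro R_commute) (simp_all add: tau_lmul_commute tau_nu_commute[OF T])

text \<open>From R z - R w = R z (Q w - Q z) R w, where Q w - Q z factors as (w - z)(w + z - 2 tau
  T).\<close>

lemma resolvent_identity:
  assumes z: "z \<in> rho" and w: "w \<in> rho"
  shows "R z - R w = cm (w - z) (cm (w + z) (R z o\<^sub>L R w) - 2 *\<^sub>R (tau T o\<^sub>L (R z o\<^sub>L R w)))"
proof -
  have comE: "R z o\<^sub>L R w o\<^sub>L E c = R z o\<^sub>L E c o\<^sub>L R w" for c
    by (simp only: blinfun_compose_assoc E_R_commute[OF w])
  have "R z - R w = (R z o\<^sub>L (Q_c (slice_emb J w) T o\<^sub>L R w)) - ((R z o\<^sub>L Q_c (slice_emb J z) T) o\<^sub>L R w)"
    by (simp only: R_inverse[OF z] R_inverse[OF w] id_blinfun_compose)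
  also have "\<dots> = R z o\<^sub>L (Q_c (slice_emb J w) T - Q_c (slice_emb J z) T) o\<^sub>L R w"
    by (simp only: op_simps blinfun_compose_assoc)
  also have "Q_c (slice_emb J w) T - Q_c (slice_emb J z) T = E ((w + z) * (w - z)) - 2 *\<^sub>R (tau T o\<^sub>L E (w - z))"
    by (simp add: Q_eq square_diff_square_factored[symmetric] E_diff E_mult op_simps algebra_simps tau_lmul_commute E_def[symmetric])
      (simp add: E_def tau_lmul_commute)
  also have "R z o\<^sub>L \<dots> o\<^sub>L R w =
      (R z o\<^sub>L E ((w + z) * (w - z)) o\<^sub>L R w) - 2 *\<^sub>R (R z o\<^sub>L (tau T o\<^sub>L E (w - z)) o\<^sub>L R w)"
    by (simp only: op_simps)
  also have "R z o\<^sub>L E ((w + z) * (w - z)) o\<^sub>L R w = cm (w - z) (cm (w + z) (R z o\<^sub>L R w))"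
    unfolding comE[symmetric] by (simp only: cm_eq E_mult blinfun_compose_assoc)
  also have "R z o\<^sub>L (tau T o\<^sub>L E (w - z)) o\<^sub>L R w = cm (w - z) (tau T o\<^sub>L (R z o\<^sub>L R w))"
  proof -
    have "R z o\<^sub>L (tau T o\<^sub>L E (w - z)) o\<^sub>L R w = (R z o\<^sub>L tau T) o\<^sub>L (E (w - z) o\<^sub>L R w)"
      by (simp only: blinfun_compose_assoc)
    also have "\<dots> = (tau T o\<^sub>L R z) o\<^sub>L (R w o\<^sub>L E (w - z))"
      by (simp only: tau_R_commute[OF z] E_R_commute[OF w])
    also have "\<dots> = cm (w - z) (tau T o\<^sub>L (R z o\<^sub>L R w))" by (simp only: cm_eq blinfun_compose_assoc)
    finally show ?thesis .
  qed
  finally show ?thesis by (simp add: cm.diff_right cm.scaleR_right)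
qed

text \<open>The resolvent identity reads R w - R z = R w k(w) with k(w) tending to 0. As soon as the
  norm of k(w) is below 1/2, the norm of R w is at most twice that of R z, so R w on the right side
  is harmless.\<close>

lemma continuous_on_R: "continuous_on rho R"
proof -
  have "isCont R z" if z: "z \<in> rho" for z
  proof -
    define k where "k w = cm (z - w) (cm (z + w) (R z) - 2 *\<^sub>R (tau T o\<^sub>L R z))" for w
    have Rw: "R w - R z = R w o\<^sub>L k w" if w: "w \<in> rho" for w
    proof -
      have "R w o\<^sub>L (tau T o\<^sub>L R z) = tau T o\<^sub>L (R w o\<^sub>L R z)"
        unfolding blinfun_compose_assoc[symmetric] tau_R_commute[OF w] ..
      then show ?thesis
        unfolding resolvent_identity[OF w z] k_def cm_compose_left op_simps by simp
    qed
    have "isCont k z"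
      unfolding k_def
      by (intro continuous_intros cm.isCont)
    then have k0: "(k \<longlongrightarrow> 0) (at z)"
      by (simp add: isCont_def k_def cm.zero_left)
    then have "((\<lambda>w. norm (k w)) \<longlongrightarrow> 0) (at z)" by (rule tendsto_norm_zero)
    then have "\<forall>\<^sub>F w in at z. norm (k w) < 1 / 2" by (rule order_tendstoD) simp
    moreover have "\<forall>\<^sub>F w in at z. w \<in> rho" using open_rho z by (rule eventually_at_in_open')
    ultimately have "\<forall>\<^sub>F w in at z. norm (R w - R z) \<le> norm (k w) * (2 * norm (R z))"
    proof eventually_elim
      case (elim w)
      have le: "norm (R w - R z) \<le> norm (R w) * norm (k w)"
        unfolding Rw[OF elim(2)] by (rule norm_blinfun_compose)
      have "norm (R w) \<le> norm (R z) + norm (R w - R z)"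
        using norm_triangle_ineq[of "R z" "R w - R z"] by simp
      also have "norm (R w - R z) \<le> norm (R w) * (1 / 2)"
        using le elim(1) by (smt (verit) mult_left_mono norm_ge_zero)
      finally have "norm (R w) \<le> 2 * norm (R z)" by simp
      then show ?case using le by (smt (verit) mult.commute mult_right_mono norm_ge_zero)
    qed
    moreover have "((\<lambda>w. norm (k w) * (2 * norm (R z))) \<longlongrightarrow> 0) (at z)"
      using \<open>((\<lambda>w. norm (k w)) \<longlongrightarrow> 0) (at z)\<close> by (rule tendsto_mult_left_zero)
    ultimately have "((\<lambda>w. R w - R z) \<longlongrightarrow> 0) (at z)" by (rule Lim_null_comparison)
    then show ?thesis by (simp add: isCont_def LIM_zero_iff)
  qed
  then show ?thesis by (simp add: continuous_at_imp_continuous_on)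
qed

text \<open>The complex derivative 2 (tau T - z) R(z)^2 of the resolvent. The kernels
  \<open>P2_L\<close> and \<open>P2_R\<close> turn out to be expressed by it, which opens the way to
  integration by parts.\<close>

definition R' :: "complex \<Rightarrow> 'x qop" where
  "R' z = 2 *\<^sub>R (tau T o\<^sub>L (R z o\<^sub>L R z)) - cm (2 * z) (R z o\<^sub>L R z)"

lemma R_has_derivative:
  assumes z: "z \<in> rho"
  shows "(R has_derivative (\<lambda>k. cm k (R' z))) (at z)"
proof -
  have iR: "isCont R z" using continuous_on_R open_rho z by (simp add: continuous_on_eq_continuous_at)
  define G where "G w = 2 *\<^sub>R (tau T o\<^sub>L (R z o\<^sub>L R w)) - cm (w + z) (R z o\<^sub>L R w)" for w
  have "(R has_derivative (\<lambda>k. cm k (G z))) (at z)"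
  proof (rule has_derivative_cmI[OF open_rho z])
    show "R w = R z + cm (w - z) (G w)" if "w \<in> rho" for w
      using resolvent_identity[OF z that] by (simp add: G_def cm.diff_right cm.scaleR_right algebra_simps)
    show "isCont G z"
      unfolding G_def by (intro continuous_intros blinfun_compose.isCont cm.isCont iR)
  qed
  then show ?thesis unfolding G_def R'_def mult_2 .
qed

lemma weakly_holomorphic_cm_R:
  assumes "f holomorphic_on S" "open S" "S \<subseteq> rho"
  shows "weakly_holomorphic_on (\<lambda>z. cm (f z) (R z)) S"
proof (rule weakly_holomorphic_onI[OF assms(2)])
  fix z assume "z \<in> S"
  then show "((\<lambda>z. cm (f z) (R z)) has_derivative (\<lambda>k. cm k (cm (f z) (R' z) + cm (deriv f z) (R z)))) (at z)"
    using assms by (intro has_derivative_cm R_has_derivative holomorphic_derivI[of f S]) auto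
qed

lemma cfunctional_compose_left: "cfunctional \<psi> \<Longrightarrow> cfunctional (\<lambda>A. \<psi> (C o\<^sub>L A))"
  unfolding cfunctional_def cm_compose_left
  by (auto intro: bounded_linear_compose[OF _ blinfun_compose.bounded_linear_right])

text \<open>Here C comes between the operator and the scalars acting from the right, so it has to
  commute with all of them.\<close>

lemma cfunctional_compose_right:
  assumes "cfunctional \<psi>" "\<And>c. E c o\<^sub>L C = C o\<^sub>L E c"
  shows "cfunctional (\<lambda>A. \<psi> (A o\<^sub>L C))"
proof -
  have "cm c A o\<^sub>L C = cm c (A o\<^sub>L C)" for c A
    by (simp only: cm_eq blinfun_compose_assoc assms(2))
  then show ?thesis
    using assms(1) unfolding cfunctional_def
    by (auto intro: bounded_linear_compose[OF _ blinfun_compose.bounded_linear_left])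
qed

lemma psi_R_holomorphic: "cfunctional \<psi> \<Longrightarrow> (\<lambda>z. \<psi> (R z)) holomorphic_on rho"
  using weakly_holomorphic_onI[OF open_rho R_has_derivative] by (simp add: weakly_holomorphic_on_def)

definition M :: "(real \<Rightarrow> complex) set \<Rightarrow> (complex \<Rightarrow> complex) \<Rightarrow> 'x qop" where
  "M \<Gamma> f = cm (1 / (2 * pi * \<i>)) (\<Sum>\<gamma>\<in>\<Gamma>. vint \<gamma> (\<lambda>z. cm (f z) (R z)))"

lemma cfunctional_M:
  assumes "encircles \<Gamma> V \<Omega>" "- rho \<subseteq> V" "f holomorphic_on \<Omega>" "cfunctional \<psi>"
  shows "\<psi> (M \<Gamma> f) = (\<Sum>\<gamma>\<in>\<Gamma>. contour_integral \<gamma> (\<lambda>z. f z * \<psi> (R z))) / (2 * pi * \<i>)"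
proof -
  note enc = encirclesD[OF assms(1)]
  have "\<psi> (vint \<gamma> (\<lambda>z. cm (f z) (R z))) = contour_integral \<gamma> (\<lambda>z. f z * \<psi> (R z))" if "\<gamma> \<in> \<Gamma>" for \<gamma>
  proof -
    have "\<psi> (vint \<gamma> (\<lambda>z. cm (f z) (R z))) = contour_integral \<gamma> (\<lambda>z. \<psi> (cm (f z) (R z)))"
    proof (rule cfunctional_vint[OF _ weakly_holomorphic_cm_R enc(5)[OF that] _ assms(4)])
      show "f holomorphic_on \<Omega> \<inter> rho" using assms(3) by (rule holomorphic_on_subset) simp
      show "open (\<Omega> \<inter> rho)" "open (\<Omega> \<inter> rho)" by (intro open_Int enc(3) open_rho)+
      show "path_image \<gamma> \<subseteq> \<Omega> \<inter> rho" using enc(7)[OF that] assms(2) by blast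
    qed simp
    then show ?thesis by (simp add: cfunctionalD(2)[OF assms(4)])
  qed
  then show ?thesis
    by (simp add: M_def cfunctionalD(2)[OF assms(4)] linear_sum[OF cfunctionalD(3)[OF assms(4)]])
qed

end

section \<open>Multiplicativity of the calculus\<close>

definition cint :: "(real \<Rightarrow> complex) set \<Rightarrow> (complex \<Rightarrow> complex) \<Rightarrow> complex" where
  "cint \<Gamma> f = (\<Sum>\<gamma>\<in>\<Gamma>. contour_integral \<gamma> f)"

definition chain_in :: "(real \<Rightarrow> complex) set \<Rightarrow> complex set \<Rightarrow> bool" where
  "chain_in \<Gamma> S \<longleftrightarrow> open S \<and> (\<forall>\<gamma>\<in>\<Gamma>. valid_path \<gamma> \<and> path_image \<gamma> \<subseteq> S)"

lemma chain_in_integrable: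
  "chain_in \<Gamma> S \<Longrightarrow> f holomorphic_on S \<Longrightarrow> \<gamma> \<in> \<Gamma> \<Longrightarrow> f contour_integrable_on \<gamma>"
  unfolding chain_in_def using contour_integrable_holomorphic_simple by blast

lemma cint_add: "chain_in \<Gamma> S \<Longrightarrow> f holomorphic_on S \<Longrightarrow> g holomorphic_on S \<Longrightarrow>
    cint \<Gamma> (\<lambda>z. f z + g z) = cint \<Gamma> f + cint \<Gamma> g"
  unfolding cint_def sum.distrib[symmetric]
  by (intro sum.cong refl contour_integral_add chain_in_integrable)

lemma cint_diff: "chain_in \<Gamma> S \<Longrightarrow> f holomorphic_on S \<Longrightarrow> g holomorphic_on S \<Longrightarrow>
    cint \<Gamma> (\<lambda>z. f z - g z) = cint \<Gamma> f - cint \<Gamma> g"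
  unfolding cint_def sum_subtractf[symmetric]
  by (intro sum.cong refl contour_integral_diff chain_in_integrable)

lemma cint_lmul: "chain_in \<Gamma> S \<Longrightarrow> f holomorphic_on S \<Longrightarrow> cint \<Gamma> (\<lambda>z. c * f z) = c * cint \<Gamma> f"
  unfolding cint_def sum_distrib_left
  by (intro sum.cong refl contour_integral_lmul chain_in_integrable)

lemma cint_cong: "chain_in \<Gamma> S \<Longrightarrow> (\<And>z. z \<in> S \<Longrightarrow> f z = g z) \<Longrightarrow> cint \<Gamma> f = cint \<Gamma> g"
  unfolding cint_def chain_in_def by (intro sum.cong refl contour_integral_eq) blast

text \<open>Conjugation reverses the orientation and running backwards restores it, so a positively
  oriented contour stays positively oriented.\<close>

definition conj_path :: "(real \<Rightarrow> complex) \<Rightarrow> real \<Rightarrow> complex" where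
  "conj_path \<gamma> = reversepath (cnj \<circ> \<gamma>)"

text \<open>Cycles are sets of paths: reindexing a sum over the conjugated cycle requires that no
  two curves become equal.\<close>

lemma inj_conj_path: "inj conj_path"
proof (rule injI)
  fix \<gamma> \<delta> assume "conj_path \<gamma> = conj_path \<delta>"
  then have "cnj (\<gamma> (1 - t)) = cnj (\<delta> (1 - t))" for t by (simp add: conj_path_def reversepath_def fun_eq_iff)
  from this[of "1 - _"] show "\<gamma> = \<delta>" by auto
qed

lemma conj_path_props:
  assumes "valid_path \<gamma>"
  shows "valid_path (conj_path \<gamma>)" "path_image (conj_path \<gamma>) = cnj ` path_image \<gamma>"
    "pathfinish \<gamma> = pathstart \<gamma> \<Longrightarrow> pathfinish (conj_path \<gamma>) = pathstart (conj_path \<gamma>)"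
    "contour_integral (conj_path \<gamma>) f = - cnj (contour_integral \<gamma> (\<lambda>z. cnj (f (cnj z))))"
    "cnj w \<notin> path_image \<gamma> \<Longrightarrow> winding_number (conj_path \<gamma>) w = cnj (winding_number \<gamma> (cnj w))"
proof -
  show "valid_path (conj_path \<gamma>)" unfolding conj_path_def using assms by (simp add: valid_path_cnj)
  show "path_image (conj_path \<gamma>) = cnj ` path_image \<gamma>" by (simp add: conj_path_def path_image_compose)
  show "pathfinish (conj_path \<gamma>) = pathstart (conj_path \<gamma>)" if "pathfinish \<gamma> = pathstart \<gamma>"
    using that by (simp add: conj_path_def pathstart_compose pathfinish_compose)
  show "contour_integral (conj_path \<gamma>) f = - cnj (contour_integral \<gamma> (\<lambda>z. cnj (f (cnj z))))"
    unfolding conj_path_def contour_integral_reversepath[OF valid_path_cnj[THEN iffD2, OF assms]] contour_integral_cnj[OF assms]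
    by (simp add: o_def)
  assume w: "cnj w \<notin> path_image \<gamma>"
  then have "w \<notin> path_image (cnj \<circ> \<gamma>)"
    unfolding path_image_compose by (metis complex_cnj_cnj image_iff)
  then show "winding_number (conj_path \<gamma>) w = cnj (winding_number \<gamma> (cnj w))"
    unfolding conj_path_def
    using winding_number_cnj[OF valid_path_imp_path[OF assms] w]
    by (simp add: winding_number_reversepath valid_path_imp_path valid_path_cnj assms)
qed

lemma encircles_conj:
  assumes enc: "encircles \<Gamma> V \<Omega>" and sym: "cnj ` \<Omega> = \<Omega>"
  shows "encircles (conj_path ` \<Gamma>) (cnj ` V) \<Omega>"
proof -
  note e = encirclesD[OF enc]
  have mem: "cnj z \<in> \<Omega> \<longleftrightarrow> z \<in> \<Omega>" for z
    using sym by (metis complex_cnj_cnj image_iff)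
  have memV: "z \<in> cnj ` V \<longleftrightarrow> cnj z \<in> V" for z
    by (metis complex_cnj_cnj image_iff)
  have wn: "(\<Sum>\<gamma>\<in>conj_path ` \<Gamma>. winding_number \<gamma> w) = cnj (\<Sum>\<gamma>\<in>\<Gamma>. winding_number \<gamma> (cnj w))"
    if "\<And>\<gamma>. \<gamma> \<in> \<Gamma> \<Longrightarrow> cnj w \<notin> path_image \<gamma>" for w
    using that e(5) by (simp add: sum.reindex[OF inj_on_subset[OF inj_conj_path subset_UNIV]] conj_path_props)
  have "open (cnj ` V)"
  proof -
    have "cnj ` V = cnj -` V" using memV by auto
    moreover have "continuous_on UNIV cnj" by (intro continuous_intros)
    ultimately show ?thesis using e(2) by (simp add: open_vimage)
  qed
  then show ?thesis
    unfolding encircles_def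
  proof (intro conjI ballI allI impI)
    show "cnj ` V \<subseteq> \<Omega>" using e(4) sym by blast
    fix \<delta> assume "\<delta> \<in> conj_path ` \<Gamma>"
    then obtain \<gamma> where \<gamma>: "\<gamma> \<in> \<Gamma>" "\<delta> = conj_path \<gamma>" by blast
    show "valid_path \<delta>" "pathfinish \<delta> = pathstart \<delta>" using \<gamma> e(5,6) by (auto simp: conj_path_props)
    show "path_image \<delta> \<subseteq> \<Omega> - cnj ` V"
      using e(7)[OF \<gamma>(1)] e(5)[OF \<gamma>(1)] mem memV \<gamma>(2) by (auto simp: conj_path_props)
  next
    fix w assume "w \<in> cnj ` V"
    then have w: "cnj w \<in> V" using memV by blast
    then have "(\<Sum>\<gamma>\<in>conj_path ` \<Gamma>. winding_number \<gamma> w) = cnj (\<Sum>\<gamma>\<in>\<Gamma>. winding_number \<gamma> (cnj w))"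
      using e(7) by (intro wn) blast
    then show "(\<Sum>\<gamma>\<in>conj_path ` \<Gamma>. winding_number \<gamma> w) = 1" using e(8)[OF w] by simp
  next
    fix w assume "w \<notin> \<Omega>"
    then have w: "cnj w \<notin> \<Omega>" using mem by blast
    then have "(\<Sum>\<gamma>\<in>conj_path ` \<Gamma>. winding_number \<gamma> w) = cnj (\<Sum>\<gamma>\<in>\<Gamma>. winding_number \<gamma> (cnj w))"
      using e(7) by (intro wn) blast
    then show "(\<Sum>\<gamma>\<in>conj_path ` \<Gamma>. winding_number \<gamma> w) = 0" using e(9)[OF w] by simp
  qed (use e in auto)
qed

text \<open>The imaginary components of J J are those of J times 2 \<open>qre J\<close>. If
  \<open>qre J\<close> were nonzero, J would be real with square -1.\<close>

lemma imag_units_qre_norm: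
  assumes "J \<in> imag_units"
  shows "qre J = 0" "norm J = 1"
proof -
  have JJ: "J * J = - 1" using assms by (simp add: imag_units_def)
  have "norm J * norm J = 1" using arg_cong[OF JJ, of norm] by (simp only: norm_mult norm_minus_cancel norm_one)
  then show "norm J = 1" using square_eq_1_iff[of "norm J"] norm_ge_zero[of J] by linarith
  have "qre J * qim1 J = 0" "qre J * qim2 J = 0" "qre J * qim3 J = 0"
    "qre J * qre J - qim1 J * qim1 J - qim2 J * qim2 J - qim3 J * qim3 J = - 1"
    using JJ by (auto simp: quat_eq_iff quat_arith_defs)
  then show "qre J = 0"
    by (smt (verit) mult_eq_0_iff zero_le_square)
qed

lemma slice_emb_qre_norm:
  assumes "J \<in> imag_units"
  shows "qre (slice_emb J z) = Re z" "norm (slice_emb J z) = cmod z"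
proof -
  show re: "qre (slice_emb J z) = Re z"
    using imag_units_qre_norm(1)[OF assms] by (simp add: slice_emb_alt quat_arith_defs)
  have "(norm J)\<^sup>2 = 1" using imag_units_qre_norm(2)[OF assms] by simp
  then have i: "(qim1 J)\<^sup>2 + (qim2 J)\<^sup>2 + (qim3 J)\<^sup>2 = 1"
    unfolding quat_norm_sq using imag_units_qre_norm(1)[OF assms] by simp
  have "(norm (slice_emb J z))\<^sup>2 = (Re z)\<^sup>2 + (Im z)\<^sup>2 * ((qim1 J)\<^sup>2 + (qim2 J)\<^sup>2 + (qim3 J)\<^sup>2)"
    unfolding quat_norm_sq using imag_units_qre_norm(1)[OF assms]
    by (simp add: slice_emb_alt quat_arith_defs power_mult_distrib algebra_simps)
  also have "(qim1 J)\<^sup>2 + (qim2 J)\<^sup>2 + (qim3 J)\<^sup>2 = 1" by (rule i)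
  also have "(Re z)\<^sup>2 + (Im z)\<^sup>2 * 1 = (cmod z)\<^sup>2" by (simp add: cmod_power2)
  finally show "norm (slice_emb J z) = cmod z" by (simp add: power2_eq_iff_nonneg)
qed

context slice_calculus
begin

lemma chain_in_encircles:
  "encircles \<Gamma> V \<Omega> \<Longrightarrow> - rho \<subseteq> V \<Longrightarrow> chain_in \<Gamma> (\<Omega> \<inter> rho)"
  unfolding chain_in_def using open_rho by (auto simp: encircles_def)

lemma cfunctional_M_cint:
  assumes "encircles \<Gamma> V \<Omega>" "- rho \<subseteq> V" "f holomorphic_on \<Omega>" "cfunctional \<psi>"
  shows "2 * pi * \<i> * \<psi> (M \<Gamma> f) = cint \<Gamma> (\<lambda>z. f z * \<psi> (R z))"
  unfolding cfunctional_M[OF assms] cint_def by simp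

lemma M_add:
  assumes "encircles \<Gamma> V \<Omega>" "- rho \<subseteq> V" "f holomorphic_on \<Omega>" "g holomorphic_on \<Omega>"
  shows "M \<Gamma> (\<lambda>z. f z + g z) = M \<Gamma> f + M \<Gamma> g"
proof (rule cfunctional_eqI)
  fix \<psi> assume \<psi>: "cfunctional \<psi>"
  note ch = chain_in_encircles[OF assms(1,2)]
  have "2 * pi * \<i> * \<psi> (M \<Gamma> (\<lambda>z. f z + g z)) = cint \<Gamma> (\<lambda>z. (f z + g z) * \<psi> (R z))"
    by (rule cfunctional_M_cint[OF assms(1,2) _ \<psi>]) (intro holomorphic_intros assms)
  also have "\<dots> = cint \<Gamma> (\<lambda>z. f z * \<psi> (R z)) + cint \<Gamma> (\<lambda>z. g z * \<psi> (R z))"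
    unfolding distrib_right using assms(3,4) psi_R_holomorphic[OF \<psi>]
    by (intro cint_add[OF ch] holomorphic_intros) (auto elim: holomorphic_on_subset)
  also have "\<dots> = 2 * pi * \<i> * \<psi> (M \<Gamma> f) + 2 * pi * \<i> * \<psi> (M \<Gamma> g)"
    by (simp only: cfunctional_M_cint[OF assms(1,2,3) \<psi>] cfunctional_M_cint[OF assms(1,2,4) \<psi>])
  also have "\<dots> = 2 * pi * \<i> * (\<psi> (M \<Gamma> f) + \<psi> (M \<Gamma> g))" by (simp only: distrib_left)
  finally have "\<psi> (M \<Gamma> (\<lambda>z. f z + g z)) = \<psi> (M \<Gamma> f) + \<psi> (M \<Gamma> g)" by simp
  then show "\<psi> (M \<Gamma> (\<lambda>z. f z + g z)) = \<psi> (M \<Gamma> f + M \<Gamma> g)"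
    using cfunctionalD(3)[OF \<psi>] by (simp add: linear_add)
qed

lemma M_independent:
  assumes "encircles \<Gamma>1 V1 \<Omega>" "encircles \<Gamma>2 V2 \<Omega>" "- rho \<subseteq> V1" "- rho \<subseteq> V2" "f holomorphic_on \<Omega>"
  shows "M \<Gamma>1 f = M \<Gamma>2 f"
proof (rule cfunctional_eqI)
  fix \<psi> assume \<psi>: "cfunctional \<psi>"
  have "(\<lambda>z. f z * \<psi> (R z)) holomorphic_on \<Omega> \<inter> rho"
    using assms(5) psi_R_holomorphic[OF \<psi>] by (intro holomorphic_intros) (auto elim: holomorphic_on_subset)
  then have "(\<Sum>\<gamma>\<in>\<Gamma>1. contour_integral \<gamma> (\<lambda>z. f z * \<psi> (R z))) = (\<Sum>\<gamma>\<in>\<Gamma>2. contour_integral \<gamma> (\<lambda>z. f z * \<psi> (R z)))"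
    by (intro encircles_homologous[OF assms(1,2) open_rho]) (use assms in auto)
  then show "\<psi> (M \<Gamma>1 f) = \<psi> (M \<Gamma>2 f)"
    unfolding cfunctional_M[OF assms(1,3,5) \<psi>] cfunctional_M[OF assms(2,4,5) \<psi>] by simp
qed

lemma M_commute:
  assumes "encircles \<Gamma> V \<Omega>" "- rho \<subseteq> V" "f holomorphic_on \<Omega>"
    and "C o\<^sub>L lmul J = lmul J o\<^sub>L C" "C o\<^sub>L tau T = tau T o\<^sub>L C" "C o\<^sub>L nu T = nu T o\<^sub>L C"
  shows "C o\<^sub>L M \<Gamma> f = M \<Gamma> f o\<^sub>L C"
proof (rule cfunctional_eqI)
  fix \<psi> assume \<psi>: "cfunctional \<psi>"
  have E: "E c o\<^sub>L C = C o\<^sub>L E c" for c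
    by (simp add: E_def slice_emb_alt lmul_add lmul_scaleR op_simps assms(4))
  note l = cfunctional_compose_left[OF \<psi>, of C] and r = cfunctional_compose_right[OF \<psi> E]
  have "2 * pi * \<i> * \<psi> (C o\<^sub>L M \<Gamma> f) = cint \<Gamma> (\<lambda>z. f z * \<psi> (C o\<^sub>L R z))"
    by (rule cfunctional_M_cint[OF assms(1-3) l])
  also have "\<dots> = cint \<Gamma> (\<lambda>z. f z * \<psi> (R z o\<^sub>L C))"
    by (rule cint_cong[OF chain_in_encircles[OF assms(1,2)]]) (use R_commute[OF _ assms(4-6)] in auto)
  also have "\<dots> = 2 * pi * \<i> * \<psi> (M \<Gamma> f o\<^sub>L C)"
    by (rule cfunctional_M_cint[OF assms(1-3) r, symmetric])
  finally show "\<psi> (C o\<^sub>L M \<Gamma> f) = \<psi> (M \<Gamma> f o\<^sub>L C)" by simp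
qed

text \<open>On \<open>V\<close>, the function \<open>l\<close> below is a Cauchy integral by the resolvent identity; therefore it
  extends holomorphically across the spectrum, and its integral against \<open>g\<close> vanishes.\<close>

lemma M_mult:
  assumes enc: "encircles \<Gamma> V \<Omega>" and V: "- rho \<subseteq> V" and f: "f holomorphic_on \<Omega>" and g: "g holomorphic_on \<Omega>"
  shows "M \<Gamma> (\<lambda>z. f z * g z) = (M \<Gamma> (\<lambda>z. z * f z) o\<^sub>L M \<Gamma> g) + (M \<Gamma> f o\<^sub>L M \<Gamma> (\<lambda>z. z * g z))
      - 2 *\<^sub>R (tau T o\<^sub>L (M \<Gamma> f o\<^sub>L M \<Gamma> g))"
proof (rule cfunctional_eqI)
  fix \<psi> assume \<psi>: "cfunctional \<psi>"
  note ch = chain_in_encircles[OF enc V]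
  define A1 where "A1 = M \<Gamma> (\<lambda>z. z * f z)"
  define A0 where "A0 = M \<Gamma> f"
  have zf: "(\<lambda>z. z * f z) holomorphic_on \<Omega>" and zg: "(\<lambda>z. z * g z) holomorphic_on \<Omega>"
    and fg: "(\<lambda>z. f z * g z) holomorphic_on \<Omega>"
    by (intro holomorphic_intros f g)+
  define \<psi>t where "\<psi>t A = \<psi> (tau T o\<^sub>L A)" for A
  have \<psi>t: "cfunctional \<psi>t" unfolding \<psi>t_def[abs_def] by (rule cfunctional_compose_left[OF \<psi>])
  \<comment> \<open>The product formula is equivalent to the vanishing of the integral of g l for
    every \<psi>: integrating g times the four terms of l gives M(fg), A1 M(g), A0 M(zg) and 2 (tau
    T) A0 M(g) with the right signs.\<close>
  define l where "l z = f z * \<psi> (R z) - \<psi> (A1 o\<^sub>L R z) - z * \<psi> (A0 o\<^sub>L R z) + 2 * \<psi>t (A0 o\<^sub>L R z)" for z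
  have hol: "(\<lambda>z. \<phi> (R z)) holomorphic_on S" if "cfunctional \<phi>" "S \<subseteq> rho" for \<phi> S
    by (rule holomorphic_on_subset[OF psi_R_holomorphic[OF that(1)] that(2)])
  note left = cfunctional_compose_left
  have f': "f holomorphic_on \<Omega> \<inter> rho" and g': "g holomorphic_on \<Omega> \<inter> rho"
    using f g by (auto elim: holomorphic_on_subset)
  have l_hol: "l holomorphic_on \<Omega> \<inter> rho"
    unfolding l_def[abs_def] by (intro holomorphic_intros hol \<psi> left[OF \<psi>] left[OF \<psi>t] f') auto
  define F where "F z = cint \<Gamma> (\<lambda>s. f s * \<psi> (R s) / (s - z)) / (2 * pi * \<i>)" for z
  have lF: "l z = F z" if z: "z \<in> V" "z \<in> rho" for z
  proof -
    \<comment> \<open>The point z is removed to make 1 / (s - z) holomorphic; no curve passes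
      through z because z lies in V.\<close>
    have chz: "chain_in \<Gamma> (\<Omega> \<inter> rho - {z})"
      using ch z(1) encirclesD(7)[OF enc] by (fastforce simp: chain_in_def)
    have right: "cfunctional (\<lambda>A. \<phi> (A o\<^sub>L R z))" if "cfunctional \<phi>" for \<phi>
      by (rule cfunctional_compose_right[OF that E_R_commute[OF z(2)]])
    have f'': "f holomorphic_on \<Omega> \<inter> rho - {z}" using f' by (rule holomorphic_on_subset) auto
    have h: "(\<lambda>s. \<psi> (R s o\<^sub>L R z)) holomorphic_on \<Omega> \<inter> rho - {z}" "(\<lambda>s. \<psi>t (R s o\<^sub>L R z)) holomorphic_on \<Omega> \<inter> rho - {z}"
      by (intro hol right \<psi> \<psi>t; auto)+
    have "2 * pi * \<i> * l z = \<psi> (R z) * (2 * pi * \<i> * f z) - 2 * pi * \<i> * \<psi> (A1 o\<^sub>L R z)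
        - z * (2 * pi * \<i> * \<psi> (A0 o\<^sub>L R z)) + 2 * (2 * pi * \<i> * \<psi>t (A0 o\<^sub>L R z))"
      by (simp add: l_def algebra_simps)
    also have "2 * pi * \<i> * \<psi> (A1 o\<^sub>L R z) = cint \<Gamma> (\<lambda>s. s * f s * \<psi> (R s o\<^sub>L R z))"
      unfolding A1_def by (rule cfunctional_M_cint[OF enc V zf right[OF \<psi>]])
    also have "2 * pi * \<i> * \<psi> (A0 o\<^sub>L R z) = cint \<Gamma> (\<lambda>s. f s * \<psi> (R s o\<^sub>L R z))"
      unfolding A0_def by (rule cfunctional_M_cint[OF enc V f right[OF \<psi>]])
    also have "2 * pi * \<i> * \<psi>t (A0 o\<^sub>L R z) = cint \<Gamma> (\<lambda>s. f s * \<psi>t (R s o\<^sub>L R z))"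
      unfolding A0_def by (rule cfunctional_M_cint[OF enc V f right[OF \<psi>t]])
    also have "2 * pi * \<i> * f z = cint \<Gamma> (\<lambda>s. f s / (s - z))"
      unfolding cint_def by (rule encircles_Cauchy_formula[OF enc f z(1), symmetric])
    also have "\<psi> (R z) * cint \<Gamma> (\<lambda>s. f s / (s - z)) - cint \<Gamma> (\<lambda>s. s * f s * \<psi> (R s o\<^sub>L R z))
        - z * cint \<Gamma> (\<lambda>s. f s * \<psi> (R s o\<^sub>L R z)) + 2 * cint \<Gamma> (\<lambda>s. f s * \<psi>t (R s o\<^sub>L R z)) =
        cint \<Gamma> (\<lambda>s. \<psi> (R z) * (f s / (s - z)) - s * f s * \<psi> (R s o\<^sub>L R z)
          - z * (f s * \<psi> (R s o\<^sub>L R z)) + 2 * (f s * \<psi>t (R s o\<^sub>L R z)))"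
      by (subst cint_add[OF chz] cint_diff[OF chz] cint_lmul[OF chz];
          (intro holomorphic_intros f'' h; simp)?)+ simp
    also have "\<dots> = cint \<Gamma> (\<lambda>s. f s * \<psi> (R s) / (s - z))"
    proof (rule cint_cong[OF chz])
      fix s assume s: "s \<in> \<Omega> \<inter> rho - {z}"
      have "\<psi> (R s) - \<psi> (R z) = \<psi> (R s - R z)" using cfunctionalD(3)[OF \<psi>] by (simp add: linear_diff)
      also have "\<dots> = (z - s) * ((z + s) * \<psi> (R s o\<^sub>L R z) - 2 * \<psi>t (R s o\<^sub>L R z))"
        using s z(2) cfunctionalD(2,3)[OF \<psi>]
        by (simp add: resolvent_identity \<psi>t_def linear_diff linear_scale scaleR_conv_of_real)
      finally have diff: "\<psi> (R s) - \<psi> (R z) = (z - s) * ((z + s) * \<psi> (R s o\<^sub>L R z) - 2 * \<psi>t (R s o\<^sub>L R z))" .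
      have "\<psi> (R z) = \<psi> (R s) - (\<psi> (R s) - \<psi> (R z))" by simp
      also note diff
      finally have "\<psi> (R z) = \<psi> (R s) - (z - s) * ((z + s) * \<psi> (R s o\<^sub>L R z) - 2 * \<psi>t (R s o\<^sub>L R z))" .
      moreover have "s - z \<noteq> 0" using s by simp
      ultimately show "\<psi> (R z) * (f s / (s - z)) - s * f s * \<psi> (R s o\<^sub>L R z)
          - z * (f s * \<psi> (R s o\<^sub>L R z)) + 2 * (f s * \<psi>t (R s o\<^sub>L R z)) = f s * \<psi> (R s) / (s - z)"
        by (simp add: divide_simps) (simp add: algebra_simps)
    qed
    finally show ?thesis by (simp add: F_def field_simps)
  qed
  have F_hol: "F holomorphic_on V"
  proof -
    have f\<psi>: "(\<lambda>s. f s * \<psi> (R s)) holomorphic_on \<Omega> \<inter> rho"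
      by (intro holomorphic_intros f' hol \<psi>) simp
    have "(\<lambda>z. contour_integral \<gamma> (\<lambda>s. f s * \<psi> (R s) / (s - z))) holomorphic_on V" if "\<gamma> \<in> \<Gamma>" for \<gamma>
      by (rule holomorphic_on_subset[OF Cauchy_type_integral_holomorphic[OF _ f\<psi>]])
        (use ch encirclesD(7)[OF enc that] that in \<open>auto simp: chain_in_def\<close>)
    then show ?thesis
      unfolding F_def[abs_def] cint_def by (intro holomorphic_intros) auto
  qed
  define L where "L z = (if z \<in> V then F z else l z)" for z
  have Ll: "L z = l z" if "z \<in> \<Omega> \<inter> rho" for z using lF that by (auto simp: L_def)
  have "L holomorphic_on V" by (rule holomorphic_transform[OF F_hol]) (simp add: L_def)
  moreover have "L holomorphic_on \<Omega> \<inter> rho" by (rule holomorphic_transform[OF l_hol]) (simp add: Ll)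
  moreover have "V \<union> (\<Omega> \<inter> rho) = \<Omega>" using encirclesD(4)[OF enc] V by blast
  ultimately have "L holomorphic_on \<Omega>"
    using holomorphic_on_Un[of L V "\<Omega> \<inter> rho"] encirclesD(2,3)[OF enc] open_rho by auto
  then have "(\<lambda>z. g z * L z) holomorphic_on \<Omega>" by (intro holomorphic_intros g)
  then have "cint \<Gamma> (\<lambda>z. g z * L z) = 0" unfolding cint_def by (rule encircles_Cauchy_theorem[OF enc])
  then have "0 = cint \<Gamma> (\<lambda>z. g z * l z)" using cint_cong[OF ch, of "\<lambda>z. g z * l z" "\<lambda>z. g z * L z"] Ll by simp
  also have "\<dots> = cint \<Gamma> (\<lambda>z. f z * g z * \<psi> (R z) - g z * \<psi> (A1 o\<^sub>L R z) - z * g z * \<psi> (A0 o\<^sub>L R z)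
      + 2 * (g z * \<psi>t (A0 o\<^sub>L R z)))"
    by (rule cint_cong[OF ch]) (simp add: l_def algebra_simps)
  also have "\<dots> = cint \<Gamma> (\<lambda>z. f z * g z * \<psi> (R z)) - cint \<Gamma> (\<lambda>z. g z * \<psi> (A1 o\<^sub>L R z))
      - cint \<Gamma> (\<lambda>z. z * g z * \<psi> (A0 o\<^sub>L R z)) + 2 * cint \<Gamma> (\<lambda>z. g z * \<psi>t (A0 o\<^sub>L R z))"
    by (subst cint_add[OF ch] cint_diff[OF ch] cint_lmul[OF ch];
        (intro holomorphic_intros f' g' hol \<psi> left[OF \<psi>] left[OF \<psi>t]; simp)?)+ simp
  also have "\<dots> = 2 * pi * \<i> * \<psi> (M \<Gamma> (\<lambda>z. f z * g z)) - 2 * pi * \<i> * \<psi> (A1 o\<^sub>L M \<Gamma> g)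
      - 2 * pi * \<i> * \<psi> (A0 o\<^sub>L M \<Gamma> (\<lambda>z. z * g z)) + 2 * (2 * pi * \<i> * \<psi>t (A0 o\<^sub>L M \<Gamma> g))"
    by (simp only: cfunctional_M_cint[OF enc V fg \<psi>] cfunctional_M_cint[OF enc V g left[OF \<psi>]]
        cfunctional_M_cint[OF enc V zg left[OF \<psi>]] cfunctional_M_cint[OF enc V g left[OF \<psi>t]])
  also have "\<dots> = 2 * pi * \<i> * (\<psi> (M \<Gamma> (\<lambda>z. f z * g z)) - \<psi> (A1 o\<^sub>L M \<Gamma> g)
      - \<psi> (A0 o\<^sub>L M \<Gamma> (\<lambda>z. z * g z)) + 2 * \<psi>t (A0 o\<^sub>L M \<Gamma> g))"
    by (simp add: algebra_simps)
  finally have "\<psi> (M \<Gamma> (\<lambda>z. f z * g z)) - \<psi> (A1 o\<^sub>L M \<Gamma> g)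
      - \<psi> (A0 o\<^sub>L M \<Gamma> (\<lambda>z. z * g z)) + 2 * \<psi>t (A0 o\<^sub>L M \<Gamma> g) = 0"
    by simp
  then have "\<psi> (M \<Gamma> (\<lambda>z. f z * g z)) = \<psi> (A1 o\<^sub>L M \<Gamma> g)
      + \<psi> (A0 o\<^sub>L M \<Gamma> (\<lambda>z. z * g z)) - 2 * \<psi>t (A0 o\<^sub>L M \<Gamma> g)"
    by (simp add: algebra_simps)
  then show "\<psi> (M \<Gamma> (\<lambda>z. f z * g z)) = \<psi> ((M \<Gamma> (\<lambda>z. z * f z) o\<^sub>L M \<Gamma> g) + (M \<Gamma> f o\<^sub>L M \<Gamma> (\<lambda>z. z * g z))
      - 2 *\<^sub>R (tau T o\<^sub>L (M \<Gamma> f o\<^sub>L M \<Gamma> g)))"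
    using cfunctionalD(3)[OF \<psi>]
    by (simp add: A1_def A0_def \<psi>t_def linear_add linear_diff linear_scale scaleR_conv_of_real)
qed

text \<open>Multiply the equation Q R = 1 by g and integrate. The right side contributes the
  integral of a holomorphic function times the identity, which vanishes by Cauchy's theorem.\<close>

lemma M_square:
  assumes enc: "encircles \<Gamma> V \<Omega>" and V: "- rho \<subseteq> V" and g: "g holomorphic_on \<Omega>"
  shows "M \<Gamma> (\<lambda>z. z * (z * g z)) = 2 *\<^sub>R (tau T o\<^sub>L M \<Gamma> (\<lambda>z. z * g z)) - (nu T o\<^sub>L M \<Gamma> g)"
proof (rule cfunctional_eqI)
  fix \<psi> assume \<psi>: "cfunctional \<psi>"
  note ch = chain_in_encircles[OF enc V]
  define \<psi>t where "\<psi>t A = \<psi> (tau T o\<^sub>L A)" for A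
  have \<psi>t: "cfunctional \<psi>t" unfolding \<psi>t_def[abs_def] by (rule cfunctional_compose_left[OF \<psi>])
  define \<psi>n where "\<psi>n A = \<psi> (nu T o\<^sub>L A)" for A
  have \<psi>n: "cfunctional \<psi>n" unfolding \<psi>n_def[abs_def] by (rule cfunctional_compose_left[OF \<psi>])
  have zg: "(\<lambda>z. z * g z) holomorphic_on \<Omega>" and zzg: "(\<lambda>z. z * (z * g z)) holomorphic_on \<Omega>"
    by (intro holomorphic_intros g)+
  have hol: "(\<lambda>z. \<phi> (R z)) holomorphic_on S" if "cfunctional \<phi>" "S \<subseteq> rho" for \<phi> S
    by (rule holomorphic_on_subset[OF psi_R_holomorphic[OF that(1)] that(2)])
  have g': "g holomorphic_on \<Omega> \<inter> rho" using g by (auto elim: holomorphic_on_subset)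
  have "0 = cint \<Gamma> (\<lambda>z. g z * \<psi> id_blinfun)"
    unfolding cint_def by (rule encircles_Cauchy_theorem[OF enc, symmetric]) (intro holomorphic_intros g)
  also have "\<dots> = cint \<Gamma> (\<lambda>z. z * (z * g z) * \<psi> (R z) - 2 * (z * g z * \<psi>t (R z)) + g z * \<psi>n (R z))"
  proof (rule cint_cong[OF ch])
    fix z assume z: "z \<in> \<Omega> \<inter> rho"
    have "id_blinfun = Q_c (slice_emb J z) T o\<^sub>L R z" using R_inverse z by simp
    also have "\<dots> = cm z (cm z (R z)) - 2 *\<^sub>R cm z (tau T o\<^sub>L R z) + (nu T o\<^sub>L R z)"
    proof -
      have "E z o\<^sub>L E z o\<^sub>L R z = R z o\<^sub>L E z o\<^sub>L E z"
        using E_R_commute[of z z] z by (simp add: blinfun_compose_assoc) (simp add: blinfun_compose_assoc[symmetric])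
      moreover have "E z o\<^sub>L tau T o\<^sub>L R z = tau T o\<^sub>L R z o\<^sub>L E z"
        using E_R_commute[of z z] z
        by (simp add: E_def tau_lmul_commute[symmetric] blinfun_compose_assoc)
      ultimately show ?thesis by (simp add: Q_eq op_simps cm_eq)
    qed
    finally have eq: "id_blinfun = cm z (cm z (R z)) - 2 *\<^sub>R cm z (tau T o\<^sub>L R z) + (nu T o\<^sub>L R z)" .
    have id: "\<psi> id_blinfun = z * (z * \<psi> (R z)) - 2 * (z * \<psi>t (R z)) + \<psi>n (R z)"
      using cfunctionalD(2,3)[OF \<psi>] unfolding eq
      by (simp add: \<psi>t_def \<psi>n_def linear_add linear_diff linear_scale scaleR_conv_of_real)
    show "g z * \<psi> id_blinfun = z * (z * g z) * \<psi> (R z) - 2 * (z * g z * \<psi>t (R z)) + g z * \<psi>n (R z)"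
      unfolding id by (simp add: algebra_simps)
  qed
  also have "\<dots> = cint \<Gamma> (\<lambda>z. z * (z * g z) * \<psi> (R z)) - 2 * cint \<Gamma> (\<lambda>z. z * g z * \<psi>t (R z)) + cint \<Gamma> (\<lambda>z. g z * \<psi>n (R z))"
    by (subst cint_add[OF ch] cint_diff[OF ch] cint_lmul[OF ch];
        (intro holomorphic_intros g' hol \<psi> \<psi>t \<psi>n; simp)?)+ simp
  also have "\<dots> = 2 * pi * \<i> * \<psi> (M \<Gamma> (\<lambda>z. z * (z * g z))) - 2 * (2 * pi * \<i> * \<psi>t (M \<Gamma> (\<lambda>z. z * g z)))
      + 2 * pi * \<i> * \<psi>n (M \<Gamma> g)"
    by (simp only: cfunctional_M_cint[OF enc V zzg \<psi>] cfunctional_M_cint[OF enc V zg \<psi>t] cfunctional_M_cint[OF enc V g \<psi>n])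
  also have "\<dots> = 2 * pi * \<i> * (\<psi> (M \<Gamma> (\<lambda>z. z * (z * g z))) - 2 * \<psi>t (M \<Gamma> (\<lambda>z. z * g z)) + \<psi>n (M \<Gamma> g))"
    by (simp add: algebra_simps)
  finally have "\<psi> (M \<Gamma> (\<lambda>z. z * (z * g z))) - 2 * \<psi>t (M \<Gamma> (\<lambda>z. z * g z)) + \<psi>n (M \<Gamma> g) = 0"
    by simp
  then have "\<psi> (M \<Gamma> (\<lambda>z. z * (z * g z))) = 2 * \<psi>t (M \<Gamma> (\<lambda>z. z * g z)) - \<psi>n (M \<Gamma> g)"
    by (simp add: algebra_simps)
  then show "\<psi> (M \<Gamma> (\<lambda>z. z * (z * g z))) = \<psi> (2 *\<^sub>R (tau T o\<^sub>L M \<Gamma> (\<lambda>z. z * g z)) - (nu T o\<^sub>L M \<Gamma> g))"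
    using cfunctionalD(3)[OF \<psi>] by (simp add: \<psi>t_def \<psi>n_def linear_diff linear_scale scaleR_conv_of_real)
qed

text \<open>\<open>M_mult\<close> is applied to f and z g, and \<open>M_square\<close> removes the
  factor z^2. The two terms 2 (tau T) M(f) M(zg) cancel.\<close>

lemma M_mult':
  assumes enc: "encircles \<Gamma> V \<Omega>" and V: "- rho \<subseteq> V" and f: "f holomorphic_on \<Omega>" and g: "g holomorphic_on \<Omega>"
  shows "M \<Gamma> (\<lambda>z. z * (f z * g z)) = (M \<Gamma> (\<lambda>z. z * f z) o\<^sub>L M \<Gamma> (\<lambda>z. z * g z)) - (nu T o\<^sub>L (M \<Gamma> f o\<^sub>L M \<Gamma> g))"
proof -
  have zg: "(\<lambda>z. z * g z) holomorphic_on \<Omega>" by (intro holomorphic_intros g)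
  have c: "tau T o\<^sub>L M \<Gamma> f = M \<Gamma> f o\<^sub>L tau T" "nu T o\<^sub>L M \<Gamma> f = M \<Gamma> f o\<^sub>L nu T"
    by (intro M_commute[OF enc V f]; simp add: tau_lmul_commute nu_lmul_commute tau_nu_commute[OF T])+
  have "(\<lambda>z. z * (f z * g z)) = (\<lambda>z. f z * (z * g z))" by (simp add: mult_ac)
  then show ?thesis
    using M_mult[OF enc V f zg] M_square[OF enc V g]
    by (simp add: op_simps) (simp add: blinfun_compose_assoc[symmetric] c)
qed

end

section \<open>Independence of the imaginary unit\<close>

text \<open>The form taken on a slice by an intrinsic function with stem functions \<alpha> and
  \<beta>: f = \<alpha> + i \<beta>, with \<alpha> even and \<beta> odd in the imaginary
  part.\<close>

definition conj_symmetric_on :: "complex set \<Rightarrow> (complex \<Rightarrow> complex) \<Rightarrow> bool" where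
  "conj_symmetric_on \<Omega> f \<longleftrightarrow> (\<forall>z\<in>\<Omega>. cnj z \<in> \<Omega> \<and> f (cnj z) = cnj (f z))"

lemma conj_symmetric_on_image: "conj_symmetric_on \<Omega> f \<Longrightarrow> cnj ` \<Omega> = \<Omega>"
  unfolding conj_symmetric_on_def by (auto simp: image_iff) (metis complex_cnj_cnj)

text \<open>Only the real part and the modulus of z enter, so the resolvent set on a slice is the
  same for every J and symmetric under conjugation.\<close>

lemma (in slice_calculus) rho_eq:
  "rho = {z. \<exists>B. is_op_inverse ((T o\<^sub>L T) - (2 * Re z) *\<^sub>R T + (cmod z)\<^sup>2 *\<^sub>R id_blinfun) B}"
  unfolding rho_def slice_def S_resolvent_set_def by (simp add: slice_emb_qre_norm[OF J])

lemma (in slice_calculus) rho_cnj: "cnj z \<in> rho \<longleftrightarrow> z \<in> rho"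
  by (simp add: rho_eq)

lemma lmul_inverse:
  assumes "p \<noteq> 0"
  shows "lmul p o\<^sub>L lmul (inverse p) = id_blinfun" "lmul (inverse p) o\<^sub>L lmul p = id_blinfun"
  using assms by (simp_all add: lmul_mult[symmetric])

text \<open>Conjugation by p carries the plane of J to that of J' and fixes \<open>tau T\<close> and
  \<open>nu T\<close>, hence carries the resolvent for J to the one for J'. Precomposed with it, a
  functional for J' becomes one for J, so the two scalar integrals agree.\<close>

lemma M_intertwine:
  assumes "slice_calculus T J" "slice_calculus T J'" "p * J = J' * p" "p \<noteq> 0"
    "encircles \<Gamma> V \<Omega>" "- slice_calculus.rho T J \<subseteq> V" "f holomorphic_on \<Omega>"
  shows "lmul p o\<^sub>L slice_calculus.M T J \<Gamma> f = slice_calculus.M T J' \<Gamma> f o\<^sub>L lmul p"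
proof -
  interpret A: slice_calculus T J by fact
  interpret B: slice_calculus T J' by fact
  define \<Phi> where "\<Phi> A = lmul p o\<^sub>L A o\<^sub>L lmul (inverse p)" for A :: "'a qop"
  have rho: "A.rho = B.rho" by (simp add: A.rho_eq B.rho_eq)
  have pE: "lmul p o\<^sub>L A.E c = B.E c o\<^sub>L lmul p" for c
    unfolding A.E_def B.E_def lmul_mult[symmetric] using assms(3) by (simp add: slice_emb_alt algebra_simps)
  have pR: "lmul p o\<^sub>L A.R z = B.R z o\<^sub>L lmul p" if z: "z \<in> A.rho" for z
  proof -
    have "lmul p o\<^sub>L (A.E z o\<^sub>L A.E z) = (B.E z o\<^sub>L B.E z) o\<^sub>L lmul p"
      unfolding blinfun_compose_assoc[symmetric] pE unfolding blinfun_compose_assoc pE ..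
    moreover have "lmul p o\<^sub>L (A.E z o\<^sub>L tau T) = (B.E z o\<^sub>L tau T) o\<^sub>L lmul p"
      unfolding blinfun_compose_assoc[symmetric] pE unfolding blinfun_compose_assoc tau_lmul_commute ..
    ultimately have pQ: "lmul p o\<^sub>L Q_c (slice_emb J z) T = Q_c (slice_emb J' z) T o\<^sub>L lmul p"
      by (simp add: A.Q_eq B.Q_eq op_simps nu_lmul_commute)
    have "lmul p o\<^sub>L A.R z = (B.R z o\<^sub>L Q_c (slice_emb J' z) T) o\<^sub>L lmul p o\<^sub>L A.R z"
      using B.R_inverse(2)[of z] z rho by simp
    also have "\<dots> = B.R z o\<^sub>L (lmul p o\<^sub>L Q_c (slice_emb J z) T) o\<^sub>L A.R z"
      by (simp only: pQ blinfun_compose_assoc)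
    also have "\<dots> = B.R z o\<^sub>L lmul p o\<^sub>L (Q_c (slice_emb J z) T o\<^sub>L A.R z)"
      by (simp only: blinfun_compose_assoc)
    finally show ?thesis by (simp add: A.R_inverse(1)[OF z])
  qed
  have "\<Phi> (A.M \<Gamma> f) = B.M \<Gamma> f"
  proof (rule B.cfunctional_eqI)
    fix \<psi> assume \<psi>: "B.cfunctional \<psi>"
    have \<Phi>cm: "\<Phi> (A.cm c X) = B.cm c (\<Phi> X)" for c X
    proof -
      have "A.E c o\<^sub>L lmul (inverse p) = lmul (inverse p) o\<^sub>L (lmul p o\<^sub>L A.E c) o\<^sub>L lmul (inverse p)"
        by (simp add: blinfun_compose_assoc[symmetric] lmul_inverse[OF assms(4)])
      also have "\<dots> = lmul (inverse p) o\<^sub>L B.E c o\<^sub>L (lmul p o\<^sub>L lmul (inverse p))"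
        unfolding pE by (simp only: blinfun_compose_assoc)
      finally have "A.E c o\<^sub>L lmul (inverse p) = lmul (inverse p) o\<^sub>L B.E c"
        by (simp add: lmul_inverse[OF assms(4)])
      then show ?thesis by (simp only: \<Phi>_def A.cm_eq B.cm_eq blinfun_compose_assoc)
    qed
    have "bounded_linear \<Phi>"
      unfolding \<Phi>_def[abs_def]
      by (intro bounded_linear_compose[OF blinfun_compose.bounded_linear_left]
          bounded_linear_compose[OF blinfun_compose.bounded_linear_right] bounded_linear_ident)
    then have cf: "A.cfunctional (\<lambda>X. \<psi> (\<Phi> X))"
      using \<psi> unfolding A.cfunctional_def B.cfunctional_def \<Phi>cm
      by (auto intro: bounded_linear_compose)
    have "2 * pi * \<i> * \<psi> (\<Phi> (A.M \<Gamma> f)) = cint \<Gamma> (\<lambda>z. f z * \<psi> (\<Phi> (A.R z)))"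
      by (rule A.cfunctional_M_cint[OF assms(5-7) cf])
    also have "\<dots> = cint \<Gamma> (\<lambda>z. f z * \<psi> (B.R z))"
    proof (rule cint_cong[OF A.chain_in_encircles[OF assms(5,6)]])
      fix z assume "z \<in> \<Omega> \<inter> A.rho"
      then have "\<Phi> (A.R z) = B.R z o\<^sub>L (lmul p o\<^sub>L lmul (inverse p))"
        by (simp add: \<Phi>_def pR) (simp add: blinfun_compose_assoc)
      then show "f z * \<psi> (\<Phi> (A.R z)) = f z * \<psi> (B.R z)" by (simp add: lmul_inverse[OF assms(4)])
    qed
    also have "\<dots> = 2 * pi * \<i> * \<psi> (B.M \<Gamma> f)"
      using assms(6) rho by (intro B.cfunctional_M_cint[OF assms(5) _ assms(7) \<psi>, symmetric]) simp
    finally show "\<psi> (\<Phi> (A.M \<Gamma> f)) = \<psi> (B.M \<Gamma> f)" by simp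
  qed
  then have "B.M \<Gamma> f o\<^sub>L lmul p = lmul p o\<^sub>L A.M \<Gamma> f o\<^sub>L (lmul (inverse p) o\<^sub>L lmul p)"
    by (simp add: \<Phi>_def blinfun_compose_assoc flip: \<open>\<Phi> (A.M \<Gamma> f) = B.M \<Gamma> f\<close>)
  then show ?thesis by (simp add: lmul_inverse[OF assms(4)])
qed

text \<open>Replacing \<open>J\<close> by \<open>-J\<close> amounts to conjugating the contour.\<close>

lemma M_minus:
  assumes "slice_calculus T J" "slice_calculus T (- J)"
    and enc: "encircles \<Gamma> V \<Omega>" and V: "- slice_calculus.rho T J \<subseteq> V"
    and f: "f holomorphic_on \<Omega>" and sym: "conj_symmetric_on \<Omega> f"
  shows "slice_calculus.M T (- J) \<Gamma> f = slice_calculus.M T J \<Gamma> f"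
proof -
  interpret A: slice_calculus T J by fact
  interpret B: slice_calculus T "- J" by fact
  have rho: "A.rho = B.rho" by (simp add: A.rho_eq B.rho_eq)
  have E: "B.E c = A.E (cnj c)" and R: "B.R c = A.R (cnj c)" for c
    by (simp_all add: A.E_def B.E_def A.R_def B.R_def slice_emb_cnj)
  show "B.M \<Gamma> f = A.M \<Gamma> f"
  proof (rule A.cfunctional_eqI)
    fix \<psi> assume \<psi>: "A.cfunctional \<psi>"
    \<comment> \<open>A scalar acts through -J as its conjugate acts through J; so the conjugate of
      a functional for J is a functional for -J.\<close>
    have "bounded_linear (\<lambda>X. cnj (\<psi> X))"
      by (rule bounded_linear_compose[OF bounded_linear_cnj A.cfunctionalD(1)[OF \<psi>]])
    moreover have "cnj (\<psi> (B.cm c X)) = c * cnj (\<psi> X)" for c X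
      using A.cfunctionalD(2)[OF \<psi>, of "cnj c" X] by (simp add: A.cm_eq B.cm_eq E)
    ultimately have cf: "B.cfunctional (\<lambda>X. cnj (\<psi> X))" by (simp add: B.cfunctional_def)
    define F where "F z = f z * \<psi> (A.R z)" for z
    have V': "- A.rho \<subseteq> cnj ` V"
    proof
      fix z assume "z \<in> - A.rho"
      then have "cnj z \<in> V" using V A.rho_cnj[of z] by blast
      then show "z \<in> cnj ` V" by (metis complex_cnj_cnj image_eqI)
    qed
    have VB: "- B.rho \<subseteq> V" using V rho by simp
    note enc' = encircles_conj[OF enc conj_symmetric_on_image[OF sym]]
    have "2 * pi * \<i> * cnj (\<psi> (B.M \<Gamma> f)) = cint \<Gamma> (\<lambda>z. f z * cnj (\<psi> (B.R z)))"
      by (rule B.cfunctional_M_cint[OF enc VB f cf])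
    also have "\<dots> = cint \<Gamma> (\<lambda>z. cnj (F (cnj z)))"
      by (rule cint_cong[OF A.chain_in_encircles[OF enc V]])
        (use sym in \<open>auto simp: F_def R conj_symmetric_on_def\<close>)
    finally have 1: "cnj (2 * pi * \<i> * cnj (\<psi> (B.M \<Gamma> f))) = cnj (cint \<Gamma> (\<lambda>z. cnj (F (cnj z))))"
      by simp
    have "2 * pi * \<i> * \<psi> (A.M (conj_path ` \<Gamma>) f) = cint (conj_path ` \<Gamma>) F"
      unfolding F_def by (rule A.cfunctional_M_cint[OF enc' V' f \<psi>])
    also have "\<dots> = - cnj (cint \<Gamma> (\<lambda>z. cnj (F (cnj z))))"
      using encirclesD(5)[OF enc]
      by (simp add: cint_def sum.reindex[OF inj_on_subset[OF inj_conj_path subset_UNIV]] conj_path_props sum_negf)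
    also have "\<dots> = 2 * pi * \<i> * \<psi> (B.M \<Gamma> f)" unfolding 1[symmetric] by simp
    finally have "\<psi> (B.M \<Gamma> f) = \<psi> (A.M (conj_path ` \<Gamma>) f)" by simp
    also have "A.M (conj_path ` \<Gamma>) f = A.M \<Gamma> f" by (rule A.M_independent[OF enc' enc V' V f])
    finally show "\<psi> (B.M \<Gamma> f) = \<psi> (A.M \<Gamma> f)" .
  qed
qed

lemma imag_units_minus: "J \<in> imag_units \<Longrightarrow> - J \<in> imag_units"
  by (simp add: imag_units_def)

text \<open>Write q = (a + b) / 2, where a commutes and b anticommutes with J. The part a commutes
  with M(f) as it commutes with the resolvent. The part b intertwines J with -J, and M(f) is the
  same for both by conjugate symmetry.\<close>

lemma M_lmul_commute:
  assumes "slice_calculus T J" "encircles \<Gamma> V \<Omega>" "- slice_calculus.rho T J \<subseteq> V"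
    "f holomorphic_on \<Omega>" "conj_symmetric_on \<Omega> f"
  shows "lmul q o\<^sub>L slice_calculus.M T J \<Gamma> f = slice_calculus.M T J \<Gamma> f o\<^sub>L lmul q"
proof -
  interpret A: slice_calculus T J by fact
  interpret B: slice_calculus T "- J" by unfold_locales (use A.T A.J imag_units_minus in auto)
  have JJ: "J * J = - 1" using A.J by (simp add: imag_units_def)
  define a b where "a = q - J * q * J" and "b = q + J * q * J"
  have a: "a * J = J * a"
  proof -
    have "a * J = q * J - J * q * (J * J)" by (simp add: a_def algebra_simps)
    moreover have "J * a = J * q - (J * J) * q * J" by (simp add: a_def algebra_simps)
    ultimately show ?thesis by (simp add: JJ)
  qed
  have b: "b * J = - J * b"
  proof -
    have "b * J = q * J + J * q * (J * J)" by (simp add: b_def algebra_simps)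
    moreover have "- J * b = - (J * q) - (J * J) * q * J" by (simp add: b_def algebra_simps)
    ultimately show ?thesis by (simp add: JJ)
  qed
  have "lmul a o\<^sub>L A.M \<Gamma> f = A.M \<Gamma> f o\<^sub>L lmul a"
    by (rule A.M_commute[OF assms(2-4)])
      (simp_all add: lmul_mult[symmetric] a tau_lmul_commute nu_lmul_commute)
  moreover have "lmul b o\<^sub>L A.M \<Gamma> f = A.M \<Gamma> f o\<^sub>L lmul b"
  proof (cases "b = 0")
    case False
    then show ?thesis
      using M_intertwine[OF assms(1) B.slice_calculus_axioms b False assms(2-4)]
        M_minus[OF assms(1) B.slice_calculus_axioms assms(2-5)] by simp
  qed (simp add: linear_0[OF linear_lmul] op_simps)
  moreover have "q = (1 / 2) *\<^sub>R (a + b)" by (simp add: a_def b_def scaleR_2[symmetric])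
  ultimately show ?thesis by (simp add: lmul_scaleR lmul_add op_simps)
qed

text \<open>The quaternion p = 1 - J' J satisfies p J = J + J' = J' p and thus intertwines the two
  weights. Since M(f) commutes with p by \<open>M_lmul_commute\<close>, p can be cancelled. It
  vanishes only for J' = -J, the case settled by \<open>M_minus\<close>.\<close>

lemma M_independent_J:
  assumes "slice_calculus T J" "slice_calculus T J'"
    "encircles \<Gamma> V \<Omega>" "encircles \<Gamma>' V' \<Omega>" "- slice_calculus.rho T J \<subseteq> V" "- slice_calculus.rho T J \<subseteq> V'"
    "f holomorphic_on \<Omega>" "conj_symmetric_on \<Omega> f"
  shows "slice_calculus.M T J \<Gamma> f = slice_calculus.M T J' \<Gamma>' f"
proof -
  interpret A: slice_calculus T J by fact
  interpret B: slice_calculus T J' by fact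
  have JJ: "J * J = - 1" "J' * J' = - 1" using A.J B.J by (auto simp: imag_units_def)
  define p where "p = 1 - J' * J"
  have "A.M \<Gamma> f = A.M \<Gamma>' f" by (rule A.M_independent[OF assms(3-7)])
  also have "A.M \<Gamma>' f = B.M \<Gamma>' f"
  proof (cases "p = 0")
    case False
    have "p * J = J - J' * (J * J)" "J' * p = J' - (J' * J') * J" by (simp_all add: p_def algebra_simps)
    then have "p * J = J' * p" by (simp add: JJ)
    then have "lmul p o\<^sub>L A.M \<Gamma>' f = B.M \<Gamma>' f o\<^sub>L lmul p"
      using M_intertwine[OF assms(1,2) _ False assms(4,6,7)] by blast
    then have "A.M \<Gamma>' f o\<^sub>L (lmul p o\<^sub>L lmul (inverse p)) = B.M \<Gamma>' f o\<^sub>L (lmul p o\<^sub>L lmul (inverse p))"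
      unfolding M_lmul_commute[OF assms(1,4,6,7,8)] blinfun_compose_assoc[symmetric] by simp
    then show ?thesis by (simp add: lmul_inverse[OF False])
  next
    case True
    then have "J' * (J * J) = J" by (simp add: p_def mult.assoc[symmetric])
    then have "J' = - J" by (simp add: JJ minus_equation_iff)
    then show ?thesis using M_minus[OF assms(1) _ assms(4,6,7,8)] assms(2) by simp
  qed
  finally show ?thesis .
qed

context slice_calculus
begin

text \<open>The components of T commute with the resolvent, and the units in T = T_0 + T_1 e_1 + T_2
  e_2 + T_3 e_3 commute with M(f) by \<open>M_lmul_commute\<close>. It is for the units that
  conjugate symmetry is required.\<close>

lemma tau_nu_T_commute_M:
  assumes "encircles \<Gamma> V \<Omega>" "- rho \<subseteq> V" "f holomorphic_on \<Omega>" "conj_symmetric_on \<Omega> f"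
  shows "tau T o\<^sub>L M \<Gamma> f = M \<Gamma> f o\<^sub>L tau T" "nu T o\<^sub>L M \<Gamma> f = M \<Gamma> f o\<^sub>L nu T"
    "T o\<^sub>L M \<Gamma> f = M \<Gamma> f o\<^sub>L T"
proof -
  show "tau T o\<^sub>L M \<Gamma> f = M \<Gamma> f o\<^sub>L tau T" "nu T o\<^sub>L M \<Gamma> f = M \<Gamma> f o\<^sub>L nu T"
    by (intro M_commute[OF assms(1-3)]; simp add: tau_lmul_commute nu_lmul_commute tau_nu_commute[OF T])+
  have r: "real_op r o\<^sub>L M \<Gamma> f = M \<Gamma> f o\<^sub>L real_op r" if "r \<in> comps T" for r
    using commuting_ops_comps[OF T that] real_op_commute[OF commuting_ops_right_linear[OF T]]
    by (intro M_commute[OF assms(1-3)] real_op_lmul_commute) auto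
  have l: "lmul q o\<^sub>L M \<Gamma> f = M \<Gamma> f o\<^sub>L lmul q" for q
    by (rule M_lmul_commute[OF slice_calculus_axioms assms])
  have rl: "(real_op r o\<^sub>L lmul q) o\<^sub>L M \<Gamma> f = M \<Gamma> f o\<^sub>L (real_op r o\<^sub>L lmul q)" if "r \<in> comps T" for r q
    by (rule commute_compose[OF r[OF that, symmetric] l[symmetric], symmetric])
  have "T = qop (comp0 T) (comp1 T) (comp2 T) (comp3 T)"
    by (rule right_linear_op_qop[OF commuting_ops_right_linear[OF T]])
  then have eq: "T = real_op (comp0 T) + (real_op (comp1 T) o\<^sub>L lmul quat_e1) +
      (real_op (comp2 T) o\<^sub>L lmul quat_e2) + (real_op (comp3 T) o\<^sub>L lmul quat_e3)"
    by (simp only: qop_def)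
  have "comp0 T \<in> comps T" "comp1 T \<in> comps T" "comp2 T \<in> comps T" "comp3 T \<in> comps T"
    by (auto simp: comps_def)
  then show "T o\<^sub>L M \<Gamma> f = M \<Gamma> f o\<^sub>L T"
    by (subst (1 2) eq) (simp only: op_simps r rl)
qed

text \<open>The derivative of f R has integral zero over a closed path. As the term with f' R is
  integrable, so is the term with f R', which is not known beforehand.\<close>

lemma vint_by_parts:
  assumes "encircles \<Gamma> V \<Omega>" "- rho \<subseteq> V" "f holomorphic_on \<Omega>" "\<gamma> \<in> \<Gamma>"
  shows "((\<lambda>t. cm (vector_derivative \<gamma> (at t within {0..1})) (cm (f (\<gamma> t)) (R' (\<gamma> t)))) has_integral
    - vint \<gamma> (\<lambda>z. cm (deriv f z) (R z))) {0..1}"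
proof -
  note enc = encirclesD[OF assms(1)]
  define S where "S = \<Omega> \<inter> rho"
  have S: "open S" "path_image \<gamma> \<subseteq> S"
    unfolding S_def using enc(3) open_rho enc(7)[OF assms(4)] assms(2) by auto
  have f: "f holomorphic_on S" using assms(3) by (rule holomorphic_on_subset) (simp add: S_def)
  let ?h = "\<lambda>z. cm (f z) (R' z) + cm (deriv f z) (R z)"
  have der: "((\<lambda>z. cm (f z) (R z)) has_derivative (\<lambda>k. cm k (?h z))) (at z)" if "z \<in> S" for z
    using that S(1) f by (intro has_derivative_cm R_has_derivative holomorphic_derivI[of f S]) (auto simp: S_def)
  have "((\<lambda>t. cm (vector_derivative \<gamma> (at t within {0..1})) (?h (\<gamma> t))) has_integral
      cm (f (\<gamma> 1)) (R (\<gamma> 1)) - cm (f (\<gamma> 0)) (R (\<gamma> 0))) {0..1}"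
    using S(2) by (intro has_integral_derivative_along_path[OF enc(5)[OF assms(4)] _ _ S(1) _ der])
      (auto simp: path_image_def)
  then have 1: "((\<lambda>t. cm (vector_derivative \<gamma> (at t within {0..1})) (?h (\<gamma> t))) has_integral 0) {0..1}"
    using enc(6)[OF assms(4)] by (simp add: pathstart_def pathfinish_def)
  have 2: "((\<lambda>t. cm (vector_derivative \<gamma> (at t within {0..1})) (cm (deriv f (\<gamma> t)) (R (\<gamma> t)))) has_integral
      vint \<gamma> (\<lambda>z. cm (deriv f z) (R z))) {0..1}"
    unfolding vint_def
    by (intro integrable_integral vint_integrable[OF S(1) weakly_holomorphic_cm_R enc(5)[OF assms(4)] S(2)]
        holomorphic_deriv f S(1)) (auto simp: S_def)
  show ?thesis using has_integral_diff[OF 1 2] by (simp add: cm.add_right)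
qed

end

text \<open>For \<open>m = M \<Gamma>\<close>, these are \<open>f(T)\<close> and \<open>(Dbar f)(T)\<close>, see \<open>calc_L_values\<close> below.\<close>

definition f_value :: "'x::real_normed_vector qop \<Rightarrow> ((complex \<Rightarrow> complex) \<Rightarrow> 'x qop) \<Rightarrow> (complex \<Rightarrow> complex) \<Rightarrow> 'x qop" where
  "f_value T m f = m (\<lambda>z. z * f z) - (conj_op T o\<^sub>L m f)"

definition Dbar_value :: "'x::real_normed_vector qop \<Rightarrow> ((complex \<Rightarrow> complex) \<Rightarrow> 'x qop) \<Rightarrow> (complex \<Rightarrow> complex) \<Rightarrow> 'x qop" where
  "Dbar_value T m f = 2 *\<^sub>R m (deriv (\<lambda>z. z * f z)) - 2 *\<^sub>R (conj_op T o\<^sub>L m (deriv f))"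

section \<open>The product rule for intrinsic functions\<close>

context slice_calculus
begin

lemma M_cong:
  assumes "encircles \<Gamma> V \<Omega>" "\<And>z. z \<in> \<Omega> \<Longrightarrow> f z = g z"
  shows "M \<Gamma> f = M \<Gamma> g"
proof -
  have "vint \<gamma> (\<lambda>z. cm (f z) (R z)) = vint \<gamma> (\<lambda>z. cm (g z) (R z))" if "\<gamma> \<in> \<Gamma>" for \<gamma>
    unfolding vint_def using encirclesD(7)[OF assms(1) that] assms(2)
    by (intro integral_cong) (auto simp: path_image_def image_subset_iff)
  then show ?thesis by (simp add: M_def)
qed

text \<open>The last term arises from the summands without derivatives: twice M(fg) contains -4 (tau
  T) M(f) M(g), whereas the two products on the right contribute -4 T* M(f) M(g). The difference T*
  - tau T is minus \<open>vec_op T\<close>. The summands with f' and those with g' match by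
  \<open>M_mult\<close>, \<open>M_mult'\<close> and the quadratic equation for T*.\<close>

lemma M_product_rule:
  assumes enc: "encircles \<Gamma> V \<Omega>" and V: "- rho \<subseteq> V"
    and f: "f holomorphic_on \<Omega>" "conj_symmetric_on \<Omega> f" and g: "g holomorphic_on \<Omega>" "conj_symmetric_on \<Omega> g"
    and syms: "conj_symmetric_on \<Omega> (deriv f)" "conj_symmetric_on \<Omega> (deriv g)"
      "conj_symmetric_on \<Omega> (\<lambda>z. z * f z)" "conj_symmetric_on \<Omega> (\<lambda>z. z * g z)"
      "conj_symmetric_on \<Omega> (\<lambda>z. z * deriv f z)" "conj_symmetric_on \<Omega> (\<lambda>z. z * deriv g z)"
  shows "Dbar_value T (M \<Gamma>) (\<lambda>z. f z * g z) =
    (f_value T (M \<Gamma>) f o\<^sub>L Dbar_value T (M \<Gamma>) g) + (Dbar_value T (M \<Gamma>) f o\<^sub>L f_value T (M \<Gamma>) g) -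
    (((-2) *\<^sub>R M \<Gamma> f) o\<^sub>L vec_op T o\<^sub>L ((-2) *\<^sub>R M \<Gamma> g))"
proof -
  note op = encirclesD(3)[OF enc]
  note rl = commuting_ops_right_linear[OF T]
  have f': "deriv f holomorphic_on \<Omega>" and g': "deriv g holomorphic_on \<Omega>"
    using f(1) g(1) op by (auto intro: holomorphic_deriv)
  have d1: "M \<Gamma> (deriv (\<lambda>z. z * h z)) = M \<Gamma> h + M \<Gamma> (\<lambda>z. z * deriv h z)" if h: "h holomorphic_on \<Omega>" for h
  proof -
    have "M \<Gamma> (deriv (\<lambda>z. z * h z)) = M \<Gamma> (\<lambda>z. h z + z * deriv h z)"
    proof (rule M_cong[OF enc])
      fix z assume "z \<in> \<Omega>"
      then have "(h has_field_derivative deriv h z) (at z)" using h op by (auto intro: holomorphic_derivI)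
      then show "deriv (\<lambda>z. z * h z) z = h z + z * deriv h z"
        by (auto intro!: DERIV_imp_deriv derivative_eq_intros)
    qed
    also have "\<dots> = M \<Gamma> h + M \<Gamma> (\<lambda>z. z * deriv h z)"
      using h op by (intro M_add[OF enc V] holomorphic_intros holomorphic_deriv) auto
    finally show ?thesis .
  qed
  have dfg: "deriv (\<lambda>z. f z * g z) z = deriv f z * g z + f z * deriv g z" if "z \<in> \<Omega>" for z
  proof -
    have "(f has_field_derivative deriv f z) (at z)" "(g has_field_derivative deriv g z) (at z)"
      using that f(1) g(1) op by (auto intro: holomorphic_derivI)
    then show ?thesis by (auto intro!: DERIV_imp_deriv derivative_eq_intros)
  qed
  have d2: "M \<Gamma> (deriv (\<lambda>z. f z * g z)) = M \<Gamma> (\<lambda>z. deriv f z * g z) + M \<Gamma> (\<lambda>z. f z * deriv g z)"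
    by (rule trans[OF M_cong[OF enc dfg] M_add[OF enc V]]) (auto intro!: holomorphic_intros f g f' g')
  have "M \<Gamma> (\<lambda>z. z * deriv (\<lambda>z. f z * g z) z) = M \<Gamma> (\<lambda>z. z * (deriv f z * g z) + z * (f z * deriv g z))"
    by (rule M_cong[OF enc]) (simp add: dfg algebra_simps)
  then have d3: "M \<Gamma> (\<lambda>z. z * deriv (\<lambda>z. f z * g z) z) =
      M \<Gamma> (\<lambda>z. z * (deriv f z * g z)) + M \<Gamma> (\<lambda>z. z * (f z * deriv g z))"
    using M_add[OF enc V, of "\<lambda>z. z * (deriv f z * g z)" "\<lambda>z. z * (f z * deriv g z)"]
    by (simp add: holomorphic_on_mult holomorphic_on_ident f g f' g')
  have fg: "(\<lambda>z. f z * g z) holomorphic_on \<Omega>" by (intro holomorphic_intros f g)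
  note com = tau_nu_T_commute_M[OF enc V, THEN compose_eq_apply]
  have zh: "(\<lambda>z. z * h z) holomorphic_on \<Omega>" if "h holomorphic_on \<Omega>" for h
    by (intro holomorphic_intros that)
  \<comment> \<open>These equations move T, \<open>tau T\<close> and \<open>nu T\<close> to the
    right of all weights. Weights are never exchanged with each other: those of f precede those of g
    on both sides.\<close>
  have cA: "blinfun_apply (tau T) (blinfun_apply (M \<Gamma> h) x) = blinfun_apply (M \<Gamma> h) (blinfun_apply (tau T) x)"
    "blinfun_apply (nu T) (blinfun_apply (M \<Gamma> h) x) = blinfun_apply (M \<Gamma> h) (blinfun_apply (nu T) x)"
    "blinfun_apply T (blinfun_apply (M \<Gamma> h) x) = blinfun_apply (M \<Gamma> h) (blinfun_apply T x)"
    if "h \<in> {f, g, deriv f, deriv g, (\<lambda>z. z * f z), (\<lambda>z. z * g z), (\<lambda>z. z * deriv f z), (\<lambda>z. z * deriv g z)}" for h x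
  proof -
    have "h holomorphic_on \<Omega>" using that f(1) g(1) f' g' zh by auto
    moreover have "conj_symmetric_on \<Omega> h" using that f(2) g(2) syms by auto
    ultimately show "blinfun_apply (tau T) (blinfun_apply (M \<Gamma> h) x) = blinfun_apply (M \<Gamma> h) (blinfun_apply (tau T) x)"
      "blinfun_apply (nu T) (blinfun_apply (M \<Gamma> h) x) = blinfun_apply (M \<Gamma> h) (blinfun_apply (nu T) x)"
      "blinfun_apply T (blinfun_apply (M \<Gamma> h) x) = blinfun_apply (M \<Gamma> h) (blinfun_apply T x)"
      by (intro com; simp)+
  qed
  have TT: "T o\<^sub>L T = 2 *\<^sub>R (T o\<^sub>L tau T) - nu T"
    using compose_conj_op[OF T] by (simp add: conj_op_eq[OF rl] op_simps algebra_simps)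
  have TTx: "blinfun_apply T (blinfun_apply T x) = 2 *\<^sub>R blinfun_apply T (blinfun_apply (tau T) x) - blinfun_apply (nu T) x" for x
    using arg_cong[OF TT, of "\<lambda>A. blinfun_apply A x"] by (simp add: apply_simps)
  have tT: "blinfun_apply (tau T) (blinfun_apply T x) = blinfun_apply T (blinfun_apply (tau T) x)" for x
    by (rule compose_eq_apply[OF tau_nu_commute(1)[OF T]])
  show ?thesis
    unfolding f_value_def Dbar_value_def d1[OF fg] d1[OF f(1)] d1[OF g(1)] d2 d3
      M_mult[OF enc V f(1) g(1)] M_mult[OF enc V f' g(1)] M_mult[OF enc V f(1) g']
      M_mult'[OF enc V f' g(1)] M_mult'[OF enc V f(1) g'] conj_op_eq[OF rl] vec_op_eq[OF rl]
    by (rule blinfun_eqI) (simp add: apply_simps cA TTx tT algebra_simps scaleR_2)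
qed

end

section \<open>The quaternionic functional calculi\<close>

lemma conj_symmetric_on_mult:
  "conj_symmetric_on \<Omega> f \<Longrightarrow> conj_symmetric_on \<Omega> g \<Longrightarrow> conj_symmetric_on \<Omega> (\<lambda>z. f z * g z)"
  and conj_symmetric_on_ident_mult: "conj_symmetric_on \<Omega> f \<Longrightarrow> conj_symmetric_on \<Omega> (\<lambda>z. z * f z)"
  and conj_symmetric_on_Int:
    "conj_symmetric_on \<Omega> f \<Longrightarrow> conj_symmetric_on \<Omega>' g \<Longrightarrow> conj_symmetric_on (\<Omega> \<inter> \<Omega>') f"
    "conj_symmetric_on \<Omega> f \<Longrightarrow> conj_symmetric_on \<Omega>' g \<Longrightarrow> conj_symmetric_on (\<Omega> \<inter> \<Omega>') g"
  by (auto simp: conj_symmetric_on_def)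

lemma conj_symmetric_on_deriv:
  assumes "open \<Omega>" "f holomorphic_on \<Omega>" "conj_symmetric_on \<Omega> f"
  shows "conj_symmetric_on \<Omega> (deriv f)"
  unfolding conj_symmetric_on_def
proof (intro ballI conjI)
  fix z assume z: "z \<in> \<Omega>"
  then show z': "cnj z \<in> \<Omega>" using assms(3) by (simp add: conj_symmetric_on_def)
  have "(f has_field_derivative deriv f z) (at (cnj (cnj z)))"
    using assms(1,2) z by (auto intro: holomorphic_derivI)
  then have "((cnj \<circ> f \<circ> cnj) has_field_derivative cnj (deriv f z)) (at (cnj z))"
    by (rule has_field_derivative_cnj_cnj)
  then have "(f has_field_derivative cnj (deriv f z)) (at (cnj z))"
    by (rule has_field_derivative_transform_within_open[OF _ assms(1) z'])
      (use assms(3) in \<open>auto simp: conj_symmetric_on_def\<close>)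
  then show "deriv f (cnj z) = cnj (deriv f z)" by (rule DERIV_imp_deriv)
qed

section \<open>Evaluation of the integrals that define the calculi\<close>

context slice_calculus
begin

lemma E_R'_commute: "z \<in> rho \<Longrightarrow> E c o\<^sub>L R' z = R' z o\<^sub>L E c"
proof -
  assume z: "z \<in> rho"
  have RR: "E c o\<^sub>L (R z o\<^sub>L R z) = (R z o\<^sub>L R z) o\<^sub>L E c"
    by (intro commute_compose E_R_commute z)
  have t: "E c o\<^sub>L tau T = tau T o\<^sub>L E c" by (simp add: E_def tau_lmul_commute)
  show ?thesis
    unfolding R'_def cm_eq op_simps
    by (simp only: commute_compose[OF t RR] commute_compose[OF RR E_commute])
qed

lemma kernels:
  assumes z: "z \<in> rho"
  shows "op_inv (Q_c (slice_emb J z) T) = R z"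
    "S_res_L (slice_emb J z) T = cm z (R z) - (conj_op T o\<^sub>L R z)"
    "S_res_R (slice_emb J z) T = cm z (R z) - (R z o\<^sub>L conj_op T)"
    "P2_L (slice_emb J z) T = 2 *\<^sub>R (conj_op T o\<^sub>L R' z) - 2 *\<^sub>R cm z (R' z)"
    "P2_R (slice_emb J z) T = 2 *\<^sub>R (R' z o\<^sub>L conj_op T) - 2 *\<^sub>R cm z (R' z)"
proof -
  show R: "op_inv (Q_c (slice_emb J z) T) = R z" by (simp add: R_def)
  show "S_res_L (slice_emb J z) T = cm z (R z) - (conj_op T o\<^sub>L R z)"
    "S_res_R (slice_emb J z) T = cm z (R z) - (R z o\<^sub>L conj_op T)"
    by (simp_all add: S_res_L_def S_res_R_def R E_def[symmetric] op_simps cm_eq E_R_commute[OF z])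
  have c: "tau T o\<^sub>L conj_op T = conj_op T o\<^sub>L tau T"
    by (simp add: conj_op_eq[OF commuting_ops_right_linear[OF T]] op_simps tau_nu_commute[OF T])
  define W where "W = R z o\<^sub>L R z"
  have EW: "E z o\<^sub>L W = W o\<^sub>L E z" unfolding W_def by (intro commute_compose E_R_commute z)
  have tW: "tau T o\<^sub>L W = W o\<^sub>L tau T" unfolding W_def by (intro commute_compose tau_R_commute z)
  have tE: "tau T o\<^sub>L E z = E z o\<^sub>L tau T" by (simp add: E_def tau_lmul_commute)
  have R': "R' z = 2 *\<^sub>R (W o\<^sub>L tau T) - 2 *\<^sub>R (W o\<^sub>L E z)"
  proof -
    have "E (2 * z) = 2 *\<^sub>R E z" by (simp only: mult_2 E_add scaleR_2)
    then show ?thesis by (simp add: R'_def W_def[symmetric] cm_eq op_simps tW)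
  qed
  have ap: "blinfun_apply (E z) (blinfun_apply W x) = blinfun_apply W (blinfun_apply (E z) x)"
    "blinfun_apply (tau T) (blinfun_apply W x) = blinfun_apply W (blinfun_apply (tau T) x)"
    "blinfun_apply (tau T) (blinfun_apply (E z) x) = blinfun_apply (E z) (blinfun_apply (tau T) x)"
    "blinfun_apply (tau T) (blinfun_apply (conj_op T) x) = blinfun_apply (conj_op T) (blinfun_apply (tau T) x)" for x
    by (intro compose_eq_apply EW tW tE c)+
  show "P2_L (slice_emb J z) T = 2 *\<^sub>R (conj_op T o\<^sub>L R' z) - 2 *\<^sub>R cm z (R' z)"
    "P2_R (slice_emb J z) T = 2 *\<^sub>R (R' z o\<^sub>L conj_op T) - 2 *\<^sub>R cm z (R' z)"
    unfolding P2_L_def P2_R_def F_res_L_def F_res_R_def R E_def[symmetric] tau_def[symmetric] W_def[symmetric] R' cm_eq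
    by (rule blinfun_eqI, simp add: apply_simps ap algebra_simps)+
qed

text \<open>The share of a single curve in 2 pi M(f); the factor -i comes from ds (-J).\<close>

definition W :: "(real \<Rightarrow> complex) \<Rightarrow> (complex \<Rightarrow> complex) \<Rightarrow> 'x qop" where
  "W \<gamma> f = cm (- \<i>) (vint \<gamma> (\<lambda>z. cm (f z) (R z)))"

lemma sum_W: "(\<Sum>\<gamma>\<in>\<Gamma>. W \<gamma> f) = (2 * pi) *\<^sub>R M \<Gamma> f"
proof -
  have "(2 * pi) *\<^sub>R M \<Gamma> f = cm ((2 * pi) *\<^sub>R (1 / (2 * pi * \<i>))) (\<Sum>\<gamma>\<in>\<Gamma>. vint \<gamma> (\<lambda>z. cm (f z) (R z)))"
    by (simp only: M_def cm.scaleR_left)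
  also have "(2 * pi) *\<^sub>R (1 / (2 * pi * \<i>)) = - \<i>" by (simp add: scaleR_conv_of_real field_simps)
  finally show ?thesis by (simp add: W_def cm.sum_right)
qed

lemma slice_ds: "lmul (slice_emb J w * (- J)) = E (- \<i> * w)"
  unfolding E_def mult.commute[of "- \<i>" w] slice_emb_mult[OF J]
  by (simp add: slice_emb_alt)

lemma has_integral_W:
  assumes enc: "encircles \<Gamma> V \<Omega>" and V: "- rho \<subseteq> V" and f: "f holomorphic_on \<Omega>" and \<gamma>: "\<gamma> \<in> \<Gamma>"
  shows "((\<lambda>t. cm (- \<i>) (cm (vector_derivative \<gamma> (at t within {0..1})) (cm (f (\<gamma> t)) (R (\<gamma> t))))) has_integral W \<gamma> f) {0..1}"
    "((\<lambda>t. cm (- \<i>) (cm (vector_derivative \<gamma> (at t within {0..1})) (cm (f (\<gamma> t)) (R' (\<gamma> t))))) has_integral - W \<gamma> (deriv f)) {0..1}"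
proof -
  note e = encirclesD[OF enc]
  have S: "open (\<Omega> \<inter> rho)" "path_image \<gamma> \<subseteq> \<Omega> \<inter> rho" using e(3) open_rho e(7)[OF \<gamma>] V by auto
  have f': "f holomorphic_on \<Omega> \<inter> rho" using f by (rule holomorphic_on_subset) simp
  have "((\<lambda>t. cm (vector_derivative \<gamma> (at t within {0..1})) (cm (f (\<gamma> t)) (R (\<gamma> t)))) has_integral
      vint \<gamma> (\<lambda>z. cm (f z) (R z))) {0..1}"
    unfolding vint_def
    by (intro integrable_integral vint_integrable[OF S(1) weakly_holomorphic_cm_R e(5)[OF \<gamma>] S(2)] f' S(1)) simp
  from has_integral_linear[OF this cm.bounded_linear_right[of "- \<i>"]]
  show "((\<lambda>t. cm (- \<i>) (cm (vector_derivative \<gamma> (at t within {0..1})) (cm (f (\<gamma> t)) (R (\<gamma> t))))) has_integral W \<gamma> f) {0..1}"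
    by (simp add: o_def W_def)
  from has_integral_linear[OF vint_by_parts[OF enc V f \<gamma>] cm.bounded_linear_right[of "- \<i>"]]
  show "((\<lambda>t. cm (- \<i>) (cm (vector_derivative \<gamma> (at t within {0..1})) (cm (f (\<gamma> t)) (R' (\<gamma> t))))) has_integral - W \<gamma> (deriv f)) {0..1}"
    by (simp add: o_def W_def cm.minus_right)
qed

lemma left_integrand:
  "(K o\<^sub>L lmul (slice_emb J w * (- J))) o\<^sub>L lmul (slice_emb J c) = cm (- \<i>) (cm w (cm c K))"
proof -
  have "(K o\<^sub>L lmul (slice_emb J w * (- J))) o\<^sub>L lmul (slice_emb J c) = K o\<^sub>L E (- \<i> * w * c)"
    by (simp only: slice_ds E_def[symmetric] blinfun_compose_assoc E_mult)
  then show ?thesis by (simp only: cm_eq[symmetric] cm_mult[symmetric] mult.assoc)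
qed

text \<open>In the right calculus the scalars stand in front of the kernel, and only a kernel
  commuting with them lets them act from the right.\<close>

lemma right_integrand:
  assumes "\<And>c. E c o\<^sub>L K = K o\<^sub>L E c"
  shows "(lmul (slice_emb J c) o\<^sub>L lmul (slice_emb J w * (- J))) o\<^sub>L K = cm (- \<i>) (cm w (cm c K))"
proof -
  have "(lmul (slice_emb J c) o\<^sub>L lmul (slice_emb J w * (- J))) o\<^sub>L K = E (c * (- \<i> * w)) o\<^sub>L K"
    unfolding slice_ds E_def[symmetric] E_mult ..
  also have "\<dots> = cm (c * (- \<i> * w)) K" by (simp only: assms cm_eq)
  also have "c * (- \<i> * w) = - \<i> * (w * c)" by (simp add: algebra_simps)
  finally show ?thesis by (simp only: cm_mult)
qed

lemma path_in_rho:
  assumes "encircles \<Gamma> V \<Omega>" "- rho \<subseteq> V" "\<gamma> \<in> \<Gamma>" "t \<in> {0..1}"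
  shows "\<gamma> t \<in> rho" "\<gamma> t \<in> \<Omega>"
proof -
  have "\<gamma> t \<in> path_image \<gamma>" using assms(4) by (auto simp: path_image_def)
  then show "\<gamma> t \<in> rho" "\<gamma> t \<in> \<Omega>" using encirclesD(7)[OF assms(1,3)] assms(2) by blast+
qed

text \<open>Composition with T* on the left passes through the integral, a factor z of the kernel is
  absorbed into f, and terms with R' are integrated by parts.\<close>

lemma has_integral_left_kernels:
  assumes enc: "encircles \<Gamma> V \<Omega>" and V: "- rho \<subseteq> V" and f: "f holomorphic_on \<Omega>" and \<gamma>: "\<gamma> \<in> \<Gamma>"
  defines "ig \<equiv> \<lambda>K t. (K (slice_emb J (\<gamma> t)) o\<^sub>L lmul (slice_emb J (vector_derivative \<gamma> (at t within {0..1})) * (- J)))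
      o\<^sub>L lmul (slice_emb J (f (\<gamma> t)))"
  shows "(ig (\<lambda>s. op_inv (Q_c s T)) has_integral W \<gamma> f) {0..1}"
    "(ig (\<lambda>s. S_res_L s T) has_integral W \<gamma> (\<lambda>z. z * f z) - (conj_op T o\<^sub>L W \<gamma> f)) {0..1}"
    "(ig (\<lambda>s. P2_L s T) has_integral 2 *\<^sub>R W \<gamma> (deriv (\<lambda>z. z * f z)) - 2 *\<^sub>R (conj_op T o\<^sub>L W \<gamma> (deriv f))) {0..1}"
proof -
  have zf: "(\<lambda>z. z * f z) holomorphic_on \<Omega>" by (intro holomorphic_intros f)
  note i = has_integral_W[OF enc V f \<gamma>] and zi = has_integral_W[OF enc V zf \<gamma>]
  note cl = has_integral_linear[OF _ blinfun_compose.bounded_linear_right[of "conj_op T"], unfolded o_def]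
  have pull: "cm (- \<i>) (cm w (cm c (cm z A))) = cm (- \<i>) (cm w (cm (z * c) A))" for w c z A
    by (simp add: cm_mult[symmetric] mult_ac)
  show "(ig (\<lambda>s. op_inv (Q_c s T)) has_integral W \<gamma> f) {0..1}"
    by (rule has_integral_eq[OF _ i(1)]) (simp add: ig_def left_integrand kernels path_in_rho[OF enc V \<gamma>] del: mult_minus_right)
  show "(ig (\<lambda>s. S_res_L s T) has_integral W \<gamma> (\<lambda>z. z * f z) - (conj_op T o\<^sub>L W \<gamma> f)) {0..1}"
    by (rule has_integral_eq[OF _ has_integral_diff[OF zi(1) cl[OF i(1)]]])
      (simp add: ig_def left_integrand kernels path_in_rho[OF enc V \<gamma>] cm.diff_right cm_compose_left pull del: mult_minus_right)
  have "(ig (\<lambda>s. P2_L s T) has_integral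
      2 *\<^sub>R (conj_op T o\<^sub>L - W \<gamma> (deriv f)) - 2 *\<^sub>R (- W \<gamma> (deriv (\<lambda>z. z * f z)))) {0..1}"
    by (rule has_integral_eq[OF _ has_integral_diff[OF has_integral_cmul[OF cl[OF i(2)], of 2] has_integral_cmul[OF zi(2), of 2]]])
      (simp add: ig_def left_integrand kernels path_in_rho[OF enc V \<gamma>] cm.diff_right cm.scaleR_right cm_compose_left pull del: mult_minus_right)
  then show "(ig (\<lambda>s. P2_L s T) has_integral 2 *\<^sub>R W \<gamma> (deriv (\<lambda>z. z * f z)) - 2 *\<^sub>R (conj_op T o\<^sub>L W \<gamma> (deriv f))) {0..1}"
    by (simp add: op_simps)
qed

text \<open>The factor T* now ends the kernel, so it stays to the right of R and R'; the scalars in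
  front pass only the resolvent factor, with which they commute.\<close>

lemma has_integral_right_kernels:
  assumes enc: "encircles \<Gamma> V \<Omega>" and V: "- rho \<subseteq> V" and f: "f holomorphic_on \<Omega>" and \<gamma>: "\<gamma> \<in> \<Gamma>"
  defines "ig \<equiv> \<lambda>K t. (lmul (slice_emb J (f (\<gamma> t))) o\<^sub>L lmul (slice_emb J (vector_derivative \<gamma> (at t within {0..1})) * (- J)))
      o\<^sub>L K (slice_emb J (\<gamma> t))"
  shows "(ig (\<lambda>s. op_inv (Q_c s T)) has_integral W \<gamma> f) {0..1}"
    "(ig (\<lambda>s. S_res_R s T) has_integral W \<gamma> (\<lambda>z. z * f z) - (W \<gamma> f o\<^sub>L conj_op T)) {0..1}"
    "(ig (\<lambda>s. P2_R s T) has_integral 2 *\<^sub>R W \<gamma> (deriv (\<lambda>z. z * f z)) - 2 *\<^sub>R (W \<gamma> (deriv f) o\<^sub>L conj_op T)) {0..1}"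
proof -
  have zf: "(\<lambda>z. z * f z) holomorphic_on \<Omega>" by (intro holomorphic_intros f)
  note i = has_integral_W[OF enc V f \<gamma>] and zi = has_integral_W[OF enc V zf \<gamma>]
  note cr = has_integral_linear[OF _ blinfun_compose.bounded_linear_left[of "conj_op T"], unfolded o_def]
  have rR: "(lmul (slice_emb J c) o\<^sub>L lmul (slice_emb J w * (- J))) o\<^sub>L (R z o\<^sub>L C) = cm (- \<i>) (cm w (cm c (R z))) o\<^sub>L C"
    "(lmul (slice_emb J c) o\<^sub>L lmul (slice_emb J w * (- J))) o\<^sub>L (R' z o\<^sub>L C) = cm (- \<i>) (cm w (cm c (R' z))) o\<^sub>L C"
    if "z \<in> rho" for z c w C
    unfolding blinfun_compose_assoc[symmetric] right_integrand[OF E_R_commute[OF that]]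
      right_integrand[OF E_R'_commute[OF that]] by (rule refl)+
  have rc: "(lmul (slice_emb J c) o\<^sub>L lmul (slice_emb J w * (- J))) o\<^sub>L cm z A =
      cm z ((lmul (slice_emb J c) o\<^sub>L lmul (slice_emb J w * (- J))) o\<^sub>L A)" for c w z A
    by (rule cm_compose_left)
  have r0: "(lmul (slice_emb J c) o\<^sub>L lmul (slice_emb J w * (- J))) o\<^sub>L R z = cm (- \<i>) (cm w (cm c (R z)))"
    "(lmul (slice_emb J c) o\<^sub>L lmul (slice_emb J w * (- J))) o\<^sub>L R' z = cm (- \<i>) (cm w (cm c (R' z)))"
    if "z \<in> rho" for z c w
    by (intro right_integrand E_R_commute E_R'_commute that)+
  have pull: "cm z (cm (- \<i>) (cm w (cm c A))) = cm (- \<i>) (cm w (cm (z * c) A))" for z w c A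
    by (simp add: cm_mult[symmetric] mult_ac)
  show "(ig (\<lambda>s. op_inv (Q_c s T)) has_integral W \<gamma> f) {0..1}"
    by (rule has_integral_eq[OF _ i(1)]) (simp add: ig_def r0 kernels path_in_rho[OF enc V \<gamma>] del: mult_minus_right)
  show "(ig (\<lambda>s. S_res_R s T) has_integral W \<gamma> (\<lambda>z. z * f z) - (W \<gamma> f o\<^sub>L conj_op T)) {0..1}"
    by (rule has_integral_eq[OF _ has_integral_diff[OF zi(1) cr[OF i(1)]]])
      (simp add: ig_def kernels path_in_rho[OF enc V \<gamma>] blinfun_compose.diff_right rR rc r0 pull del: mult_minus_right)
  have "(ig (\<lambda>s. P2_R s T) has_integral
      2 *\<^sub>R (- W \<gamma> (deriv f) o\<^sub>L conj_op T) - 2 *\<^sub>R (- W \<gamma> (deriv (\<lambda>z. z * f z)))) {0..1}"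
    by (rule has_integral_eq[OF _ has_integral_diff[OF has_integral_cmul[OF cr[OF i(2)], of 2] has_integral_cmul[OF zi(2), of 2]]])
      (simp add: ig_def kernels path_in_rho[OF enc V \<gamma>] blinfun_compose.diff_right blinfun_compose.scaleR_right rR rc r0 pull del: mult_minus_right)
  then show "(ig (\<lambda>s. P2_R s T) has_integral 2 *\<^sub>R W \<gamma> (deriv (\<lambda>z. z * f z)) - 2 *\<^sub>R (W \<gamma> (deriv f) o\<^sub>L conj_op T)) {0..1}"
    by (simp add: op_simps)
qed

text \<open>The constants e k are the rightmost factors of the integrand and leave the integral as
  right factors. A single term with constant 1 covers intrinsic functions.\<close>

lemma calc_L_values:
  assumes enc: "encircles \<Gamma> V \<Omega>" and V: "- rho \<subseteq> V" and I: "finite I"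
    and F: "\<And>k. k \<in> I \<Longrightarrow> F k holomorphic_on \<Omega>"
    and g: "\<And>z. z \<in> \<Omega> \<Longrightarrow> g (slice_emb J z) = (\<Sum>k\<in>I. slice_emb J (F k z) * e k)"
  shows "D_calc_L (J, \<Gamma>) g T = (\<Sum>k\<in>I. ((-2) *\<^sub>R M \<Gamma> (F k)) o\<^sub>L lmul (e k))"
    "calc_L (J, \<Gamma>) g T = (\<Sum>k\<in>I. f_value T (M \<Gamma>) (F k) o\<^sub>L lmul (e k))"
    "Dbar_calc_L (J, \<Gamma>) g T = (\<Sum>k\<in>I. Dbar_value T (M \<Gamma>) (F k) o\<^sub>L lmul (e k))"
proof -
  define ds :: "(real \<Rightarrow> complex) \<Rightarrow> real \<Rightarrow> 'x qop" where
    "ds \<gamma> t = lmul (slice_emb J (vector_derivative \<gamma> (at t within {0..1})) * (- J))" for \<gamma> t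
  have *: "slice_integral_L (J, \<Gamma>) K g = (\<Sum>k\<in>I. (\<Sum>\<gamma>\<in>\<Gamma>. X \<gamma> k) o\<^sub>L lmul (e k))"
    if X: "\<And>\<gamma> k. \<gamma> \<in> \<Gamma> \<Longrightarrow> k \<in> I \<Longrightarrow> ((\<lambda>t. (K (slice_emb J (\<gamma> t)) o\<^sub>L ds \<gamma> t) o\<^sub>L lmul (slice_emb J (F k (\<gamma> t)))) has_integral X \<gamma> k) {0..1}"
    for K :: "quat \<Rightarrow> 'x qop" and X
  proof -
    have "integral {0..1} (\<lambda>t. (K (slice_emb J (\<gamma> t)) o\<^sub>L ds \<gamma> t) o\<^sub>L lmul (g (slice_emb J (\<gamma> t)))) = (\<Sum>k\<in>I. X \<gamma> k o\<^sub>L lmul (e k))" if \<gamma>: "\<gamma> \<in> \<Gamma>" for \<gamma>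
    proof (rule integral_unique, rule has_integral_eq[OF _ has_integral_sum[OF I]])
      show "((\<lambda>t. ((K (slice_emb J (\<gamma> t)) o\<^sub>L ds \<gamma> t) o\<^sub>L lmul (slice_emb J (F k (\<gamma> t)))) o\<^sub>L lmul (e k)) has_integral X \<gamma> k o\<^sub>L lmul (e k)) {0..1}" if "k \<in> I" for k
        using has_integral_linear[OF X[OF \<gamma> that] blinfun_compose.bounded_linear_left[of "lmul (e k)"]]
        by (simp only: o_def)
      fix t :: real assume "t \<in> {0..1}"
      then have "g (slice_emb J (\<gamma> t)) = (\<Sum>k\<in>I. slice_emb J (F k (\<gamma> t)) * e k)"
        by (intro g path_in_rho(2)[OF enc V \<gamma>])
      then show "(\<Sum>k\<in>I. ((K (slice_emb J (\<gamma> t)) o\<^sub>L ds \<gamma> t) o\<^sub>L lmul (slice_emb J (F k (\<gamma> t)))) o\<^sub>L lmul (e k)) = (K (slice_emb J (\<gamma> t)) o\<^sub>L ds \<gamma> t) o\<^sub>L lmul (g (slice_emb J (\<gamma> t)))"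
        by (simp only: linear_sum[OF linear_lmul] lmul_mult blinfun_compose.sum_right blinfun_compose_assoc)
    qed
    then have "slice_integral_L (J, \<Gamma>) K g = (\<Sum>\<gamma>\<in>\<Gamma>. \<Sum>k\<in>I. X \<gamma> k o\<^sub>L lmul (e k))"
      unfolding slice_integral_L_def ds_def by simp
    then show ?thesis
      by (subst (asm) sum.swap) (simp only: blinfun_compose.sum_left)
  qed
  note hi = has_integral_left_kernels[OF enc V F, folded ds_def]
  have si: "slice_integral_L (J, \<Gamma>) (\<lambda>s. op_inv (Q_c s T)) g = (\<Sum>k\<in>I. (\<Sum>\<gamma>\<in>\<Gamma>. W \<gamma> (F k)) o\<^sub>L lmul (e k))"
    "slice_integral_L (J, \<Gamma>) (\<lambda>s. S_res_L s T) g = (\<Sum>k\<in>I. (\<Sum>\<gamma>\<in>\<Gamma>. W \<gamma> (\<lambda>z. z * F k z) - (conj_op T o\<^sub>L W \<gamma> (F k))) o\<^sub>L lmul (e k))"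
    "slice_integral_L (J, \<Gamma>) (\<lambda>s. P2_L s T) g = (\<Sum>k\<in>I. (\<Sum>\<gamma>\<in>\<Gamma>. 2 *\<^sub>R W \<gamma> (deriv (\<lambda>z. z * F k z)) - 2 *\<^sub>R (conj_op T o\<^sub>L W \<gamma> (deriv (F k)))) o\<^sub>L lmul (e k))"
    by (rule *, rule hi; assumption)+
  note sums = sum_subtractf scaleR_right.sum[symmetric] blinfun_compose.sum_right[symmetric] sum_W
  show "D_calc_L (J, \<Gamma>) g T = (\<Sum>k\<in>I. ((-2) *\<^sub>R M \<Gamma> (F k)) o\<^sub>L lmul (e k))"
    unfolding D_calc_L_def si(1) sums 
    by (simp add: scaleR_right.sum op_simps)
  show "calc_L (J, \<Gamma>) g T = (\<Sum>k\<in>I. f_value T (M \<Gamma>) (F k) o\<^sub>L lmul (e k))"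
    unfolding calc_L_def si(2) sums f_value_def 
    by (simp add: scaleR_right.sum op_simps scaleR_diff_right)
  show "Dbar_calc_L (J, \<Gamma>) g T = (\<Sum>k\<in>I. Dbar_value T (M \<Gamma>) (F k) o\<^sub>L lmul (e k))"
    unfolding Dbar_calc_L_def si(3) sums Dbar_value_def 
    by (simp add: scaleR_right.sum op_simps scaleR_diff_right)
qed

lemma conj_op_commute_M:
  assumes "encircles \<Gamma> V \<Omega>" "- rho \<subseteq> V" "f holomorphic_on \<Omega>" "conj_symmetric_on \<Omega> f"
  shows "M \<Gamma> f o\<^sub>L conj_op T = conj_op T o\<^sub>L M \<Gamma> f"
  using tau_nu_T_commute_M[OF assms]
  by (simp add: conj_op_eq[OF commuting_ops_right_linear[OF T]] op_simps)

text \<open>The constants leave on the left. The factor T* appears to the right of the weights and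
  is moved to the left to reach \<open>f_value\<close> and \<open>Dbar_value\<close>; this uses the
  conjugate symmetry of the F k.\<close>

lemma calc_R_values:
  assumes enc: "encircles \<Gamma> V \<Omega>" and V: "- rho \<subseteq> V" and I: "finite I"
    and F: "\<And>k. k \<in> I \<Longrightarrow> F k holomorphic_on \<Omega>" "\<And>k. k \<in> I \<Longrightarrow> conj_symmetric_on \<Omega> (F k)"
    and g: "\<And>z. z \<in> \<Omega> \<Longrightarrow> g (slice_emb J z) = (\<Sum>k\<in>I. e k * slice_emb J (F k z))"
  shows "D_calc_R (J, \<Gamma>) g T = (\<Sum>k\<in>I. lmul (e k) o\<^sub>L ((-2) *\<^sub>R M \<Gamma> (F k)))"
    "calc_R (J, \<Gamma>) g T = (\<Sum>k\<in>I. lmul (e k) o\<^sub>L f_value T (M \<Gamma>) (F k))"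
    "Dbar_calc_R (J, \<Gamma>) g T = (\<Sum>k\<in>I. lmul (e k) o\<^sub>L Dbar_value T (M \<Gamma>) (F k))"
proof -
  define ds :: "(real \<Rightarrow> complex) \<Rightarrow> real \<Rightarrow> 'x qop" where
    "ds \<gamma> t = lmul (slice_emb J (vector_derivative \<gamma> (at t within {0..1})) * (- J))" for \<gamma> t
  have *: "slice_integral_R (J, \<Gamma>) g K = (\<Sum>k\<in>I. lmul (e k) o\<^sub>L (\<Sum>\<gamma>\<in>\<Gamma>. X \<gamma> k))"
    if X: "\<And>\<gamma> k. \<gamma> \<in> \<Gamma> \<Longrightarrow> k \<in> I \<Longrightarrow> ((\<lambda>t. (lmul (slice_emb J (F k (\<gamma> t))) o\<^sub>L ds \<gamma> t) o\<^sub>L K (slice_emb J (\<gamma> t))) has_integral X \<gamma> k) {0..1}"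
    for K :: "quat \<Rightarrow> 'x qop" and X
  proof -
    have "integral {0..1} (\<lambda>t. (lmul (g (slice_emb J (\<gamma> t))) o\<^sub>L ds \<gamma> t) o\<^sub>L K (slice_emb J (\<gamma> t))) = (\<Sum>k\<in>I. lmul (e k) o\<^sub>L X \<gamma> k)" if \<gamma>: "\<gamma> \<in> \<Gamma>" for \<gamma>
    proof (rule integral_unique, rule has_integral_eq[OF _ has_integral_sum[OF I]])
      show "((\<lambda>t. lmul (e k) o\<^sub>L ((lmul (slice_emb J (F k (\<gamma> t))) o\<^sub>L ds \<gamma> t) o\<^sub>L K (slice_emb J (\<gamma> t)))) has_integral lmul (e k) o\<^sub>L X \<gamma> k) {0..1}" if "k \<in> I" for k
        using has_integral_linear[OF X[OF \<gamma> that] blinfun_compose.bounded_linear_right[of "lmul (e k)"]]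
        by (simp only: o_def)
      fix t :: real assume "t \<in> {0..1}"
      then have "g (slice_emb J (\<gamma> t)) = (\<Sum>k\<in>I. e k * slice_emb J (F k (\<gamma> t)))"
        by (intro g path_in_rho(2)[OF enc V \<gamma>])
      then show "(\<Sum>k\<in>I. lmul (e k) o\<^sub>L ((lmul (slice_emb J (F k (\<gamma> t))) o\<^sub>L ds \<gamma> t) o\<^sub>L K (slice_emb J (\<gamma> t)))) = (lmul (g (slice_emb J (\<gamma> t))) o\<^sub>L ds \<gamma> t) o\<^sub>L K (slice_emb J (\<gamma> t))"
        by (simp only: linear_sum[OF linear_lmul] lmul_mult blinfun_compose.sum_left blinfun_compose_assoc)
    qed
    then have "slice_integral_R (J, \<Gamma>) g K = (\<Sum>\<gamma>\<in>\<Gamma>. \<Sum>k\<in>I. lmul (e k) o\<^sub>L X \<gamma> k)"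
      unfolding slice_integral_R_def ds_def by simp
    then show ?thesis
      by (subst (asm) sum.swap) (simp only: blinfun_compose.sum_right)
  qed
  note hi = has_integral_right_kernels[OF enc V F(1), folded ds_def]
  have si: "slice_integral_R (J, \<Gamma>) g (\<lambda>s. op_inv (Q_c s T)) = (\<Sum>k\<in>I. lmul (e k) o\<^sub>L (\<Sum>\<gamma>\<in>\<Gamma>. W \<gamma> (F k)))"
    "slice_integral_R (J, \<Gamma>) g (\<lambda>s. S_res_R s T) = (\<Sum>k\<in>I. lmul (e k) o\<^sub>L (\<Sum>\<gamma>\<in>\<Gamma>. W \<gamma> (\<lambda>z. z * F k z) - (W \<gamma> (F k) o\<^sub>L conj_op T)))"
    "slice_integral_R (J, \<Gamma>) g (\<lambda>s. P2_R s T) = (\<Sum>k\<in>I. lmul (e k) o\<^sub>L (\<Sum>\<gamma>\<in>\<Gamma>. 2 *\<^sub>R W \<gamma> (deriv (\<lambda>z. z * F k z)) - 2 *\<^sub>R (W \<gamma> (deriv (F k)) o\<^sub>L conj_op T)))"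
    by (rule *, rule hi; assumption)+
  have com: "M \<Gamma> (F k) o\<^sub>L conj_op T = conj_op T o\<^sub>L M \<Gamma> (F k)"
    "M \<Gamma> (deriv (F k)) o\<^sub>L conj_op T = conj_op T o\<^sub>L M \<Gamma> (deriv (F k))" if "k \<in> I" for k
    by (intro conj_op_commute_M[OF enc V] F[OF that] holomorphic_deriv conj_symmetric_on_deriv encirclesD(3)[OF enc])+
  note sums = sum_subtractf scaleR_right.sum[symmetric] blinfun_compose.sum_left[symmetric] sum_W
  show "D_calc_R (J, \<Gamma>) g T = (\<Sum>k\<in>I. lmul (e k) o\<^sub>L ((-2) *\<^sub>R M \<Gamma> (F k)))"
    unfolding D_calc_R_def si(1) sums 
    by (simp add: scaleR_right.sum op_simps)
  show "calc_R (J, \<Gamma>) g T = (\<Sum>k\<in>I. lmul (e k) o\<^sub>L f_value T (M \<Gamma>) (F k))"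
    unfolding calc_R_def si(2) sums f_value_def 
    by (simp add: scaleR_right.sum op_simps scaleR_diff_right com)
  show "Dbar_calc_R (J, \<Gamma>) g T = (\<Sum>k\<in>I. lmul (e k) o\<^sub>L Dbar_value T (M \<Gamma>) (F k))"
    unfolding Dbar_calc_R_def si(3) sums Dbar_value_def 
    by (simp add: scaleR_right.sum op_simps scaleR_diff_right com)
qed

end

section \<open>Stem functions and contours\<close>

lemma quat_e1_imag_unit: "quat_e1 \<in> imag_units"
  by (simp add: imag_units_def quat_units)

lemma slice_independent:
  "axially_symmetric D \<Longrightarrow> J \<in> imag_units \<Longrightarrow> J' \<in> imag_units \<Longrightarrow> slice J D = slice J' D"
  unfolding axially_symmetric_def slice_def slice_emb_def by blast

lemma slice_params_iff:
  "axially_symmetric D \<Longrightarrow> J \<in> imag_units \<Longrightarrow> (Re z, Im z) \<in> slice_params D \<longleftrightarrow> slice_emb J z \<in> D"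
  unfolding axially_symmetric_def slice_params_def slice_emb_def by blast

text \<open>A real functional turns the system for \<alpha> and \<beta> into the Cauchy-Riemann
  equations of a scalar function, and the parity conditions into conjugate symmetry.\<close>

lemma stem_component:
  fixes L :: "quat \<Rightarrow> real"
  assumes stem: "stem_pair D \<alpha> \<beta>" and D: "open D" "axially_symmetric D" and L: "bounded_linear L" and J: "J \<in> imag_units"
  defines "F \<equiv> \<lambda>z. Complex (L (\<alpha> (Re z, Im z))) (L (\<beta> (Re z, Im z)))"
  shows "F holomorphic_on slice J D" "conj_symmetric_on (slice J D) F"
proof -
  have stemD: "\<alpha> (Re z, - Im z) = \<alpha> (Re z, Im z)" "\<beta> (Re z, - Im z) = - \<beta> (Re z, Im z)"
      "\<alpha> differentiable (at (Re z, Im z))" "\<beta> differentiable (at (Re z, Im z))"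
      "frechet_derivative \<alpha> (at (Re z, Im z)) (1, 0) = frechet_derivative \<beta> (at (Re z, Im z)) (0, 1)"
      "frechet_derivative \<alpha> (at (Re z, Im z)) (0, 1) = - frechet_derivative \<beta> (at (Re z, Im z)) (1, 0)"
    if "z \<in> slice J D" for z
  proof -
    have "(Re z, Im z) \<in> slice_params D"
      using that slice_params_iff[OF D(2) J] by (simp add: slice_def)
    then show "\<alpha> (Re z, - Im z) = \<alpha> (Re z, Im z)" "\<beta> (Re z, - Im z) = - \<beta> (Re z, Im z)"
      "\<alpha> differentiable (at (Re z, Im z))" "\<beta> differentiable (at (Re z, Im z))"
      "frechet_derivative \<alpha> (at (Re z, Im z)) (1, 0) = frechet_derivative \<beta> (at (Re z, Im z)) (0, 1)"
      "frechet_derivative \<alpha> (at (Re z, Im z)) (0, 1) = - frechet_derivative \<beta> (at (Re z, Im z)) (1, 0)"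
      using stem unfolding stem_pair_def by fast+
  qed
  have linL: "linear L" using L by (rule bounded_linear.linear)
  have "F field_differentiable at z" if z: "z \<in> slice J D" for z
  proof -
    define A where "A = frechet_derivative \<alpha> (at (Re z, Im z))"
    define B where "B = frechet_derivative \<beta> (at (Re z, Im z))"
    have A: "(\<alpha> has_derivative A) (at (Re z, Im z))" and B: "(\<beta> has_derivative B) (at (Re z, Im z))"
      using stemD(3,4)[OF z] by (simp_all add: A_def B_def frechet_derivative_works)
    have split: "G (x, y) = x *\<^sub>R G (1, 0) + y *\<^sub>R G (0, 1)" if "linear G" for G :: "real \<times> real \<Rightarrow> quat" and x y
      using linear_add[OF that, of "(x, 0)" "(0, y)"] linear_scale[OF that, of x "(1, 0)"] linear_scale[OF that, of y "(0, 1)"]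
      by simp
    have pair: "((\<lambda>z. (Re z, Im z)) has_derivative (\<lambda>h. (Re h, Im h))) (at z)"
      by (auto intro!: derivative_eq_intros)
    have "((\<lambda>z. L (\<alpha> (Re z, Im z))) has_derivative (\<lambda>h. L (A (Re h, Im h)))) (at z)"
      "((\<lambda>z. L (\<beta> (Re z, Im z))) has_derivative (\<lambda>h. L (B (Re h, Im h)))) (at z)"
      using bounded_linear.has_derivative[OF L diff_chain_at[OF pair A]]
        bounded_linear.has_derivative[OF L diff_chain_at[OF pair B]] by (simp_all add: o_def)
    then have "((\<lambda>z. of_real (L (\<alpha> (Re z, Im z))) + \<i> * of_real (L (\<beta> (Re z, Im z)))) has_derivative
        (\<lambda>h. of_real (L (A (Re h, Im h))) + \<i> * of_real (L (B (Re h, Im h))))) (at z)"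
      by (intro has_derivative_add has_derivative_mult_right bounded_linear.has_derivative[OF bounded_linear_of_real])
    moreover have "(\<lambda>z. of_real (L (\<alpha> (Re z, Im z))) + \<i> * of_real (L (\<beta> (Re z, Im z)))) = F"
      by (simp add: F_def fun_eq_iff complex_eq_iff)
    moreover have "(\<lambda>h. of_real (L (A (Re h, Im h))) + \<i> * of_real (L (B (Re h, Im h)))) =
        times (Complex (L (A (1, 0))) (L (B (1, 0))))"
    proof
      fix h
      have "A (0, 1) = - B (1, 0)" "B (0, 1) = A (1, 0)" using stemD(5,6)[OF z] by (simp_all add: A_def B_def)
      then have AB: "A (Re h, Im h) = Re h *\<^sub>R A (1, 0) - Im h *\<^sub>R B (1, 0)"
        "B (Re h, Im h) = Re h *\<^sub>R B (1, 0) + Im h *\<^sub>R A (1, 0)"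
        using split[OF has_derivative_linear[OF A], of "Re h" "Im h"] split[OF has_derivative_linear[OF B], of "Re h" "Im h"]
        by simp_all
      show "of_real (L (A (Re h, Im h))) + \<i> * of_real (L (B (Re h, Im h))) =
          Complex (L (A (1, 0))) (L (B (1, 0))) * h"
        unfolding AB
        by (simp add: complex_eq_iff linear_add[OF linL] linear_diff[OF linL] linear_scale[OF linL] linear_neg[OF linL] algebra_simps)
    qed
    ultimately show ?thesis by (auto simp: field_differentiable_def has_field_derivative_def)
  qed
  then show "F holomorphic_on slice J D"
    by (simp add: holomorphic_on_def field_differentiable_at_within)
  show "conj_symmetric_on (slice J D) F"
    unfolding conj_symmetric_on_def
  proof (intro ballI conjI)
    fix z assume z: "z \<in> slice J D"
    \<comment> \<open>By axial symmetry the slices for J and -J are equal, and conjugation exchanges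
      them.\<close>
    then have "z \<in> slice (- J) D" using slice_independent[OF D(2) J imag_units_minus[OF J]] by simp
    then show "cnj z \<in> slice J D" by (simp add: slice_def slice_emb_cnj)
    show "F (cnj z) = cnj (F z)"
      using stemD(1,2)[OF z] by (simp add: F_def complex_eq_iff linear_neg[OF linL])
  qed
qed

section \<open>Splitting slice hyperholomorphic functions into intrinsic components\<close>

definition quat_comp :: "nat \<Rightarrow> quat \<Rightarrow> real" where "quat_comp k = [qre, qim1, qim2, qim3] ! k"
definition quat_unit :: "nat \<Rightarrow> quat" where "quat_unit k = [1, quat_e1, quat_e2, quat_e3] ! k"

lemma less_4_cases: "k < 4 \<Longrightarrow> k = 0 \<or> k = 1 \<or> k = 2 \<or> k = (3::nat)"
  by auto

lemma bounded_linear_quat_comp: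
  assumes "k < 4"
  shows "bounded_linear (quat_comp k)"
proof (rule bounded_linear_intro[where K = 1])
  note k = less_4_cases[OF assms]
  show "quat_comp k (x + y) = quat_comp k x + quat_comp k y" for x y
    using k by (auto simp: quat_comp_def plus_quat_def numeral_2_eq_2 numeral_3_eq_3)
  show "quat_comp k (r *\<^sub>R x) = r *\<^sub>R quat_comp k x" for r x
    using k by (auto simp: quat_comp_def scaleR_quat_def numeral_2_eq_2 numeral_3_eq_3)
  show "norm (quat_comp k x) \<le> norm x * 1" for x
  proof -
    have "(quat_comp k x)\<^sup>2 \<le> (norm x)\<^sup>2"
      using k by (auto simp: quat_comp_def quat_norm_sq)
    then show ?thesis using abs_le_square_iff[of "quat_comp k x" "norm x"] by simp
  qed
qed

lemma quat_sum_comp: "q = (\<Sum>k<4. quat_comp k q *\<^sub>R quat_unit k)"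
  using quat_decompose[of q]
  by (simp add: quat_comp_def quat_unit_def eval_nat_numeral of_real_def)

lemma slice_emb_Complex: "slice_emb J (Complex a b) = a *\<^sub>R 1 + b *\<^sub>R J"
  by (simp add: slice_emb_alt)

text \<open>Expanding \<alpha> and \<beta> in the basis of units keeps J to the left of real
  coefficients, so the units collect on the right. The same F k serve every J.\<close>

lemma left_slice_hyp_components:
  assumes "left_slice_hyp D g" "open D" "axially_symmetric D"
  obtains F where "\<And>k. k < 4 \<Longrightarrow> F k holomorphic_on slice quat_e1 D"
    "\<And>k. k < 4 \<Longrightarrow> conj_symmetric_on (slice quat_e1 D) (F k)"
    "\<And>J z. J \<in> imag_units \<Longrightarrow> slice_emb J z \<in> D \<Longrightarrow> g (slice_emb J z) = (\<Sum>k<4. slice_emb J (F k z) * quat_unit k)"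
proof -
  obtain \<alpha> \<beta> where stem: "stem_pair D \<alpha> \<beta>"
    and g: "\<And>u v J. (u, v) \<in> slice_params D \<Longrightarrow> J \<in> imag_units \<Longrightarrow> g (of_real u + J * of_real v) = \<alpha> (u, v) + J * \<beta> (u, v)"
    using assms(1) unfolding left_slice_hyp_def by fast
  define F where "F k z = Complex (quat_comp k (\<alpha> (Re z, Im z))) (quat_comp k (\<beta> (Re z, Im z)))" for k z
  show thesis
  proof (rule that[of F])
    show "F k holomorphic_on slice quat_e1 D" "conj_symmetric_on (slice quat_e1 D) (F k)" if "k < 4" for k
      using stem_component[OF stem assms(2,3) bounded_linear_quat_comp[OF that] quat_e1_imag_unit]
      by (simp_all add: F_def[abs_def])
    fix J z assume J: "J \<in> imag_units" and z: "slice_emb J z \<in> D"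
    have "g (slice_emb J z) = \<alpha> (Re z, Im z) + J * \<beta> (Re z, Im z)"
      using g[OF _ J] slice_params_iff[OF assms(3) J] z by (simp add: slice_emb_def)
    also have "\<dots> = (\<Sum>k<4. quat_comp k (\<alpha> (Re z, Im z)) *\<^sub>R quat_unit k) + J * (\<Sum>k<4. quat_comp k (\<beta> (Re z, Im z)) *\<^sub>R quat_unit k)"
      by (simp only: quat_sum_comp[symmetric])
    also have "\<dots> = (\<Sum>k<4. slice_emb J (F k z) * quat_unit k)"
      by (simp add: F_def slice_emb_Complex sum_distrib_left sum.distrib[symmetric] algebra_simps)
    finally show "g (slice_emb J z) = (\<Sum>k<4. slice_emb J (F k z) * quat_unit k)" .
  qed
qed

lemma right_slice_hyp_components:
  assumes "right_slice_hyp D g" "open D" "axially_symmetric D"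
  obtains F where "\<And>k. k < 4 \<Longrightarrow> F k holomorphic_on slice quat_e1 D"
    "\<And>k. k < 4 \<Longrightarrow> conj_symmetric_on (slice quat_e1 D) (F k)"
    "\<And>J z. J \<in> imag_units \<Longrightarrow> slice_emb J z \<in> D \<Longrightarrow> g (slice_emb J z) = (\<Sum>k<4. quat_unit k * slice_emb J (F k z))"
proof -
  obtain \<alpha> \<beta> where stem: "stem_pair D \<alpha> \<beta>"
    and g: "\<And>u v J. (u, v) \<in> slice_params D \<Longrightarrow> J \<in> imag_units \<Longrightarrow> g (of_real u + J * of_real v) = \<alpha> (u, v) + \<beta> (u, v) * J"
    using assms(1) unfolding right_slice_hyp_def by fast
  define F where "F k z = Complex (quat_comp k (\<alpha> (Re z, Im z))) (quat_comp k (\<beta> (Re z, Im z)))" for k z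
  show thesis
  proof (rule that[of F])
    show "F k holomorphic_on slice quat_e1 D" "conj_symmetric_on (slice quat_e1 D) (F k)" if "k < 4" for k
      using stem_component[OF stem assms(2,3) bounded_linear_quat_comp[OF that] quat_e1_imag_unit]
      by (simp_all add: F_def[abs_def])
    fix J z assume J: "J \<in> imag_units" and z: "slice_emb J z \<in> D"
    have "g (slice_emb J z) = \<alpha> (Re z, Im z) + \<beta> (Re z, Im z) * J"
      using g[OF _ J] slice_params_iff[OF assms(3) J] z by (simp add: slice_emb_def)
    also have "\<dots> = (\<Sum>k<4. quat_comp k (\<alpha> (Re z, Im z)) *\<^sub>R quat_unit k) + (\<Sum>k<4. quat_comp k (\<beta> (Re z, Im z)) *\<^sub>R quat_unit k) * J"
      by (simp only: quat_sum_comp[symmetric])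
    also have "\<dots> = (\<Sum>k<4. quat_unit k * slice_emb J (F k z))"
      by (simp add: F_def slice_emb_Complex sum_distrib_right sum.distrib[symmetric] algebra_simps)
    finally show "g (slice_emb J z) = (\<Sum>k<4. quat_unit k * slice_emb J (F k z))" .
  qed
qed

text \<open>For real values of \<alpha> and \<beta> the real parts alone form the stem.\<close>

lemma intrinsic_slice_hyp_component:
  assumes "intrinsic_slice_hyp D f" "open D" "axially_symmetric D"
  obtains F where "F holomorphic_on slice quat_e1 D" "conj_symmetric_on (slice quat_e1 D) F"
    "\<And>J z. J \<in> imag_units \<Longrightarrow> slice_emb J z \<in> D \<Longrightarrow> f (slice_emb J z) = slice_emb J (F z)"
proof -
  obtain \<alpha> \<beta> where stem: "stem_pair D \<alpha> \<beta>"
    and r: "\<And>u v. (u, v) \<in> slice_params D \<Longrightarrow> \<alpha> (u, v) \<in> \<real> \<and> \<beta> (u, v) \<in> \<real>"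
    and f: "\<And>u v J. (u, v) \<in> slice_params D \<Longrightarrow> J \<in> imag_units \<Longrightarrow> f (of_real u + J * of_real v) = \<alpha> (u, v) + J * \<beta> (u, v)"
    using assms(1) unfolding intrinsic_slice_hyp_def by fast
  define F where "F z = Complex (qre (\<alpha> (Re z, Im z))) (qre (\<beta> (Re z, Im z)))" for z
  show thesis
  proof (rule that[of F])
    show "F holomorphic_on slice quat_e1 D" "conj_symmetric_on (slice quat_e1 D) F"
      using stem_component[OF stem assms(2,3) bounded_linear_qre quat_e1_imag_unit]
      by (simp_all add: F_def[abs_def])
    fix J z assume J: "J \<in> imag_units" and z: "slice_emb J z \<in> D"
    have p: "(Re z, Im z) \<in> slice_params D" using slice_params_iff[OF assms(3) J] z by simp
    have re: "q = of_real (qre q)" if "q \<in> \<real>" for q :: quat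
      using that by (auto simp: Reals_def of_real_def quat_arith_defs)
    have "f (slice_emb J z) = \<alpha> (Re z, Im z) + J * \<beta> (Re z, Im z)"
      using f[OF p J] by (simp add: slice_emb_def)
    also have "\<dots> = slice_emb J (F z)"
      using re[of "\<alpha> (Re z, Im z)"] re[of "\<beta> (Re z, Im z)"] r[OF p] by (simp add: F_def slice_emb_def)
    finally show "f (slice_emb J z) = slice_emb J (F z)" .
  qed
qed

text \<open>V is the slice of the slice Cauchy domain U. The curves run on its frontier, which
  avoids the open slice itself and stays in the slice of D, because the closure of U does. Axial
  symmetry lets the plane of \<open>quat_e1\<close> stand for that of any J.\<close>

lemma contours_encircles:
  assumes "(J, \<Gamma>) \<in> contours K D" "open D" "axially_symmetric D"
  obtains V where "J \<in> imag_units" "encircles \<Gamma> V (slice quat_e1 D)" "slice quat_e1 K \<subseteq> V"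
proof -
  obtain U where J: "J \<in> imag_units" and U: "slice_cauchy_domain U" "K \<subseteq> U" "closure U \<subseteq> D"
    and ob: "oriented_boundary (slice J U) \<Gamma>"
    using assms(1) unfolding contours_def by blast
  have oU: "open U" and sU: "axially_symmetric U" using U(1) by (auto simp: slice_cauchy_domain_def)
  have e1U: "slice quat_e1 U = slice J U" and e1D: "slice quat_e1 D = slice J D"
    by (intro slice_independent sU assms(3) quat_e1_imag_unit J)+
  have "closed (slice J (closure U))"
    using continuous_closed_vimage[of "closure U" "slice_emb J"] linear_continuous_at[OF bounded_linear_slice_emb]
    by (simp add: slice_def vimage_def)
  then have "closure (slice J U) \<subseteq> slice J (closure U)"
    by (intro closure_minimal) (use closure_subset in \<open>auto simp: slice_def\<close>)
  then have cl: "closure (slice J U) \<subseteq> slice J D" using U(3) by (auto simp: slice_def)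
  have opU: "open (slice J U)" by (rule open_slice[OF oU])
  have js: "jordan_system \<Gamma> (frontier (slice J U))" and w1: "\<forall>z\<in>slice J U. (\<Sum>\<gamma>\<in>\<Gamma>. winding_number \<gamma> z) = 1"
    and w0: "\<forall>z. z \<notin> closure (slice J U) \<longrightarrow> (\<Sum>\<gamma>\<in>\<Gamma>. winding_number \<gamma> z) = 0"
    using ob by (auto simp: oriented_boundary_def)
  have "path_image \<gamma> \<subseteq> slice J D - slice J U" if "\<gamma> \<in> \<Gamma>" for \<gamma>
  proof -
    have "path_image \<gamma> \<subseteq> frontier (slice J U)" using js that by (auto simp: jordan_system_def)
    also have "\<dots> = closure (slice J U) - slice J U" using opU by (simp add: frontier_def interior_open)
    finally show ?thesis using cl by blast
  qed
  moreover have "slice J U \<subseteq> slice J D" using cl closure_subset by blast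
  ultimately have "encircles \<Gamma> (slice J U) (slice quat_e1 D)"
    unfolding encircles_def e1D
    using js w1 w0 opU open_slice[OF assms(2)] cl by (auto simp: jordan_system_def)
  moreover have "slice quat_e1 K \<subseteq> slice J U" using U(2) unfolding e1U[symmetric] by (auto simp: slice_def)
  ultimately show thesis using that J by blast
qed

section \<open>Comparison of all contours with one reference cycle\<close>

lemma slice_calculus_e1: "T \<in> commuting_ops \<Longrightarrow> slice_calculus T quat_e1"
  by (simp add: slice_calculus_def quat_e1_imag_unit)

lemma rho_e1:
  assumes "T \<in> commuting_ops" "slice_calculus T J"
  shows "slice_calculus.rho T J = - slice quat_e1 (S_spectrum T)"
proof -
  interpret A: slice_calculus T J by fact
  interpret B: slice_calculus T quat_e1 by (rule slice_calculus_e1[OF assms(1)])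
  have "A.rho = B.rho" by (simp add: A.rho_eq B.rho_eq)
  then show ?thesis by (auto simp: B.rho_def slice_def S_spectrum_def)
qed

text \<open>The reference cycle may come from a smaller domain \<Omega>0: it still encircles the
  spectrum within the slice of D, so homology and independence of J replace \<Gamma> by \<Gamma>0
  and J by \<open>quat_e1\<close>. The values of one calculus over different contours thus become
  expressions in the same m.\<close>

lemma contour_reference:
  assumes T: "T \<in> commuting_ops" and c: "(J, \<Gamma>) \<in> contours (S_spectrum T) D" and D: "open D" "axially_symmetric D"
    and ref: "encircles \<Gamma>0 V0 \<Omega>0" "slice quat_e1 (S_spectrum T) \<subseteq> V0" "\<Omega>0 \<subseteq> slice quat_e1 D"
  defines "m \<equiv> slice_calculus.M T quat_e1 \<Gamma>0"
  shows "\<exists>V. J \<in> imag_units \<and> slice_calculus T J \<and> encircles \<Gamma> V (slice quat_e1 D) \<and>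
    - slice_calculus.rho T J \<subseteq> V \<and>
    (\<forall>f. f holomorphic_on slice quat_e1 D \<longrightarrow> conj_symmetric_on (slice quat_e1 D) f \<longrightarrow>
      slice_calculus.M T J \<Gamma> f = m f \<and> f_value T (slice_calculus.M T J \<Gamma>) f = f_value T m f \<and>
      Dbar_value T (slice_calculus.M T J \<Gamma>) f = Dbar_value T m f)"
proof -
  obtain V where J: "J \<in> imag_units" and enc: "encircles \<Gamma> V (slice quat_e1 D)" and V: "slice quat_e1 (S_spectrum T) \<subseteq> V"
    using contours_encircles[OF c D] by blast
  interpret A: slice_calculus T J by (simp add: slice_calculus_def T J)
  interpret B: slice_calculus T quat_e1 by (rule slice_calculus_e1[OF T])
  have rA: "- A.rho \<subseteq> V" using V rho_e1[OF T A.slice_calculus_axioms] by simp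
  have rB: "- B.rho \<subseteq> V" "- B.rho \<subseteq> V0" using V ref(2) rho_e1[OF T B.slice_calculus_axioms] by simp_all
  have op: "open (slice quat_e1 D)" by (rule open_slice[OF D(1)])
  have enc0: "encircles \<Gamma>0 V0 (slice quat_e1 D)" by (rule encircles_mono[OF ref(1,3) op])
  have ind: "A.M \<Gamma> f = m f" if "f holomorphic_on slice quat_e1 D" "conj_symmetric_on (slice quat_e1 D) f" for f
    unfolding m_def
    by (rule M_independent_J[OF A.slice_calculus_axioms B.slice_calculus_axioms enc enc0 rA _ that])
      (use rB rho_e1[OF T A.slice_calculus_axioms] ref(2) in auto)
  have "A.M \<Gamma> f = m f \<and> f_value T (A.M \<Gamma>) f = f_value T m f \<and> Dbar_value T (A.M \<Gamma>) f = Dbar_value T m f"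
    if f: "f holomorphic_on slice quat_e1 D" "conj_symmetric_on (slice quat_e1 D) f" for f
  proof -
    have zf: "(\<lambda>z. z * f z) holomorphic_on slice quat_e1 D" by (intro holomorphic_intros f)
    note zs = conj_symmetric_on_ident_mult[OF f(2)]
    note d = ind[OF holomorphic_deriv[OF _ op] conj_symmetric_on_deriv[OF op]]
    show ?thesis by (simp add: f_value_def Dbar_value_def ind[OF f] ind[OF zf zs] d[OF f(1) f] d[OF zf zf zs])
  qed
  then show ?thesis using J A.slice_calculus_axioms enc rA by blast
qed

lemma contour_values_L:
  assumes T: "T \<in> commuting_ops" and c: "c \<in> contours (S_spectrum T) D" and D: "open D" "axially_symmetric D"
    and ref: "encircles \<Gamma>0 V0 \<Omega>0" "slice quat_e1 (S_spectrum T) \<subseteq> V0" "\<Omega>0 \<subseteq> slice quat_e1 D"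
    and I: "finite I" and F: "\<And>k. k \<in> I \<Longrightarrow> F k holomorphic_on slice quat_e1 D"
      "\<And>k. k \<in> I \<Longrightarrow> conj_symmetric_on (slice quat_e1 D) (F k)"
    and g: "\<And>J z. J \<in> imag_units \<Longrightarrow> slice_emb J z \<in> D \<Longrightarrow> g (slice_emb J z) = (\<Sum>k\<in>I. slice_emb J (F k z) * e k)"
  defines "m \<equiv> slice_calculus.M T quat_e1 \<Gamma>0"
  shows "D_calc_L c g T = (\<Sum>k\<in>I. ((-2) *\<^sub>R m (F k)) o\<^sub>L lmul (e k))"
    "calc_L c g T = (\<Sum>k\<in>I. f_value T m (F k) o\<^sub>L lmul (e k))"
    "Dbar_calc_L c g T = (\<Sum>k\<in>I. Dbar_value T m (F k) o\<^sub>L lmul (e k))"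
proof -
  obtain J \<Gamma> where cJ: "c = (J, \<Gamma>)" by (cases c)
  obtain V where J: "J \<in> imag_units" and A: "slice_calculus T J" and enc: "encircles \<Gamma> V (slice quat_e1 D)"
    and V: "- slice_calculus.rho T J \<subseteq> V"
    and ind: "\<And>f. f holomorphic_on slice quat_e1 D \<Longrightarrow> conj_symmetric_on (slice quat_e1 D) f \<Longrightarrow>
      slice_calculus.M T J \<Gamma> f = m f \<and> f_value T (slice_calculus.M T J \<Gamma>) f = f_value T m f \<and>
      Dbar_value T (slice_calculus.M T J \<Gamma>) f = Dbar_value T m f"
    using contour_reference[OF T c[unfolded cJ] D ref] unfolding m_def by blast
  interpret A: slice_calculus T J by (rule A)
  have g': "g (slice_emb J z) = (\<Sum>k\<in>I. slice_emb J (F k z) * e k)" if "z \<in> slice quat_e1 D" for z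
    using g[OF J] that slice_independent[OF D(2) J quat_e1_imag_unit] by (auto simp: slice_def)
  have val: "D_calc_L (J, \<Gamma>) g T = (\<Sum>k\<in>I. ((-2) *\<^sub>R A.M \<Gamma> (F k)) o\<^sub>L lmul (e k))"
    "calc_L (J, \<Gamma>) g T = (\<Sum>k\<in>I. f_value T (A.M \<Gamma>) (F k) o\<^sub>L lmul (e k))"
    "Dbar_calc_L (J, \<Gamma>) g T = (\<Sum>k\<in>I. Dbar_value T (A.M \<Gamma>) (F k) o\<^sub>L lmul (e k))"
    by (rule A.calc_L_values[OF enc V I F(1) g']; assumption)+
  show "D_calc_L c g T = (\<Sum>k\<in>I. ((-2) *\<^sub>R m (F k)) o\<^sub>L lmul (e k))"
    "calc_L c g T = (\<Sum>k\<in>I. f_value T m (F k) o\<^sub>L lmul (e k))"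
    "Dbar_calc_L c g T = (\<Sum>k\<in>I. Dbar_value T m (F k) o\<^sub>L lmul (e k))"
    unfolding cJ val by (intro sum.cong refl; simp only: ind[OF F])+
qed

lemma contour_values_R:
  assumes T: "T \<in> commuting_ops" and c: "c \<in> contours (S_spectrum T) D" and D: "open D" "axially_symmetric D"
    and ref: "encircles \<Gamma>0 V0 \<Omega>0" "slice quat_e1 (S_spectrum T) \<subseteq> V0" "\<Omega>0 \<subseteq> slice quat_e1 D"
    and I: "finite I" and F: "\<And>k. k \<in> I \<Longrightarrow> F k holomorphic_on slice quat_e1 D"
      "\<And>k. k \<in> I \<Longrightarrow> conj_symmetric_on (slice quat_e1 D) (F k)"
    and g: "\<And>J z. J \<in> imag_units \<Longrightarrow> slice_emb J z \<in> D \<Longrightarrow> g (slice_emb J z) = (\<Sum>k\<in>I. e k * slice_emb J (F k z))"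
  defines "m \<equiv> slice_calculus.M T quat_e1 \<Gamma>0"
  shows "D_calc_R c g T = (\<Sum>k\<in>I. lmul (e k) o\<^sub>L ((-2) *\<^sub>R m (F k)))"
    "calc_R c g T = (\<Sum>k\<in>I. lmul (e k) o\<^sub>L f_value T m (F k))"
    "Dbar_calc_R c g T = (\<Sum>k\<in>I. lmul (e k) o\<^sub>L Dbar_value T m (F k))"
proof -
  obtain J \<Gamma> where cJ: "c = (J, \<Gamma>)" by (cases c)
  obtain V where J: "J \<in> imag_units" and A: "slice_calculus T J" and enc: "encircles \<Gamma> V (slice quat_e1 D)"
    and V: "- slice_calculus.rho T J \<subseteq> V"
    and ind: "\<And>f. f holomorphic_on slice quat_e1 D \<Longrightarrow> conj_symmetric_on (slice quat_e1 D) f \<Longrightarrow>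
      slice_calculus.M T J \<Gamma> f = m f \<and> f_value T (slice_calculus.M T J \<Gamma>) f = f_value T m f \<and>
      Dbar_value T (slice_calculus.M T J \<Gamma>) f = Dbar_value T m f"
    using contour_reference[OF T c[unfolded cJ] D ref] unfolding m_def by blast
  interpret A: slice_calculus T J by (rule A)
  have g': "g (slice_emb J z) = (\<Sum>k\<in>I. e k * slice_emb J (F k z))" if "z \<in> slice quat_e1 D" for z
    using g[OF J] that slice_independent[OF D(2) J quat_e1_imag_unit] by (auto simp: slice_def)
  have val: "D_calc_R (J, \<Gamma>) g T = (\<Sum>k\<in>I. lmul (e k) o\<^sub>L ((-2) *\<^sub>R A.M \<Gamma> (F k)))"
    "calc_R (J, \<Gamma>) g T = (\<Sum>k\<in>I. lmul (e k) o\<^sub>L f_value T (A.M \<Gamma>) (F k))"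
    "Dbar_calc_R (J, \<Gamma>) g T = (\<Sum>k\<in>I. lmul (e k) o\<^sub>L Dbar_value T (A.M \<Gamma>) (F k))"
    by (rule A.calc_R_values[OF enc V I F g']; assumption)+
  show "D_calc_R c g T = (\<Sum>k\<in>I. lmul (e k) o\<^sub>L ((-2) *\<^sub>R m (F k)))"
    "calc_R c g T = (\<Sum>k\<in>I. lmul (e k) o\<^sub>L f_value T m (F k))"
    "Dbar_calc_R c g T = (\<Sum>k\<in>I. lmul (e k) o\<^sub>L Dbar_value T m (F k))"
    unfolding cJ val by (intro sum.cong refl; simp only: ind[OF F])+
qed

section \<open>The product formulas for left and right slice hyperholomorphic functions\<close>

lemma slice_Int: "slice J (A \<inter> B) = slice J A \<inter> slice J B"
  by (auto simp: slice_def)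

lemma axially_symmetric_Int: "axially_symmetric A \<Longrightarrow> axially_symmetric B \<Longrightarrow> axially_symmetric (A \<inter> B)"
  unfolding axially_symmetric_def by blast

lemma reference_product_rule:
  assumes T: "T \<in> commuting_ops" and ref: "encircles \<Gamma> V (\<Omega> \<inter> \<Omega>')" "slice quat_e1 (S_spectrum T) \<subseteq> V"
    and f: "f holomorphic_on \<Omega>" "conj_symmetric_on \<Omega> f" and g: "g holomorphic_on \<Omega>'" "conj_symmetric_on \<Omega>' g"
  defines "m \<equiv> slice_calculus.M T quat_e1 \<Gamma>"
  shows "Dbar_value T m (\<lambda>z. f z * g z) = (f_value T m f o\<^sub>L Dbar_value T m g) + (Dbar_value T m f o\<^sub>L f_value T m g) -
    (((-2) *\<^sub>R m f) o\<^sub>L vec_op T o\<^sub>L ((-2) *\<^sub>R m g))"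
proof -
  interpret B: slice_calculus T quat_e1 by (rule slice_calculus_e1[OF T])
  have r: "- B.rho \<subseteq> V" using ref(2) rho_e1[OF T B.slice_calculus_axioms] by simp
  note op = encirclesD(3)[OF ref(1)]
  have f': "f holomorphic_on \<Omega> \<inter> \<Omega>'" "conj_symmetric_on (\<Omega> \<inter> \<Omega>') f"
    and g': "g holomorphic_on \<Omega> \<inter> \<Omega>'" "conj_symmetric_on (\<Omega> \<inter> \<Omega>') g"
    using f g conj_symmetric_on_Int[OF f(2) g(2)] by (auto elim: holomorphic_on_subset)
  show ?thesis
    unfolding m_def
    by (intro B.M_product_rule[OF ref(1) r f' g'] conj_symmetric_on_deriv conj_symmetric_on_ident_mult op f' g')
qed

text \<open>On each slice f g has the components \<phi> F k with the same constants on the right,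
  since \<phi> and F k take values in one commutative plane. The product rule for each component is
  multiplied by its constant and summed.\<close>

lemma Dbar_product_L:
  fixes T :: "'x::banach qop"
  assumes T: "T \<in> commuting_ops" and f: "(Df, f) \<in> SH_intrinsic (S_spectrum T)" and g: "(Dg, g) \<in> SH_L (S_spectrum T)"
    and c: "c \<in> contours (S_spectrum T) (Df \<inter> Dg)"
    and a: "a1 \<in> contours (S_spectrum T) Df" "a2 \<in> contours (S_spectrum T) Df" "a3 \<in> contours (S_spectrum T) Df"
    and b: "b1 \<in> contours (S_spectrum T) Dg" "b2 \<in> contours (S_spectrum T) Dg" "b3 \<in> contours (S_spectrum T) Dg"
  shows "Dbar_calc_L c (\<lambda>q. f q * g q) T =
    (calc_L a1 f T o\<^sub>L Dbar_calc_L b1 g T) + (Dbar_calc_L a2 f T o\<^sub>L calc_L b2 g T)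
    - (D_calc_L a3 f T o\<^sub>L vec_op T o\<^sub>L D_calc_L b3 g T)"
proof -
  have Df: "open Df" "axially_symmetric Df" "intrinsic_slice_hyp Df f"
    and Dg: "open Dg" "axially_symmetric Dg" "left_slice_hyp Dg g"
    using f g by (auto simp: SH_intrinsic_def SH_L_def)
  obtain \<phi> where \<phi>: "\<phi> holomorphic_on slice quat_e1 Df" "conj_symmetric_on (slice quat_e1 Df) \<phi>"
    "\<And>J z. J \<in> imag_units \<Longrightarrow> slice_emb J z \<in> Df \<Longrightarrow> f (slice_emb J z) = slice_emb J (\<phi> z)"
    using intrinsic_slice_hyp_component[OF Df(3,1,2)] by blast
  obtain F where F: "\<And>k. k < 4 \<Longrightarrow> F k holomorphic_on slice quat_e1 Dg"
    "\<And>k. k < 4 \<Longrightarrow> conj_symmetric_on (slice quat_e1 Dg) (F k)"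
    "\<And>J z. J \<in> imag_units \<Longrightarrow> slice_emb J z \<in> Dg \<Longrightarrow> g (slice_emb J z) = (\<Sum>k<4. slice_emb J (F k z) * quat_unit k)"
    using left_slice_hyp_components[OF Dg(3,1,2)] by blast
  have D: "open (Df \<inter> Dg)" "axially_symmetric (Df \<inter> Dg)"
    using Df Dg by (auto intro: axially_symmetric_Int)
  obtain J \<Gamma> where cJ: "c = (J, \<Gamma>)" by (cases c)
  obtain V where enc: "encircles \<Gamma> V (slice quat_e1 (Df \<inter> Dg))" and V: "slice quat_e1 (S_spectrum T) \<subseteq> V"
    using contours_encircles[OF c[unfolded cJ] D] by blast
  \<comment> \<open>The cycle of c serves as reference for all terms, as it lies in both domains;
    only its unit is replaced by \<open>quat_e1\<close>.\<close>
  define m where "m = slice_calculus.M T quat_e1 \<Gamma>"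
  \<comment> \<open>A sum with one term, so that the evaluation of the left calculus applies to f as
    well as to g.\<close>
  have fe: "f (slice_emb J z) = (\<Sum>k\<in>{0::nat}. slice_emb J (\<phi> z) * 1)" if "J \<in> imag_units" "slice_emb J z \<in> Df" for J z
    using \<phi>(3)[OF that] by simp
  have sub: "slice quat_e1 (Df \<inter> Dg) \<subseteq> slice quat_e1 Df" "slice quat_e1 (Df \<inter> Dg) \<subseteq> slice quat_e1 Dg"
    by (auto simp: slice_Int)
  note fv = contour_values_L[OF T _ Df(1,2) enc V sub(1) _ \<phi>(1,2) fe, folded m_def]
  note gv = contour_values_L[OF T _ Dg(1,2) enc V sub(2) finite_lessThan[of 4], of _ F g quat_unit, folded m_def]
  have fgh: "(\<lambda>z. \<phi> z * F k z) holomorphic_on slice quat_e1 (Df \<inter> Dg)"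
    "conj_symmetric_on (slice quat_e1 (Df \<inter> Dg)) (\<lambda>z. \<phi> z * F k z)" if "k < 4" for k
    unfolding slice_Int using \<phi>(1,2) F(1,2)[OF that] conj_symmetric_on_Int[OF \<phi>(2) F(2)[OF that]]
    by (auto intro!: holomorphic_intros conj_symmetric_on_mult elim: holomorphic_on_subset)
  have fge: "f (slice_emb J z) * g (slice_emb J z) = (\<Sum>k<4. slice_emb J (\<phi> z * F k z) * quat_unit k)"
    if "J \<in> imag_units" "slice_emb J z \<in> Df \<inter> Dg" for J z
    using that \<phi>(3) F(3) by (simp add: slice_emb_mult sum_distrib_left mult.assoc)
  have "Dbar_calc_L c (\<lambda>q. f q * g q) T = (\<Sum>k<4. Dbar_value T m (\<lambda>z. \<phi> z * F k z) o\<^sub>L lmul (quat_unit k))"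
    unfolding m_def
    by (rule contour_values_L(3)[OF T c D enc V order_refl finite_lessThan]) (use fgh fge in auto)
  also have "\<dots> = (\<Sum>k<4. ((f_value T m \<phi> o\<^sub>L Dbar_value T m (F k)) +
    (Dbar_value T m \<phi> o\<^sub>L f_value T m (F k)) -
    (((-2) *\<^sub>R m \<phi>) o\<^sub>L vec_op T o\<^sub>L ((-2) *\<^sub>R m (F k)))) o\<^sub>L lmul (quat_unit k))"
    unfolding m_def
    by (intro sum.cong refl arg_cong[where f = "\<lambda>A. A o\<^sub>L lmul _"]
        reference_product_rule[OF T enc[unfolded slice_Int] V \<phi>(1,2) F(1,2)]) auto
  also have "\<dots> = (f_value T m \<phi> o\<^sub>L
      (\<Sum>k<4. Dbar_value T m (F k) o\<^sub>L lmul (quat_unit k))) +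
    (Dbar_value T m \<phi> o\<^sub>L
      (\<Sum>k<4. f_value T m (F k) o\<^sub>L lmul (quat_unit k))) -
    (((-2) *\<^sub>R m \<phi>) o\<^sub>L vec_op T o\<^sub>L (\<Sum>k<4. ((-2) *\<^sub>R m (F k)) o\<^sub>L lmul (quat_unit k)))"
    unfolding blinfun_compose.sum_right sum.distrib[symmetric] sum_subtractf[symmetric]
    by (intro sum.cong refl)
      (simp only: blinfun_compose_assoc blinfun_compose.add_left blinfun_compose.diff_left[of _ "((-2) *\<^sub>R m \<phi>) o\<^sub>L _"])
  also have "f_value T m \<phi> = calc_L a1 f T"
    using fv(2)[OF a(1)] by simp
  also have "Dbar_value T m \<phi> = Dbar_calc_L a2 f T"
    using fv(3)[OF a(2)] by simp
  also have "(-2) *\<^sub>R m \<phi> = D_calc_L a3 f T"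
    using fv(1)[OF a(3)] by simp
  also have "(\<Sum>k<4. Dbar_value T m (F k) o\<^sub>L lmul (quat_unit k)) = Dbar_calc_L b1 g T"
    by (rule gv(3)[OF b(1), symmetric]) (use F in auto)
  also have "(\<Sum>k<4. f_value T m (F k) o\<^sub>L lmul (quat_unit k)) = calc_L b2 g T"
    by (rule gv(2)[OF b(2), symmetric]) (use F in auto)
  also have "(\<Sum>k<4. ((-2) *\<^sub>R m (F k)) o\<^sub>L lmul (quat_unit k)) = D_calc_L b3 g T"
    by (rule gv(1)[OF b(3), symmetric]) (use F in auto)
  finally show ?thesis .
qed

text \<open>The mirror image: the constants stand on the left, and the factor g comes first in each
  product.\<close>

lemma Dbar_product_R:
  fixes T :: "'x::banach qop"
  assumes T: "T \<in> commuting_ops" and f: "(Df, f) \<in> SH_intrinsic (S_spectrum T)" and g: "(Dg, g) \<in> SH_R (S_spectrum T)"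
    and c: "c \<in> contours (S_spectrum T) (Df \<inter> Dg)"
    and a: "a1 \<in> contours (S_spectrum T) Df" "a2 \<in> contours (S_spectrum T) Df" "a3 \<in> contours (S_spectrum T) Df"
    and b: "b1 \<in> contours (S_spectrum T) Dg" "b2 \<in> contours (S_spectrum T) Dg" "b3 \<in> contours (S_spectrum T) Dg"
  shows "Dbar_calc_R c (\<lambda>q. g q * f q) T =
    (calc_R b1 g T o\<^sub>L Dbar_calc_L a1 f T) + (Dbar_calc_R b2 g T o\<^sub>L calc_L a2 f T)
    - (D_calc_R b3 g T o\<^sub>L vec_op T o\<^sub>L D_calc_L a3 f T)"
proof -
  have Df: "open Df" "axially_symmetric Df" "intrinsic_slice_hyp Df f"
    and Dg: "open Dg" "axially_symmetric Dg" "right_slice_hyp Dg g"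
    using f g by (auto simp: SH_intrinsic_def SH_R_def)
  obtain \<phi> where \<phi>: "\<phi> holomorphic_on slice quat_e1 Df" "conj_symmetric_on (slice quat_e1 Df) \<phi>"
    "\<And>J z. J \<in> imag_units \<Longrightarrow> slice_emb J z \<in> Df \<Longrightarrow> f (slice_emb J z) = slice_emb J (\<phi> z)"
    using intrinsic_slice_hyp_component[OF Df(3,1,2)] by blast
  obtain F where F: "\<And>k. k < 4 \<Longrightarrow> F k holomorphic_on slice quat_e1 Dg"
    "\<And>k. k < 4 \<Longrightarrow> conj_symmetric_on (slice quat_e1 Dg) (F k)"
    "\<And>J z. J \<in> imag_units \<Longrightarrow> slice_emb J z \<in> Dg \<Longrightarrow> g (slice_emb J z) = (\<Sum>k<4. quat_unit k * slice_emb J (F k z))"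
    using right_slice_hyp_components[OF Dg(3,1,2)] by blast
  have D: "open (Df \<inter> Dg)" "axially_symmetric (Df \<inter> Dg)"
    using Df Dg by (auto intro: axially_symmetric_Int)
  obtain J \<Gamma> where cJ: "c = (J, \<Gamma>)" by (cases c)
  obtain V where enc: "encircles \<Gamma> V (slice quat_e1 (Df \<inter> Dg))" and V: "slice quat_e1 (S_spectrum T) \<subseteq> V"
    using contours_encircles[OF c[unfolded cJ] D] by blast
  \<comment> \<open>The domains are exchanged because the product rule is now applied with F k first
    and \<phi> second.\<close>
  have enc': "encircles \<Gamma> V (slice quat_e1 Dg \<inter> slice quat_e1 Df)"
    using enc by (simp add: slice_Int Int_commute)
  define m where "m = slice_calculus.M T quat_e1 \<Gamma>"
  have fe: "f (slice_emb J z) = (\<Sum>k\<in>{0::nat}. slice_emb J (\<phi> z) * 1)" if "J \<in> imag_units" "slice_emb J z \<in> Df" for J z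
    using \<phi>(3)[OF that] by simp
  have sub: "slice quat_e1 (Df \<inter> Dg) \<subseteq> slice quat_e1 Df" "slice quat_e1 (Df \<inter> Dg) \<subseteq> slice quat_e1 Dg"
    by (auto simp: slice_Int)
  \<comment> \<open>The intrinsic factor is evaluated by the left calculus in this formula too; its
    constant is 1, so nothing depends on the side.\<close>
  note fv = contour_values_L[OF T _ Df(1,2) enc V sub(1) _ \<phi>(1,2) fe, folded m_def]
  note gv = contour_values_R[OF T _ Dg(1,2) enc V sub(2) finite_lessThan[of 4], of _ F g quat_unit, folded m_def]
  have fgh: "(\<lambda>z. F k z * \<phi> z) holomorphic_on slice quat_e1 (Df \<inter> Dg)"
    "conj_symmetric_on (slice quat_e1 (Df \<inter> Dg)) (\<lambda>z. F k z * \<phi> z)" if "k < 4" for k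
    unfolding slice_Int using \<phi>(1,2) F(1,2)[OF that] conj_symmetric_on_Int[OF \<phi>(2) F(2)[OF that]]
    by (auto intro!: holomorphic_intros conj_symmetric_on_mult elim: holomorphic_on_subset)
  have fge: "g (slice_emb J z) * f (slice_emb J z) = (\<Sum>k<4. quat_unit k * slice_emb J (F k z * \<phi> z))"
    if "J \<in> imag_units" "slice_emb J z \<in> Df \<inter> Dg" for J z
    using that \<phi>(3) F(3) by (simp add: slice_emb_mult sum_distrib_right mult.assoc)
  have "Dbar_calc_R c (\<lambda>q. g q * f q) T = (\<Sum>k<4. lmul (quat_unit k) o\<^sub>L Dbar_value T m (\<lambda>z. F k z * \<phi> z))"
    unfolding m_def
    by (rule contour_values_R(3)[OF T c D enc V order_refl finite_lessThan]) (use fgh fge in auto)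
  also have "\<dots> = (\<Sum>k<4. lmul (quat_unit k) o\<^sub>L ((f_value T m (F k) o\<^sub>L Dbar_value T m \<phi>) +
    (Dbar_value T m (F k) o\<^sub>L f_value T m \<phi>) -
    (((-2) *\<^sub>R m (F k)) o\<^sub>L vec_op T o\<^sub>L ((-2) *\<^sub>R m \<phi>))))"
    unfolding m_def
    by (intro sum.cong refl arg_cong[where f = "\<lambda>A. lmul _ o\<^sub>L A"]
        reference_product_rule[OF T enc' V F(1,2) \<phi>(1,2)]) auto
  also have "\<dots> = ((\<Sum>k<4. lmul (quat_unit k) o\<^sub>L f_value T m (F k)) o\<^sub>L Dbar_value T m \<phi>) +
    ((\<Sum>k<4. lmul (quat_unit k) o\<^sub>L Dbar_value T m (F k)) o\<^sub>L f_value T m \<phi>) -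
    ((\<Sum>k<4. lmul (quat_unit k) o\<^sub>L ((-2) *\<^sub>R m (F k))) o\<^sub>L vec_op T o\<^sub>L ((-2) *\<^sub>R m \<phi>))"
    unfolding blinfun_compose.sum_left sum.distrib[symmetric] sum_subtractf[symmetric]
    by (intro sum.cong refl)
      (simp only: blinfun_compose_assoc blinfun_compose.add_right blinfun_compose.diff_right[of _ _ "((-2) *\<^sub>R m (F _)) o\<^sub>L _"])
  also have "Dbar_value T m \<phi> = Dbar_calc_L a1 f T"
    using fv(3)[OF a(1)] by simp
  also have "f_value T m \<phi> = calc_L a2 f T"
    using fv(2)[OF a(2)] by simp
  also have "(-2) *\<^sub>R m \<phi> = D_calc_L a3 f T"
    using fv(1)[OF a(3)] by simp
  also have "(\<Sum>k<4. lmul (quat_unit k) o\<^sub>L f_value T m (F k)) = calc_R b1 g T"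
    by (rule gv(2)[OF b(1), symmetric]) (use F in auto)
  also have "(\<Sum>k<4. lmul (quat_unit k) o\<^sub>L Dbar_value T m (F k)) = Dbar_calc_R b2 g T"
    by (rule gv(3)[OF b(2), symmetric]) (use F in auto)
  also have "(\<Sum>k<4. lmul (quat_unit k) o\<^sub>L ((-2) *\<^sub>R m (F k))) = D_calc_R b3 g T"
    by (rule gv(1)[OF b(3), symmetric]) (use F in auto)
  finally show ?thesis .
qed

theorem theorem4p6:
  fixes T :: "'x::banach qop" and f :: "quat \<Rightarrow> quat" and Df :: "quat set"
  assumes "T \<in> commuting_ops"
    and "(Df, f) \<in> SH_intrinsic (S_spectrum T)"
  shows
    "(\<forall>Dg g. (Dg, g) \<in> SH_L (S_spectrum T) \<longrightarrow>
       (\<forall>c \<in> contours (S_spectrum T) (Df \<inter> Dg).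
        \<forall>a1 \<in> contours (S_spectrum T) Df. \<forall>a2 \<in> contours (S_spectrum T) Df.
        \<forall>a3 \<in> contours (S_spectrum T) Df.
        \<forall>b1 \<in> contours (S_spectrum T) Dg. \<forall>b2 \<in> contours (S_spectrum T) Dg.
        \<forall>b3 \<in> contours (S_spectrum T) Dg.
          Dbar_calc_L c (\<lambda>q. f q * g q) T =
            (calc_L a1 f T o\<^sub>L Dbar_calc_L b1 g T)
            + (Dbar_calc_L a2 f T o\<^sub>L calc_L b2 g T)
            - (D_calc_L a3 f T o\<^sub>L vec_op T o\<^sub>L D_calc_L b3 g T)))
     \<and>
     (\<forall>Dg g. (Dg, g) \<in> SH_R (S_spectrum T) \<longrightarrow>
       (\<forall>c \<in> contours (S_spectrum T) (Df \<inter> Dg).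
        \<forall>a1 \<in> contours (S_spectrum T) Df. \<forall>a2 \<in> contours (S_spectrum T) Df.
        \<forall>a3 \<in> contours (S_spectrum T) Df.
        \<forall>b1 \<in> contours (S_spectrum T) Dg. \<forall>b2 \<in> contours (S_spectrum T) Dg.
        \<forall>b3 \<in> contours (S_spectrum T) Dg.
          Dbar_calc_R c (\<lambda>q. g q * f q) T =
            (calc_R b1 g T o\<^sub>L Dbar_calc_L a1 f T)
            + (Dbar_calc_R b2 g T o\<^sub>L calc_L a2 f T)
            - (D_calc_R b3 g T o\<^sub>L vec_op T o\<^sub>L D_calc_L a3 f T)))"
  using Dbar_product_L[OF assms] Dbar_product_R[OF assms] by blast

end
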